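(* Let $\mathbf a=\{a_k\}_{k\ge0}$ with $\operatorname{Im}a_k>0$ satisfy $$\lim_{n\to\infty}\sum_{k=0}^{n-1}\frac{|\operatorname{Im}a_k|}{1+|a_k|^2}=+\infty .$$ Then for every $1<p<\infty$ and every $f\in L_p(\mathbb R)$, $$\lim_{n\to\infty}\int_{-\infty}^{\infty}\big|f(x)-S_n(f;\mathbf a;x)\big|^p\,dx=0 .$$
   Context: Let $\Phi_n^+$ ($n\ge0$) be built from $\mathbf a$ and $\Phi_n^-$ ($n\ge1$) from $b_k:=\overline{a_{k-1}}$ ($k\ge1$) as follows: $\chi_k^+:=\frac{|1+a_k^2|}{1+a_k^2}$, $B_0^+:=1$, $B_n^+(z):=\prod_{k=0}^{n-1}\chi_k^+\frac{z-a_k}{z-\overline{a_k}}$, $\Phi_n^+(z):=\frac{\sqrt{\operatorname{Im}a_n}}{z-\overline{a_n}}B_n^+(z)$; $\chi_k^-:=\frac{|1+b_k^2|}{1+b_k^2}$, $B_1^-:=1$, $B_n^-(z):=\prod_{k=1}^{n-1}\chi_k^-\frac{z-b_k}{z-\overline{b_k}}$, $\Phi_n^-(z):=\frac{\sqrt{-\operatorname{Im}b_n}}{z-\overline{b_n}}B_n^-(z)$ (unimodular constants $\chi$ taken to be $1$ if the denominator vanishes); $\Phi_n:=\Phi_n^+$ for $n\ge0$, $\Phi_n:=\Phi_{-n}^-$ for $n\le-1$. For $f\in L_p(\mathbb R)$ (each $\Phi_k\in L_q(\mathbb R)$, $1/p+1/q=1$) let $c_k:=\frac1\pi\int_{-\infty}^\infty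 f(t)\overline{\Phi_k(t)}\,dt$ and $S_n(f;\mathbf a;x):=\sum_{k=-n}^{n-1}c_k\Phi_k(x)$. *)

theory Defs
  imports "HOL-Analysis.Analysis"
begin

definition chi :: "complex \<Rightarrow> complex" where
  "chi w = (if 1 + w^2 = 0 then 1 else complex_of_real (cmod (1 + w^2)) / (1 + w^2))"

definition Bplus :: "(nat \<Rightarrow> complex) \<Rightarrow> nat \<Rightarrow> complex \<Rightarrow> complex" where
  "Bplus a n z = (\<Prod>k<n. chi (a k) * ((z - a k) / (z - cnj (a k))))"

definition Phiplus :: "(nat \<Rightarrow> complex) \<Rightarrow> nat \<Rightarrow> complex \<Rightarrow> complex" where
  "Phiplus a n z = complex_of_real (sqrt (Im (a n))) / (z - cnj (a n)) * Bplus a n z"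

definition bseq :: "(nat \<Rightarrow> complex) \<Rightarrow> nat \<Rightarrow> complex" where
  "bseq a k = cnj (a (k - 1))"

definition Bminus :: "(nat \<Rightarrow> complex) \<Rightarrow> nat \<Rightarrow> complex \<Rightarrow> complex" where
  "Bminus a n z = (\<Prod>k\<in>{1..<n}. chi (bseq a k) * ((z - bseq a k) / (z - cnj (bseq a k))))"

definition Phiminus :: "(nat \<Rightarrow> complex) \<Rightarrow> nat \<Rightarrow> complex \<Rightarrow> complex" where
  "Phiminus a n z = complex_of_real (sqrt (- Im (bseq a n))) / (z - cnj (bseq a n)) * Bminus a n z"

definition Phi :: "(nat \<Rightarrow> complex) \<Rightarrow> int \<Rightarrow> complex \<Rightarrow> complex" where
  "Phi a k z = (if k \<ge> 0 then Phiplus a (nat k) z else Phiminus a (nat (- k)) z)"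

definition coef :: "(nat \<Rightarrow> complex) \<Rightarrow> (real \<Rightarrow> complex) \<Rightarrow> int \<Rightarrow> complex" where
  "coef a f k = (1 / complex_of_real pi) *
     (\<integral>t. f t * cnj (Phi a k (complex_of_real t)) \<partial>lborel)"

definition Spart :: "(real \<Rightarrow> complex) \<Rightarrow> (nat \<Rightarrow> complex) \<Rightarrow> nat \<Rightarrow> real \<Rightarrow> complex" where
  "Spart f a n x = (\<Sum>k\<in>{- int n..<int n}. coef a f k * Phi a k (complex_of_real x))"

end

theory Submission
  imports
    Defs
    "HOL-Complex_Analysis.Complex_Analysis"
    "HOL-Probability.Probability"
begin

text \<open>
  On the real line \<open>\<Phi>\<^sub>-\<^sub>k\<^sub>-\<^sub>1\<close> is the conjugate of \<open>\<Phi>\<^sub>k\<close>, so \<open>S\<^sub>n f = P\<^sub>n f + cnj (P\<^sub>n (cnj f))\<close> with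
  \<open>P\<^sub>n\<close> the sum over \<open>0 \<le> k < n\<close>. The Christoffel-Darboux identity turns \<open>P\<^sub>n f\<close> in the upper half
  plane into \<open>C f - B\<^sub>n C (f cnj B\<^sub>n)\<close>, where \<open>C\<close> is the Cauchy transform and \<open>\<bar>B\<^sub>n\<bar> \<le> 1\<close>. Hence
  M. Riesz's theorem for \<open>C\<close> bounds \<open>P\<^sub>n\<close> on \<open>L\<^sub>p\<close> uniformly in \<open>n\<close> when \<open>1 < p \<le> 2\<close>, and duality
  does so for \<open>p \<ge> 2\<close>. By density it remains to treat averages over intervals \<open>s \<in> [\<alpha>, \<beta>]\<close> of
  Poisson kernels with pole \<open>w = s + \<i> y\<close>: there the error is at most a multiple of
  \<open>sup \<bar>B\<^sub>n w\<bar> / (1 + \<bar>x\<bar>)\<close>, and \<open>B\<^sub>n\<close> tends to \<open>0\<close> because the Blaschke condition fails.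
\<close>

text \<open>No boundary values of the Cauchy transform on the real line are used. \<open>C\<close>
  is estimated on each line of height \<open>y > 0\<close> with a constant free of \<open>y\<close>;
  a partial sum is a finite sum of functions continuous up to the axis, so Fatou's lemma carries the
  bound down to \<open>y = 0\<close>. Functions of bounded support come first because their
  transforms decay at infinity, as Cauchy's theorem on large half discs requires. The range
  \<open>p \<le> 2\<close> comes from the power \<open>F powr p\<close>: its argument
  \<open>p * Arg F\<close> then stays within \<open>[-pi, pi]\<close>.

  Poisson kernels serve as test functions because twice the real part of the Cauchy kernel is the
  Poisson kernel: Christoffel-Darboux at the pole \<open>w\<close> shows that the partial sum
  returns the kernel itself up to one term with the factor \<open>B_n w\<close>. They are averaged
  because the averages over an interval tend to its indicator as \<open>y\<close> tends to
  \<open>0\<close>, and intervals generate the Borel sets. The uniform bound makes the class of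
  functions with convergent expansions closed in \<open>L_p\<close>, which turns this into a density
  argument.\<close>

section \<open>Real powers and an inequality in the right half plane\<close>

lemma powr_add_le:
  fixes a b p :: real
  assumes "0 \<le> a" "0 \<le> b" "0 < p"
  shows "(a + b) powr p \<le> 2 powr p * (a powr p + b powr p)"
proof -
  have "(a + b) powr p \<le> (2 * max a b) powr p"
    using assms by (intro powr_mono2) auto
  also have "\<dots> = 2 powr p * max a b powr p"
    using assms by (simp add: powr_mult)
  also have "\<dots> \<le> 2 powr p * (a powr p + b powr p)"
    by (intro mult_left_mono) (auto simp: max_def)
  finally show ?thesis .
qed

text \<open>
  Near \<open>Arg z = \<plusminus>\<pi>/2\<close> the right-hand side is controlled by \<open>cos (p \<pi>/2) < 0\<close>. For a holomorphic \<open>F\<close> with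
  \<open>Re F > 0\<close> the last term integrates to \<open>0\<close> along the line, so \<open>Re F\<close> alone bounds \<open>F\<close> in \<open>L\<^sub>p\<close>.
\<close>

lemma riesz_angle_inequality:
  fixes p :: real
  assumes "1 < p" "p \<le> 2"
  obtains A B :: real where "A \<ge> 0" "B \<ge> 0"
    "\<And>z. Re z > 0 \<Longrightarrow> cmod z powr p \<le> A * Re z powr p - B * Re (z powr of_real p)"
proof -
  \<comment> \<open>Any \<open>s\<close> strictly between \<open>pi / (2 * p)\<close> and
    \<open>pi / 2\<close> would do: beyond \<open>s\<close> the angle \<open>p * \<theta>\<close>
    lies past \<open>pi / 2\<close>, so its cosine is negative, while up to \<open>s\<close> the
    cosine of \<open>\<theta>\<close> itself stays away from \<open>0\<close>.\<close>
  define s where "s = (pi / (2 * p) + pi / 2) / 2"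
  have s: "pi / (2 * p) < s" "s < pi / 2"
    using assms by (auto simp: s_def field_simps)
  have s0: "0 < s" using s(1) assms by (smt (verit) divide_pos_pos pi_gt_zero)
  have ps: "pi / 2 < p * s" "p * s \<le> pi"
    using s assms s0 mult_mono[of p 2 s "pi/2"] by (auto simp: field_simps)
  have c1: "cos (p * s) < 0"
    using ps cos_monotone_0_pi[of "pi/2" "p * s"] by simp
  have c2: "cos s > 0" using s s0 by (intro cos_gt_zero) auto
  \<comment> \<open>\<open>B\<close> is normalised so that \<open>- B * cos (p * s) = 1\<close>,
    which settles the angles beyond \<open>s\<close>. \<open>A\<close> makes
    \<open>A * cos s powr p = 1 + B\<close>, so below \<open>s\<close> it pays for the worst case
    \<open>B * cos (p * \<theta>) = B\<close>.\<close>
  define B where "B = 1 / (- cos (p * s))"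
  define A where "A = (1 + B) / (cos s powr p)"
  have B: "B \<ge> 0" using c1 by (simp add: B_def divide_nonneg_pos)
  have A: "A \<ge> 0" using B by (simp add: A_def)
  have angle: "1 \<le> A * cos \<theta> powr p - B * cos (p * \<theta>)" if "0 \<le> \<theta>" "\<theta> < pi / 2" for \<theta>
  proof (cases "\<theta> \<le> s")
    case True
    have "cos s \<le> cos \<theta>" using True that s s0 by (intro cos_monotone_0_pi_le) auto
    then have "cos s powr p \<le> cos \<theta> powr p" using c2 assms by (intro powr_mono2) auto
    then have "A * cos s powr p \<le> A * cos \<theta> powr p" using A by (intro mult_left_mono)
    moreover have "A * cos s powr p = 1 + B" using c2 by (simp add: A_def)
    moreover have "B * cos (p * \<theta>) \<le> B * 1" using B by (intro mult_left_mono) auto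
    ultimately show ?thesis by linarith
  next
    case False
    have "p * \<theta> \<le> 2 * (pi / 2)" using that assms by (intro mult_mono) auto
    then have "cos (p * \<theta>) \<le> cos (p * s)"
      using False assms s0 by (intro cos_monotone_0_pi_le) auto
    then have "B * cos (p * \<theta>) \<le> B * cos (p * s)" using B by (intro mult_left_mono)
    also have "\<dots> = -1" using c1 by (simp add: B_def)
    finally have "B * cos (p * \<theta>) \<le> - 1" .
    moreover have "0 \<le> A * cos \<theta> powr p" using A by simp
    ultimately show ?thesis by linarith
  qed
  have "cmod z powr p \<le> A * Re z powr p - B * Re (z powr of_real p)" if "Re z > 0" for z
  proof -
    have z: "z \<noteq> 0" using that by auto
    define \<theta> where "\<theta> = Arg z"
    have th: "\<bar>\<theta>\<bar> < pi / 2" using that z Arg_Re_pos[of z] by (simp add: \<theta>_def)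
    have zr: "z = rcis (cmod z) \<theta>" by (simp add: \<theta>_def rcis_cmod_Arg)
    have re: "Re z = cmod z * cos \<theta>" using zr by (metis Re_rcis)
    have "z powr of_real p = exp (of_real p * Ln z)" using z by (simp add: powr_def)
    also have "\<dots> = exp (of_real (p * ln (cmod z)) + \<i> * of_real (p * \<theta>))"
      using z by (simp add: Ln_Arg \<theta>_def algebra_simps Ln_of_real)
    also have "Re \<dots> = cmod z powr p * cos (p * \<theta>)"
      using z by (simp add: Re_exp powr_def)
    finally have rp: "Re (z powr of_real p) = cmod z powr p * cos (p * \<theta>)" .
    have cp: "cos \<theta> > 0" using th by (intro cos_gt_zero_pi) auto
    have "1 \<le> A * cos \<bar>\<theta>\<bar> powr p - B * cos (p * \<bar>\<theta>\<bar>)" using th by (intro angle) auto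
    also have "\<dots> = A * cos \<theta> powr p - B * cos (p * \<theta>)"
      by (simp add: abs_if)
    finally have "cmod z powr p * 1 \<le> cmod z powr p * (A * cos \<theta> powr p - B * cos (p * \<theta>))"
      by (intro mult_left_mono) auto
    also have "\<dots> = A * Re z powr p - B * Re (z powr of_real p)"
      using cp by (simp add: re rp powr_mult algebra_simps)
    finally show ?thesis by simp
  qed
  with A B show ?thesis by (rule that)
qed

section \<open>Integrals along the real line of functions holomorphic in a half plane\<close>

lemma integrable_one_plus_abs_powr:
  fixes r :: real
  assumes "1 < r"
  shows "integrable lborel (\<lambda>x::real. (1 + \<bar>x\<bar>) powr (- r))"
proof -
  let ?g = "\<lambda>x::real. (1 + \<bar>x\<bar>) powr (- r)"
  have lim: "((\<lambda>x::real. - ((1 + x) powr (1 - r)) / (r - 1)) \<longlongrightarrow> - 0 / (r - 1)) at_top"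
    using assms by (intro tendsto_intros tendsto_neg_powr filterlim_tendsto_add_at_top filterlim_ident) auto
  have deriv: "((\<lambda>x. - ((1 + x) powr (1 - r)) / (r - 1)) has_real_derivative ?g x) (at x)"
    if "0 \<le> x" for x
  proof -
    have "((\<lambda>x. - ((1 + x) powr (1 - r)) / (r - 1)) has_real_derivative
        - ((1 - r) * (1 + x) powr (1 - r - 1)) / (r - 1)) (at x)"
      using that assms by (auto intro!: derivative_eq_intros DERIV_fun_powr[where g="\<lambda>x. 1 + x" and m=1, simplified])
    also have "- ((1 - r) * (1 + x) powr (1 - r - 1)) / (r - 1) = ?g x"
      using that assms by (simp add: field_simps)
    finally show ?thesis .
  qed
  have "(\<integral>\<^sup>+x. ennreal (?g x) * indicator {0 ..} x \<partial>lborel) = - 0 / (r - 1) - (- ((1 + 0) powr (1 - r)) / (r - 1))"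
    by (rule nn_integral_FTC_atLeast[OF _ _ _ lim])
       (use deriv in auto)
  then have half: "(\<integral>\<^sup>+x. ennreal (?g x) * indicator {0 ..} x \<partial>lborel) < \<infinity>" by simp
  have refl: "(\<integral>\<^sup>+x. ennreal (?g x) * indicator {0 ..} (- x) \<partial>lborel)
        = (\<integral>\<^sup>+x. ennreal (?g x) * indicator {0 ..} x \<partial>lborel)"
    using nn_integral_real_affine[of "\<lambda>x. ennreal (?g x) * indicator {0 ..} x" "-1" 0] by simp
  have "(\<integral>\<^sup>+x. ennreal (?g x) \<partial>lborel)
     \<le> (\<integral>\<^sup>+x. ennreal (?g x) * indicator {0 ..} x + ennreal (?g x) * indicator {0 ..} (- x) \<partial>lborel)"
    by (intro nn_integral_mono) (auto simp: indicator_def)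
  also have "\<dots> < \<infinity>"
    using half refl by (subst nn_integral_add) auto
  finally show ?thesis
    by (intro integrableI_nonneg) auto
qed

text \<open>Cauchy's theorem on the boundary of the upper half disc of radius \<open>R\<close>: the
  arc contributes at most \<open>C * pi * (R * (1 + R) powr (- r))\<close>, which vanishes in the
  limit since \<open>r > 1\<close>. The strip of width \<open>d\<close> below the axis puts the
  diameter inside a convex open domain of holomorphy.\<close>

lemma half_plane_integral_zero:
  fixes F :: "complex \<Rightarrow> complex" and C d r :: real
  assumes hol: "F holomorphic_on {z. Im z > - d}" and d: "d > 0" and r: "r > 1"
    and bd: "\<And>z. Im z \<ge> 0 \<Longrightarrow> cmod (F z) \<le> C * (1 + cmod z) powr (- r)"
  shows "integrable lborel (\<lambda>x. F (complex_of_real x))"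
    and "(\<integral>x. F (complex_of_real x) \<partial>lborel) = 0"
proof -
  have contF: "continuous_on {z. Im z > - d} F" using hol by (rule holomorphic_on_imp_continuous_on)
  have contR: "continuous_on UNIV (\<lambda>x. F (complex_of_real x))"
    by (rule continuous_on_compose2[OF contF]) (use d in \<open>auto intro!: continuous_intros\<close>)
  then have meas: "(\<lambda>x. F (complex_of_real x)) \<in> borel_measurable lborel"
    by (simp add: borel_measurable_continuous_onI)
  have bdR: "cmod (F (complex_of_real x)) \<le> C * (1 + \<bar>x\<bar>) powr (- r)" for x
    using bd[of "complex_of_real x"] by simp
  have intw: "integrable lborel (\<lambda>x. C * (1 + \<bar>x\<bar>) powr (- r))"
    using integrable_one_plus_abs_powr[OF r] by simp
  show int: "integrable lborel (\<lambda>x. F (complex_of_real x))"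
    by (rule Bochner_Integration.integrable_bound[OF intw meas]) (use bdR in \<open>auto intro: order_trans[OF _ abs_ge_self]\<close>)
  let ?s = "\<lambda>R x. indicator {-R..R} x *\<^sub>R F (complex_of_real x)"
  have lim: "((\<lambda>R. integral\<^sup>L lborel (?s R)) \<longlongrightarrow> (\<integral>x. F (complex_of_real x) \<partial>lborel)) at_top"
  proof (rule integral_dominated_convergence_at_top[OF meas _ intw])
    show "AE x in lborel. ((\<lambda>R. ?s R x) \<longlongrightarrow> F (complex_of_real x)) at_top"
    proof (rule AE_I2, rule tendsto_eventually)
      fix x :: real
      show "\<forall>\<^sub>F R in at_top. ?s R x = F (complex_of_real x)"
        using eventually_ge_at_top[of "\<bar>x\<bar>"] by eventually_elim (auto simp: indicator_def)
    qed
    show "\<forall>\<^sub>F R in at_top. AE x in lborel. norm (?s R x) \<le> C * (1 + \<bar>x\<bar>) powr (- r)"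
      using bdR by (intro always_eventually allI AE_I2) (auto simp: indicator_def intro: order_trans[OF norm_ge_zero])
  qed (use meas in measurable)
  have bound: "norm (integral\<^sup>L lborel (?s R)) \<le> C * pi * (R * (1 + R) powr (- r))" if R: "R > 0" for R
  proof -
    define g1 where "g1 = linepath (complex_of_real (- R)) (complex_of_real R)"
    define g2 where "g2 = part_circlepath 0 R 0 pi"
    have im1: "path_image g1 \<subseteq> {z. Im z > - d}"
      using d by (auto simp: g1_def in_segment)
    have im2: "Im z \<ge> 0 \<and> cmod z = R" if "z \<in> path_image g2" for z
      using that R unfolding g2_def path_image_part_circlepath'
      by (auto simp: norm_mult cis_conv_exp[symmetric] path_image_def part_circlepath_def linepath_def
            intro!: mult_nonneg_nonneg sin_ge_zero simp: Im_exp closed_segment_eq_real_ivl split: if_splits)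
    have eqs: "pathfinish g1 = pathstart g2" "pathfinish g2 = pathstart g1"
      by (auto simp: g1_def g2_def)
    have "(F has_contour_integral 0) (g1 +++ g2)"
    proof (rule Cauchy_theorem_convex_simple[OF hol])
      show "convex {z. Im z > - d}" by (rule convex_halfspace_Im_gt)
      show "valid_path (g1 +++ g2)" using eqs by (intro valid_path_join) (auto simp: g1_def g2_def)
      show "path_image (g1 +++ g2) \<subseteq> {z. Im z > - d}"
        using im1 im2 d eqs by (fastforce simp: path_image_join)
    qed (use eqs in auto)
    moreover have c1: "F contour_integrable_on g1"
      using im1 contF unfolding g1_def
      by (intro contour_integrable_continuous_linepath) (auto intro: continuous_on_subset)
    moreover have c2: "F contour_integrable_on g2"
      using im2 d unfolding g2_def
      by (intro contour_integrable_continuous_part_circlepath continuous_on_subset[OF contF]) (auto dest!: im2[unfolded g2_def])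
    ultimately have sum0: "contour_integral g1 F + contour_integral g2 F = 0"
      using eqs by (metis contour_integral_join contour_integral_unique g1_def g2_def
            valid_path_linepath valid_path_part_circlepath)
    have "norm (contour_integral g2 F) \<le> (C * (1 + R) powr (- r)) * R * \<bar>pi - 0\<bar>"
      unfolding g2_def
    proof (rule contour_integral_bound_part_circlepath)
      show "F contour_integrable_on part_circlepath 0 R 0 pi" using c2 by (simp add: g2_def)
      show "0 \<le> C * (1 + R) powr - r"
        using order_trans[OF norm_ge_zero bd[of "complex_of_real R"]] R by simp
      show "norm (F x) \<le> C * (1 + R) powr - r" if "x \<in> path_image (part_circlepath 0 R 0 pi)" for x
        using im2[of x] that bd[of x] by (auto simp: g2_def)
    qed (use R in auto)
    moreover have "contour_integral g1 F = integral {-R..R} (\<lambda>x. F (complex_of_real x))"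
      using contour_integral_linepath_Reals_eq[of "complex_of_real (-R)" "complex_of_real R" F] R
      by (simp add: g1_def)
    moreover have "integral {-R..R} (\<lambda>x. F (complex_of_real x)) = integral\<^sup>L lborel (?s R)"
      using set_borel_integral_eq_integral(2)[of "{-R..R}" "\<lambda>x. F (complex_of_real x)"]
         borel_integrable_compact[of "{-R..R}" "\<lambda>x. F (complex_of_real x)"] contR
      by (simp add: set_integrable_def set_lebesgue_integral_def continuous_on_subset)
    ultimately show ?thesis using sum0
      by (simp add: mult_ac add_eq_0_iff2)
  qed
  have "((\<lambda>R. C * pi * (R * (1 + R) powr (- r))) \<longlongrightarrow> 0) at_top"
    using r by real_asymp
  then have "((\<lambda>R. integral\<^sup>L lborel (?s R)) \<longlongrightarrow> 0) at_top"
    by (rule Lim_null_comparison[rotated])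
       (use bound in \<open>auto intro!: eventually_mono[OF eventually_gt_at_top[of 0]]\<close>)
  then show "(\<integral>x. F (complex_of_real x) \<partial>lborel) = 0"
    using lim by (intro tendsto_unique[OF _ lim]) auto
qed

subsection \<open>The Poisson kernel of the upper half plane\<close>

lemma le_divide_mult:
  fixes a c d :: real
  assumes "0 < c" "c \<le> d" "0 \<le> a"
  shows "a \<le> a / c * d"
  using mult_left_mono[of c d "a / c"] assms by simp

lemma one_div_le:
  fixes d q L :: real
  assumes "0 < d" "0 < q" "q \<le> L * d"
  shows "1 / d \<le> L / q"
  using assms by (simp add: field_simps)

text \<open>The distance from \<open>z\<close> to the line is at least
  \<open>\<bar>Im z\<bar>\<close>, which pays for the fixed part \<open>1 + cmod z\<close>; the
  triangle inequality pays for the rest. Thus \<open>1 / (z - t)\<close> is of order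
  \<open>1 / (1 + \<bar>t\<bar>)\<close> with a constant depending on \<open>z\<close>
  alone.\<close>

lemma one_plus_abs_le:
  assumes "Im z \<noteq> 0"
  shows "1 + \<bar>t\<bar> \<le> ((1 + cmod z) / \<bar>Im z\<bar> + 1) * cmod (z - complex_of_real t)"
proof -
  have a: "\<bar>Im z\<bar> \<le> cmod (z - complex_of_real t)"
    using abs_Im_le_cmod[of "z - complex_of_real t"] by simp
  have "\<bar>t\<bar> \<le> cmod z + cmod (z - complex_of_real t)"
    by (metis norm_of_real norm_minus_commute norm_triangle_sub)
  moreover have "1 + cmod z \<le> (1 + cmod z) / \<bar>Im z\<bar> * cmod (z - complex_of_real t)"
    using a assms by (intro le_divide_mult) auto
  ultimately show ?thesis by (simp add: algebra_simps)
qed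

text \<open>The factor \<open>1 / pi\<close> makes it a probability density in
  \<open>t\<close>.\<close>

definition poisson :: "complex \<Rightarrow> real \<Rightarrow> real" where
  "poisson w t = Im w / (pi * (cmod (w - complex_of_real t))\<^sup>2)"

lemma poisson_nonneg: "Im w \<ge> 0 \<Longrightarrow> poisson w t \<ge> 0"
  by (simp add: poisson_def)

text \<open>Only the difference \<open>s - t\<close> enters. Hence the kernel has mass
  \<open>1\<close> in the base point as well, and an average over boundary points is also a
  superposition of kernels with different poles.\<close>

lemma poisson_swap: "poisson (Complex s y) t = poisson (Complex t y) s"
  by (simp add: poisson_def cmod_def power2_commute)

lemma poisson_measurable [measurable]: "poisson w \<in> borel_measurable borel"
  unfolding poisson_def by measurable

lemma poisson_has_integral:
  assumes "Im w > 0"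
  shows "has_bochner_integral lborel (poisson w) 1"
proof -
  have e: "einterval (-\<infinity>) \<infinity> = UNIV" by (auto simp: einterval_def)
  have i: "integrable lborel (\<lambda>x::real. inverse (1 + x\<^sup>2))"
    using integrable_inverse_1_plus_square by (simp add: e set_integrable_def)
  have v: "(\<integral>x. inverse (1 + x\<^sup>2) \<partial>lborel) = pi"
    using LBINT_inverse_1_plus_square
    by (simp add: interval_lebesgue_integral_def e set_lebesgue_integral_def)
  have hb: "has_bochner_integral lborel (\<lambda>x::real. inverse (1 + x\<^sup>2)) pi"
    using i v by (simp add: has_bochner_integral_iff)
  have "has_bochner_integral lborel (\<lambda>x. inverse (1 + (- Re w / Im w + (1 / Im w) * x)\<^sup>2)) (pi /\<^sub>R \<bar>1 / Im w\<bar>)"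
    by (rule lborel_has_bochner_integral_real_affine_iff[THEN iffD1, OF _ hb]) (use assms in simp)
  then have "has_bochner_integral lborel (\<lambda>x. inverse (pi * Im w) * inverse (1 + (- Re w / Im w + (1 / Im w) * x)\<^sup>2)) 
      (inverse (pi * Im w) * (pi /\<^sub>R \<bar>1 / Im w\<bar>))"
    by (rule has_bochner_integral_mult_right)
  moreover have "inverse (pi * Im w) * (pi /\<^sub>R \<bar>1 / Im w\<bar>) = 1" using assms by (simp add: field_simps)
  moreover have "inverse (pi * Im w) * inverse (1 + (- Re w / Im w + (1 / Im w) * x)\<^sup>2) = poisson w x" for x
  proof -
    have "1 + (- Re w / Im w + (1 / Im w) * x)\<^sup>2 = ((Re w - x)\<^sup>2 + (Im w)\<^sup>2) / (Im w)\<^sup>2"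
      using assms by (simp add: field_simps power2_eq_square)
    then show ?thesis
      using assms unfolding poisson_def cmod_power2 by (simp add: field_simps power2_eq_square)
  qed
  ultimately show ?thesis by simp
qed

lemma poisson_factor:
  assumes "Im w > 0"
  shows "complex_of_real (poisson w t) =
     of_real (Im w / pi) / ((of_real t - w) * (of_real t - cnj w))"
proof -
  have "(of_real t - w) * (of_real t - cnj w) = of_real ((cmod (w - of_real t))\<^sup>2)"
    unfolding cmod_power2 by (simp add: complex_eq_iff power2_eq_square algebra_simps)
  then show ?thesis unfolding poisson_def by simp
qed

text \<open>The kernel is a constant times \<open>1 / ((t - w) * (t - cnj w))\<close>. Subtracting
  \<open>F w\<close> cancels the pole at \<open>w\<close>, and the difference quotient gains one
  order of decay; the factor \<open>1 / (t - cnj w)\<close> gives the second, so the integral of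
  \<open>G\<close> vanishes by \<open>half_plane_integral_zero\<close> with \<open>r = 2\<close>.
  What remains is \<open>F w\<close> times the total mass \<open>1\<close>.\<close>

lemma poisson_reproduces:
  fixes F :: "complex \<Rightarrow> complex" and M d :: real
  assumes hol: "F holomorphic_on {z. Im z > - d}" and d: "d > 0"
    and bd: "\<And>z. Im z \<ge> 0 \<Longrightarrow> cmod (F z) \<le> M" and w: "Im w > 0"
  shows "integrable lborel (\<lambda>t. of_real (poisson w t) * F (of_real t))"
    and "(\<integral>t. of_real (poisson w t) * F (of_real t) \<partial>lborel) = F w"
proof -
  \<comment> \<open>The bound by \<open>Im w\<close> keeps the other pole \<open>cnj w\<close> out
    of the half plane.\<close>
  define e where "e = min d (Im w)"
  have e: "e > 0" "e \<le> d" "e \<le> Im w" using d w by (auto simp: e_def)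
  let ?S = "{z. Im z > - e}"
  define Q where "Q z = (if z = w then deriv F w else (F z - F w) / (z - w))" for z
  have opS: "open ?S" by (rule open_halfspace_Im_gt)
  have holQ: "Q holomorphic_on ?S"
    unfolding Q_def
    by (rule pole_lemma) (use hol e w opS in \<open>auto simp: interior_open intro: holomorphic_on_subset\<close>)
  define G where "G z = Q z / (z - cnj w)" for z
  have holG: "G holomorphic_on ?S"
    unfolding G_def using e by (intro holomorphic_intros holQ) (auto simp: complex_eq_iff)
  have M0: "M \<ge> 0" using bd[OF less_imp_le[OF w]] norm_ge_zero order_trans by blast
  define L where "L = (1 + cmod w) / Im w + 1"
  have L: "1 + cmod z \<le> L * cmod (z - cnj w)" if "Im z \<ge> 0" for z
  proof -
    have "Im (z - cnj w) \<le> cmod (z - cnj w)" by (rule order_trans[OF abs_ge_self abs_Im_le_cmod])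
    then have "Im w \<le> cmod (z - cnj w)" using that by simp
    then have "1 + cmod w \<le> (1 + cmod w) / Im w * cmod (z - cnj w)"
      using w by (intro le_divide_mult) auto
    moreover have "cmod z \<le> cmod w + cmod (z - cnj w)"
      by (metis complex_mod_cnj norm_triangle_sub)
    ultimately show ?thesis by (simp add: L_def algebra_simps)
  qed
  have L': "1 + cmod z \<le> L * cmod (z - w)" if "cmod (z - w) \<ge> Im w" for z
  proof -
    have "1 + cmod w \<le> (1 + cmod w) / Im w * cmod (z - w)"
      using that w by (intro le_divide_mult) auto
    moreover have "cmod z \<le> cmod w + cmod (z - w)"
      by (metis norm_triangle_sub)
    ultimately show ?thesis by (simp add: L_def algebra_simps)
  qed
  have Lpos: "L > 0" using w by (simp add: L_def add_nonneg_pos divide_nonneg_pos)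
  have "cball w (Im w) \<subseteq> ?S"
  proof
    fix z assume "z \<in> cball w (Im w)"
    then have "\<bar>Im (w - z)\<bar> \<le> Im w" using abs_Im_le_cmod[of "w - z"] by (simp add: dist_norm)
    then show "z \<in> ?S" using e by auto
  qed
  then have "compact (Q ` cball w (Im w))"
    by (intro compact_continuous_image continuous_on_subset[OF holomorphic_on_imp_continuous_on[OF holQ]]) auto
  then obtain N where N: "\<And>z. z \<in> cball w (Im w) \<Longrightarrow> cmod (Q z) \<le> N"
    by (metis bounded_iff compact_imp_bounded imageI)
  have N0: "N \<ge> 0" using order_trans[OF norm_ge_zero N[of w]] w by simp
  \<comment> \<open>The first summand bounds the difference quotient at distance at least
    \<open>Im w\<close> from \<open>w\<close>. The second is for the closed ball of radius
    \<open>Im w\<close>, where \<open>N\<close> comes from compactness and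
    \<open>cmod z \<le> cmod w + Im w\<close>.\<close>
  define K where "K = L * (2 * M) + N * (1 + cmod w + Im w)"
  have Qbd: "cmod (Q z) * (1 + cmod z) \<le> K" if "Im z \<ge> 0" for z
  proof (cases "z \<in> cball w (Im w)")
    case True
    then have "cmod z \<le> cmod w + Im w"
      by (metis (no_types) dist_norm mem_cball norm_minus_commute norm_triangle_sub add_left_mono order_trans)
    then have "cmod (Q z) * (1 + cmod z) \<le> N * (1 + cmod w + Im w)"
      using N[OF True] N0 by (intro mult_mono) auto
    then show ?thesis using M0 Lpos by (simp add: K_def add_increasing)
  next
    case False
    then have far: "cmod (z - w) \<ge> Im w" "z \<noteq> w" using w by (auto simp: dist_norm norm_minus_commute)
    have "cmod (Q z) * (1 + cmod z) \<le> cmod (Q z) * (L * cmod (z - w))"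
      using L'[OF far(1)] by (intro mult_left_mono) auto
    also have "\<dots> = L * cmod (F z - F w)" using far by (simp add: Q_def norm_divide)
    also have "\<dots> \<le> L * (2 * M)"
      using bd[OF that] bd[of w] w Lpos norm_triangle_ineq4[of "F z" "F w"]
      by (intro mult_left_mono) auto
    finally show ?thesis using N0 w by (simp add: K_def add_increasing2)
  qed
  have Gbd: "cmod (G z) \<le> (K * L) * (1 + cmod z) powr (- 2)" if "Im z \<ge> 0" for z
  proof -
    have zpos: "cmod (z - cnj w) > 0" using that w by (auto simp: complex_eq_iff)
    have p1: "1 + cmod z > 0" by (simp add: add_pos_nonneg)
    have "cmod (G z) = cmod (Q z) / cmod (z - cnj w)" by (simp add: G_def norm_divide)
    also have "\<dots> \<le> cmod (Q z) * L / (1 + cmod z)"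
      using mult_left_mono[OF L[OF that] norm_ge_zero[of "Q z"]] zpos p1
      by (simp add: field_simps)
    also have "\<dots> = (cmod (Q z) * (1 + cmod z)) * L / (1 + cmod z)\<^sup>2"
      using p1 by (simp add: power2_eq_square)
    also have "\<dots> \<le> K * L / (1 + cmod z)\<^sup>2"
      using Qbd[OF that] Lpos by (intro divide_right_mono mult_right_mono) auto
    also have "\<dots> = (K * L) * (1 + cmod z) powr (- 2)"
      using p1 by (simp add: powr_minus powr_numeral divide_inverse)
    finally show ?thesis .
  qed
  have iG: "integrable lborel (\<lambda>t. G (of_real t))" "(\<integral>t. G (of_real t) \<partial>lborel) = 0"
    using half_plane_integral_zero[OF holG e(1) _ Gbd] by auto
  have split: "of_real (poisson w t) * F (of_real t) =
      of_real (Im w / pi) * G (of_real t) + F w * of_real (poisson w t)" for t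
  proof -
    have "complex_of_real t \<noteq> w" using w by (auto simp: complex_eq_iff)
    then have "of_real (poisson w t) * (F (of_real t) - F w) = of_real (Im w / pi) * G (of_real t)"
      unfolding poisson_factor[OF w] G_def Q_def by simp
    then show ?thesis by (simp add: algebra_simps)
  qed
  have P: "integrable lborel (\<lambda>t. complex_of_real (poisson w t))" "(\<integral>t. complex_of_real (poisson w t) \<partial>lborel) = 1"
    using poisson_has_integral[OF w] by (auto simp: has_bochner_integral_iff)
  show "integrable lborel (\<lambda>t. of_real (poisson w t) * F (of_real t))"
    unfolding split using iG P by (intro Bochner_Integration.integrable_add integrable_mult_right) auto
  show "(\<integral>t. of_real (poisson w t) * F (of_real t) \<partial>lborel) = F w"
    unfolding split using iG P by (subst Bochner_Integration.integral_add) auto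
qed

subsection \<open>The Cauchy transform and Riesz's theorem\<close>

text \<open>The usual Cauchy integral \<open>1 / (2 * pi * \<i>)\<close> times the integral of
  \<open>g t / (t - z)\<close>, with the sign moved into the constant.\<close>

definition cauchy_transform :: "(real \<Rightarrow> complex) \<Rightarrow> complex \<Rightarrow> complex" where
  "cauchy_transform g z = (\<i> / (2 * pi)) * (\<integral>t. g t / (z - of_real t) \<partial>lborel)"

lemma Im_le_cmod_diff: "Im z \<le> cmod (z - complex_of_real t)"
  using abs_Im_le_cmod[of "z - complex_of_real t"] by simp

lemma cauchy_integrand_integrable:
  assumes g: "integrable lborel g" and z: "Im z > 0"
  shows "integrable lborel (\<lambda>t. g t / (z - complex_of_real t))"
proof (rule Bochner_Integration.integrable_bound)
  show "integrable lborel (\<lambda>t. g t / of_real (Im z))"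
    using g by simp
  have "cmod (g t / (z - complex_of_real t)) \<le> cmod (g t / of_real (Im z))" for t
    using Im_le_cmod_diff[of z t] z by (simp add: norm_divide frac_le)
  then show "AE t in lborel. norm (g t / (z - complex_of_real t)) \<le> norm (g t / of_real (Im z))"
    by simp
qed (use g in measurable)

text \<open>Differentiation under the integral by dominated convergence along sequences. Passing to
  a tail \<open>Y\<close> with \<open>Im (Y i) > Im z / 2\<close> yields the common majorant of the
  difference quotients.\<close>

lemma cauchy_transform_holomorphic:
  assumes g: "integrable lborel g"
  shows "cauchy_transform g holomorphic_on {z. Im z > 0}"
proof -
  have "((\<lambda>z. \<integral>t. g t / (z - complex_of_real t) \<partial>lborel) has_field_derivative
        - (\<integral>t. g t / (z - complex_of_real t)\<^sup>2 \<partial>lborel)) (at z)" if z: "Im z > 0" for z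
    unfolding has_field_derivative_iff tendsto_at_iff_sequentially
  proof (intro allI impI)
    fix X :: "nat \<Rightarrow> complex"
    assume X: "\<forall>i. X i \<in> UNIV - {z}" and Xz: "X \<longlonglongrightarrow> z"
    have "(\<lambda>i. Im (X i)) \<longlonglongrightarrow> Im z" using Xz by (rule tendsto_Im)
    then have "\<forall>\<^sub>F i in sequentially. Im (X i) > Im z / 2" 
      using z by (intro order_tendstoD(1)) auto
    then obtain N where N: "\<And>i. i \<ge> N \<Longrightarrow> Im (X i) > Im z / 2"
      by (auto simp: eventually_sequentially)
    define Y where "Y i = X (i + N)" for i
    have Y: "Im (Y i) > Im z / 2" "Y i \<noteq> z" for i using N X by (auto simp: Y_def)
    have Yz: "Y \<longlonglongrightarrow> z" unfolding Y_def using Xz by (rule LIMSEQ_ignore_initial_segment)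
    have Ypos: "Im (Y i) > 0" for i using Y(1)[of i] z by linarith
    have nz: "z - of_real t \<noteq> 0" "Y i - of_real t \<noteq> 0" for t i
      using z Ypos[of i] by (auto simp: complex_eq_iff)
    let ?I = "\<lambda>w. \<integral>t. g t / (w - complex_of_real t) \<partial>lborel"
    have quot: "(?I (Y i) - ?I z) / (Y i - z) =
        (\<integral>t. - (g t / ((Y i - of_real t) * (z - of_real t))) \<partial>lborel)" for i
    proof -
      have "?I (Y i) - ?I z = (\<integral>t. g t / (Y i - of_real t) - g t / (z - of_real t) \<partial>lborel)"
        using cauchy_integrand_integrable[OF g] Ypos z by (intro Bochner_Integration.integral_diff[symmetric]) auto
      also have "\<dots> / (Y i - z) = (\<integral>t. (g t / (Y i - of_real t) - g t / (z - of_real t)) / (Y i - z) \<partial>lborel)"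
        by simp
      also have "\<dots> = (\<integral>t. - (g t / ((Y i - of_real t) * (z - of_real t))) \<partial>lborel)"
      proof (rule Bochner_Integration.integral_cong[OF refl])
        fix t
        show "(g t / (Y i - of_real t) - g t / (z - of_real t)) / (Y i - z) = - (g t / ((Y i - of_real t) * (z - of_real t)))"
          using nz(1)[of t] nz(2)[of i t] Y(2)[of i] by (simp add: divide_simps) (simp add: algebra_simps)
      qed
      finally show ?thesis .
    qed
    have "(\<lambda>i. \<integral>t. - (g t / ((Y i - of_real t) * (z - of_real t))) \<partial>lborel)
        \<longlonglongrightarrow> (\<integral>t. - (g t / ((z - of_real t) * (z - of_real t))) \<partial>lborel)"
    proof (rule integral_dominated_convergence)
      show "integrable lborel (\<lambda>t. cmod (g t) / (Im z / 2 * Im z))" using g by simp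
      show "AE t in lborel. (\<lambda>i. - (g t / ((Y i - of_real t) * (z - of_real t))))
          \<longlonglongrightarrow> - (g t / ((z - of_real t) * (z - of_real t)))"
        using Yz nz by (auto intro!: tendsto_intros)
      show "AE t in lborel. norm (- (g t / ((Y i - of_real t) * (z - of_real t)))) \<le> cmod (g t) / (Im z / 2 * Im z)" for i
      proof (rule AE_I2)
        fix t
        have "Im z / 2 * Im z \<le> cmod (Y i - of_real t) * cmod (z - of_real t)"
          using Y(1)[of i] z Im_le_cmod_diff[of z t] Im_le_cmod_diff[of "Y i" t] by (intro mult_mono) auto
        then show "norm (- (g t / ((Y i - of_real t) * (z - of_real t)))) \<le> cmod (g t) / (Im z / 2 * Im z)"
          using z unfolding norm_minus_cancel norm_divide norm_mult by (intro divide_left_mono) (auto intro!: mult_pos_pos simp: nz[unfolded right_minus_eq])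
      qed
    qed (use g in measurable)
    then have "(\<lambda>i. (?I (Y i) - ?I z) / (Y i - z)) \<longlonglongrightarrow> - (\<integral>t. g t / (z - of_real t)\<^sup>2 \<partial>lborel)"
      unfolding quot by (simp add: power2_eq_square)
    then have "(\<lambda>i. (\<lambda>w. (?I w - ?I z) / (w - z)) (X (i + N))) \<longlonglongrightarrow> - (\<integral>t. g t / (z - of_real t)\<^sup>2 \<partial>lborel)"
      unfolding Y_def .
    then show "((\<lambda>w. (?I w - ?I z) / (w - z)) \<circ> X) \<longlonglongrightarrow> - (\<integral>t. g t / (z - of_real t)\<^sup>2 \<partial>lborel)"
      unfolding o_def by (rule LIMSEQ_offset)
  qed
  then have "(\<lambda>z. \<integral>t. g t / (z - complex_of_real t) \<partial>lborel) holomorphic_on {z. Im z > 0}"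
    by (auto simp: holomorphic_on_def field_differentiable_def intro: has_field_derivative_at_within)
  then show ?thesis unfolding cauchy_transform_def by (intro holomorphic_intros)
qed

text \<open>For \<open>g\<close> supported in \<open>[-M, M]\<close> the kernel is of order
  \<open>1 / (1 + cmod z)\<close> uniformly over the support. The \<open>p\<close>-th power of the
  transform then decays with exponent \<open>p > 1\<close>, as
  \<open>half_plane_integral_zero\<close> demands.\<close>

lemma cauchy_transform_decay:
  assumes g: "integrable lborel g" and supp: "\<And>t. \<bar>t\<bar> > M \<Longrightarrow> g t = 0" and M: "M \<ge> 0" and y: "y > 0"
    and z: "Im z \<ge> y"
  shows "cmod (cauchy_transform g z) * (1 + cmod z) \<le> ((1 + M) / y + 1) * (\<integral>t. cmod (g t) \<partial>lborel)"
proof -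
  let ?L = "(1 + M) / y + 1"
  have p1: "1 + cmod z > 0" by (simp add: add_pos_nonneg)
  have bd: "cmod (g t / (z - of_real t)) \<le> ?L / (1 + cmod z) * cmod (g t)" for t
  proof (cases "\<bar>t\<bar> > M")
    case False
    have d: "cmod (z - of_real t) \<ge> y" using Im_le_cmod_diff[of z t] z by linarith
    have "cmod z \<le> \<bar>t\<bar> + cmod (z - of_real t)"
      by (metis norm_of_real norm_triangle_sub)
    moreover have "1 + M \<le> (1 + M) / y * cmod (z - of_real t)"
      using d y M by (intro le_divide_mult) auto
    ultimately have "1 + cmod z \<le> ?L * cmod (z - of_real t)"
      using False by (simp add: algebra_simps)
    then have "1 / cmod (z - of_real t) \<le> ?L / (1 + cmod z)"
      using d y p1 by (intro one_div_le) auto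
    from mult_right_mono[OF this norm_ge_zero[of "g t"]] show ?thesis
      by (simp add: norm_divide)
  qed (use supp in simp)
  have "cmod (\<integral>t. g t / (z - of_real t) \<partial>lborel) \<le> (\<integral>t. ?L / (1 + cmod z) * cmod (g t) \<partial>lborel)"
    using cauchy_integrand_integrable[OF g, of z] bd g y z
    by (intro order_trans[OF integral_norm_bound] Bochner_Integration.integral_mono) auto
  also have "\<dots> = ?L / (1 + cmod z) * (\<integral>t. cmod (g t) \<partial>lborel)" by simp
  finally have A: "cmod (\<integral>t. g t / (z - of_real t) \<partial>lborel) * (1 + cmod z) \<le> ?L * (\<integral>t. cmod (g t) \<partial>lborel)"
    using p1 by (simp add: field_simps)
  have "cmod (cauchy_transform g z) = 1 / (2 * pi) * cmod (\<integral>t. g t / (z - of_real t) \<partial>lborel)"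
    by (simp add: cauchy_transform_def norm_mult norm_divide)
  also have "\<dots> \<le> 1 * cmod (\<integral>t. g t / (z - of_real t) \<partial>lborel)"
    using pi_gt3 by (intro mult_right_mono) auto
  finally have "cmod (cauchy_transform g z) * (1 + cmod z) \<le> cmod (\<integral>t. g t / (z - of_real t) \<partial>lborel) * (1 + cmod z)"
    using p1 by (intro mult_right_mono) auto
  with A show ?thesis by linarith
qed

lemma poisson_integrable:
  fixes g :: "real \<Rightarrow> real"
  assumes g: "integrable lborel g" and z: "Im z > 0"
  shows "integrable lborel (\<lambda>t. poisson z t * g t)"
proof (rule Bochner_Integration.integrable_bound)
  show "integrable lborel (\<lambda>t. 1 / (pi * Im z) * g t)" using g by simp
  have "norm (poisson z t * g t) \<le> norm (1 / (pi * Im z) * g t)" for t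
  proof -
    have "(Im z)\<^sup>2 \<le> (cmod (z - of_real t))\<^sup>2" using Im_le_cmod_diff[of z t] z by (intro power_mono) auto
    then have "Im z / (pi * (cmod (z - of_real t))\<^sup>2) \<le> Im z / (pi * (Im z)\<^sup>2)"
      using z by (intro divide_left_mono mult_left_mono mult_pos_pos) (auto simp: complex_eq_iff)
    also have "\<dots> = 1 / (pi * Im z)" using z by (simp add: power2_eq_square)
    finally have "\<bar>poisson z t\<bar> \<le> \<bar>1 / (pi * Im z)\<bar>" using z by (simp add: poisson_def)
    then show ?thesis unfolding real_norm_def abs_mult by (intro mult_right_mono) auto
  qed
  then show "AE t in lborel. norm (poisson z t * g t) \<le> norm (1 / (pi * Im z) * g t)" by simp
qed (use g in measurable)

text \<open>The real part of \<open>\<i> / (2 * pi * (z - t))\<close> is half the Poisson kernel. So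
  a nonnegative density is mapped into the closed right half plane, where the angular inequality is
  available.\<close>

lemma Re_cauchy_transform:
  fixes g :: "real \<Rightarrow> real"
  assumes g: "integrable lborel g" and z: "Im z > 0"
  shows "Re (cauchy_transform (\<lambda>t. of_real (g t)) z) = (\<integral>t. poisson z t * g t \<partial>lborel) / 2"
proof -
  have i: "integrable lborel (\<lambda>t. complex_of_real (g t) / (z - of_real t))"
    using g z by (intro cauchy_integrand_integrable) auto
  have "Re (cauchy_transform (\<lambda>t. of_real (g t)) z) = 
     - (1 / (2 * pi)) * Im (\<integral>t. complex_of_real (g t) / (z - of_real t) \<partial>lborel)"
  proof -
    have "\<i> / complex_of_real (2 * pi) = \<i> * of_real (1 / (2 * pi))" by simp
    then show ?thesis unfolding cauchy_transform_def by (simp only:) simp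
  qed
  also have "Im (\<integral>t. complex_of_real (g t) / (z - of_real t) \<partial>lborel) = 
     (\<integral>t. Im (complex_of_real (g t) / (z - of_real t)) \<partial>lborel)"
    using i by simp
  also have "\<dots> = (\<integral>t. - pi * (poisson z t * g t) \<partial>lborel)"
    unfolding poisson_def cmod_power2 by (intro Bochner_Integration.integral_cong) (auto simp: Im_divide)
  also have "- (1 / (2 * pi)) * \<dots> = (\<integral>t. poisson z t * g t \<partial>lborel) / 2"
    by simp
  finally show ?thesis .
qed

section \<open>Jensen's inequality and the contraction property of the Poisson integral\<close>

text \<open>The convex function \<open>x powr p\<close> lies above its tangent at \<open>u\<close>.
  This is Young's inequality for the product \<open>g * u powr (p - 1)\<close> with exponents
  \<open>p\<close> and \<open>p / (p - 1)\<close>, so the case \<open>u = 0\<close> needs no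
  separate treatment.\<close>

lemma powr_tangent_le:
  fixes u g p :: real
  assumes "1 < p" "0 \<le> u" "0 \<le> g"
  shows "u powr p + p * u powr (p - 1) * (g - u) \<le> g powr p"
proof -
  have pp: "(p - 1) * (p / (p - 1)) = p" using assms by simp
  have "g * u powr (p - 1) \<le> g powr p / p + (u powr (p - 1)) powr (p / (p - 1)) / (p / (p - 1))"
    using assms by (intro Youngs_inequality) (auto simp: field_simps)
  then have "g * u powr (p - 1) \<le> g powr p / p + u powr p * (p - 1) / p"
    unfolding powr_powr pp by simp
  then have "p * (g * u powr (p - 1)) \<le> p * (g powr p / p + u powr p * (p - 1) / p)"
    using assms by (intro mult_left_mono) auto
  also have "\<dots> = g powr p + u powr p * (p - 1)" using assms by (simp add: field_simps)
  finally have "p * (g * u powr (p - 1)) \<le> g powr p + u powr p * (p - 1)" .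
  moreover have "u powr (p - 1) * u = u powr p"
    using assms powr_mult_base[of u "p - 1"] by (simp add: mult.commute)
  then have "p * u powr (p - 1) * (g - u) = p * (g * u powr (p - 1)) - p * u powr p"
    by (metis (no_types, lifting) mult.assoc mult.commute right_diff_distrib)
  moreover have "u powr p * (p - 1) = p * u powr p - u powr p" by (simp add: algebra_simps)
  ultimately show ?thesis by linarith
qed

text \<open>The tangent inequality at the mean value \<open>u\<close> is integrated against the
  probability density \<open>poisson z\<close>; the linear term then drops out.\<close>

lemma poisson_jensen:
  fixes g :: "real \<Rightarrow> real"
  assumes p: "1 < p" and g: "integrable lborel g" "\<And>t. 0 \<le> g t"
    and gp: "integrable lborel (\<lambda>t. g t powr p)" and z: "Im z > 0"
  shows "(\<integral>t. poisson z t * g t \<partial>lborel) powr p \<le> (\<integral>t. poisson z t * g t powr p \<partial>lborel)"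
proof -
  define u where "u = (\<integral>t. poisson z t * g t \<partial>lborel)"
  have u0: "u \<ge> 0" unfolding u_def using g z by (intro Bochner_Integration.integral_nonneg) (simp add: poisson_nonneg)
  note P = poisson_has_integral[OF z]
  have Pi: "integrable lborel (poisson z)" "(\<integral>t. poisson z t \<partial>lborel) = 1"
    using P by (auto simp: has_bochner_integral_iff)
  note Pg = poisson_integrable[OF g(1) z] and Pgp = poisson_integrable[OF gp z]
  let ?c = "p * u powr (p - 1)"
  have "(\<integral>t. (u powr p - ?c * u) * poisson z t + ?c * (poisson z t * g t) \<partial>lborel)
      \<le> (\<integral>t. poisson z t * g t powr p \<partial>lborel)"
  proof (rule Bochner_Integration.integral_mono[OF _ Pgp])
    show "integrable lborel (\<lambda>t. (u powr p - ?c * u) * poisson z t + ?c * (poisson z t * g t))"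
      using Pi Pg by (intro Bochner_Integration.integrable_add integrable_mult_right)
    fix t
    have "poisson z t * (u powr p + ?c * (g t - u)) \<le> poisson z t * g t powr p"
      using powr_tangent_le[OF p u0 g(2)[of t]] z by (intro mult_left_mono poisson_nonneg) auto
    then show "(u powr p - ?c * u) * poisson z t + ?c * (poisson z t * g t) \<le> poisson z t * g t powr p"
      by (simp add: algebra_simps)
  qed
  also have "(\<integral>t. (u powr p - ?c * u) * poisson z t + ?c * (poisson z t * g t) \<partial>lborel)
      = (u powr p - ?c * u) * 1 + ?c * u"
    using Pi Pg by (subst Bochner_Integration.integral_add) (auto simp: u_def)
  finally show ?thesis by (simp add: u_def)
qed

text \<open>The \<open>p\<close>-th power of the \<open>L_p\<close> norm, with values in
  \<open>ennreal\<close> so that it exists without integrability conditions. Minkowski's inequality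
  is replaced by \<open>pmass_add_le\<close>: its factor \<open>2 powr p\<close> is harmless because
  every estimate needs only some constant depending on \<open>p\<close>.\<close>

definition pmass :: "real \<Rightarrow> (real \<Rightarrow> complex) \<Rightarrow> ennreal" where
  "pmass p f = (\<integral>\<^sup>+x. ennreal (cmod (f x) powr p) \<partial>lborel)"

lemma pmass_add_le:
  assumes p: "p > 0" and [measurable]: "f \<in> borel_measurable borel" "g \<in> borel_measurable borel"
  shows "pmass p (\<lambda>x. f x + g x) \<le> ennreal (2 powr p) * (pmass p f + pmass p g)"
proof -
  have "pmass p (\<lambda>x. f x + g x) \<le> (\<integral>\<^sup>+x. ennreal (2 powr p) * (ennreal (cmod (f x) powr p) + ennreal (cmod (g x) powr p)) \<partial>lborel)"
    unfolding pmass_def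
  proof (intro nn_integral_mono)
    fix x
    have "cmod (f x + g x) powr p \<le> (cmod (f x) + cmod (g x)) powr p"
      using p by (intro powr_mono2 norm_triangle_ineq) auto
    also have "\<dots> \<le> 2 powr p * (cmod (f x) powr p + cmod (g x) powr p)"
      using p by (intro powr_add_le) auto
    finally show "ennreal (cmod (f x + g x) powr p) \<le> ennreal (2 powr p) * (ennreal (cmod (f x) powr p) + ennreal (cmod (g x) powr p))"
      by (simp flip: ennreal_plus ennreal_mult)
  qed
  also have "\<dots> = ennreal (2 powr p) * (pmass p f + pmass p g)"
    unfolding pmass_def by (subst nn_integral_cmult) (auto simp: nn_integral_add)
  finally show ?thesis .
qed

lemma pmass_mono:
  assumes "p > 0" "\<And>x. cmod (f x) \<le> cmod (g x)"
  shows "pmass p f \<le> pmass p g"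
  unfolding pmass_def using assms by (intro nn_integral_mono ennreal_leI powr_mono2) auto

lemma pmass_cmult:
  assumes "p > 0" "f \<in> borel_measurable borel"
  shows "pmass p (\<lambda>x. c * f x) = ennreal (cmod c powr p) * pmass p f"
  unfolding pmass_def using assms
  by (subst nn_integral_cmult[symmetric]) (auto simp: norm_mult powr_mult ennreal_mult)

text \<open>Jensen's inequality holds pointwise in \<open>x\<close>; after exchanging the integrals,
  \<open>poisson_swap\<close> shows that the kernel has mass \<open>1\<close> in \<open>x\<close>
  too.\<close>

lemma poisson_contraction:
  fixes g :: "real \<Rightarrow> real"
  assumes p: "1 < p" and g: "integrable lborel g" "\<And>t. 0 \<le> g t"
    and gp: "integrable lborel (\<lambda>t. g t powr p)" and y: "y > 0"
  shows "(\<integral>\<^sup>+x. ennreal ((\<integral>t. poisson (Complex x y) t * g t \<partial>lborel) powr p) \<partial>lborel)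
     \<le> (\<integral>\<^sup>+t. ennreal (g t powr p) \<partial>lborel)"
proof -
  have [measurable]: "g \<in> borel_measurable borel" using g by measurable
  have m[measurable]: "(\<lambda>(x, t). poisson (Complex x y) t) \<in> borel_measurable (borel \<Otimes>\<^sub>M borel)"
    unfolding poisson_def cmod_power2 by simp
  have "(\<integral>\<^sup>+x. ennreal ((\<integral>t. poisson (Complex x y) t * g t \<partial>lborel) powr p) \<partial>lborel)
     \<le> (\<integral>\<^sup>+x. (\<integral>\<^sup>+t. ennreal (poisson (Complex x y) t * g t powr p) \<partial>lborel) \<partial>lborel)"
  proof (intro nn_integral_mono)
    fix x
    have "ennreal ((\<integral>t. poisson (Complex x y) t * g t \<partial>lborel) powr p) \<le> ennreal (\<integral>t. poisson (Complex x y) t * g t powr p \<partial>lborel)"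
      using y by (intro ennreal_leI poisson_jensen p g gp) auto
    also have "\<dots> = (\<integral>\<^sup>+t. ennreal (poisson (Complex x y) t * g t powr p) \<partial>lborel)"
      using y gp by (intro nn_integral_eq_integral[symmetric] poisson_integrable AE_I2) (auto simp: poisson_nonneg)
    finally show "ennreal ((\<integral>t. poisson (Complex x y) t * g t \<partial>lborel) powr p) \<le> (\<integral>\<^sup>+t. ennreal (poisson (Complex x y) t * g t powr p) \<partial>lborel)" .
  qed
  also have "\<dots> = (\<integral>\<^sup>+t. (\<integral>\<^sup>+x. ennreal (poisson (Complex x y) t * g t powr p) \<partial>lborel) \<partial>lborel)"
    by (rule lborel_pair.Fubini') measurable
  also have "\<dots> = (\<integral>\<^sup>+t. ennreal (g t powr p) \<partial>lborel)"
  proof (intro nn_integral_cong)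
    fix t
    have P: "has_bochner_integral lborel (poisson (Complex t y)) 1"
      using poisson_has_integral[of "Complex t y"] y by simp
    have "(\<integral>\<^sup>+x. ennreal (poisson (Complex x y) t * g t powr p) \<partial>lborel)
      = (\<integral>\<^sup>+x. ennreal (g t powr p) * ennreal (poisson (Complex t y) x) \<partial>lborel)"
      using y by (intro nn_integral_cong) (simp add: poisson_swap[of _ y t] poisson_nonneg mult.commute flip: ennreal_mult)
    also have "\<dots> = ennreal (g t powr p) * (\<integral>\<^sup>+x. ennreal (poisson (Complex t y) x) \<partial>lborel)"
      by (rule nn_integral_cmult) measurable
    also have "(\<integral>\<^sup>+x. ennreal (poisson (Complex t y) x) \<partial>lborel) = 1"
      using P y by (subst nn_integral_eq_integral) (auto simp: has_bochner_integral_iff poisson_nonneg)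
    finally show "(\<integral>\<^sup>+x. ennreal (poisson (Complex x y) t * g t powr p) \<partial>lborel) = ennreal (g t powr p)" by simp
  qed
  finally show ?thesis .
qed

text \<open>A nonnegative \<open>g\<close> gives a transform \<open>h\<close> with positive real
  part, so the principal power \<open>h powr p\<close> is holomorphic and its integral along the
  line is \<open>0\<close>. Integrating the angular inequality leaves only the mass of
  \<open>Re h\<close>, that is of half a Poisson integral, which the contraction property bounds by
  the mass of \<open>g\<close>.\<close>

lemma riesz_cauchy_transform_nonneg:
  fixes g :: "real \<Rightarrow> real"
  assumes p: "1 < p" and AB: "A \<ge> 0" "B \<ge> 0"
    "\<And>z. Re z > 0 \<Longrightarrow> cmod z powr p \<le> A * Re z powr p - B * Re (z powr of_real p)"
    and g: "integrable lborel g" "\<And>t. 0 \<le> g t" and gp: "integrable lborel (\<lambda>t. g t powr p)"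
    and supp: "\<And>t. \<bar>t\<bar> > M \<Longrightarrow> g t = 0" and M: "M \<ge> 0" and y: "y > 0"
  shows "pmass p (\<lambda>x. cauchy_transform (\<lambda>t. of_real (g t)) (Complex x y)) \<le> ennreal A * pmass p (\<lambda>t. of_real (g t))"
proof -
  let ?h = "cauchy_transform (\<lambda>t. of_real (g t))"
  have gc: "integrable lborel (\<lambda>t. complex_of_real (g t))" using g by simp
  note hol = cauchy_transform_holomorphic[OF gc]
  show ?thesis
  proof (cases "\<exists>z. Im z > 0 \<and> Re (?h z) = 0")
    \<comment> \<open>The principal power requires a strictly positive real part. A single zero of
      the real part forces \<open>g = 0\<close> almost everywhere, since the Poisson kernel is
      positive, and then the transform vanishes identically.\<close>
    case True
    then obtain z where z: "Im z > 0" "Re (?h z) = 0" by auto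
    then have "(\<integral>t. poisson z t * g t \<partial>lborel) = 0" using Re_cauchy_transform[OF g(1)] by auto
    then have "AE t in lborel. poisson z t * g t = 0"
      using integral_nonneg_eq_0_iff_AE[OF poisson_integrable[OF g(1) z(1)]] g z by (auto simp: poisson_nonneg)
    moreover have "poisson z t \<noteq> 0" for t using z by (auto simp: poisson_def complex_eq_iff)
    ultimately have g0: "AE t in lborel. g t = 0" by auto
    have "?h w = 0" for w
    proof -
      have "(\<integral>t. complex_of_real (g t) / (w - of_real t) \<partial>lborel) = 0"
        by (rule integral_eq_zero_AE) (use g0 in \<open>auto elim: eventually_mono\<close>)
      then show ?thesis by (simp add: cauchy_transform_def)
    qed
    then show ?thesis by (simp add: pmass_def)
  next
    case False
    have Re0: "Re (?h z) > 0" if "Im z > 0" for z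
    proof -
      have "Re (?h z) \<ge> 0" unfolding Re_cauchy_transform[OF g(1) that]
        using g that by (auto intro!: Bochner_Integration.integral_nonneg simp: poisson_nonneg)
      then show ?thesis using False that by (metis order_le_less)
    qed
    \<comment> \<open>The shift moves the line of height \<open>y\<close> onto the real axis and
      leaves a strip of width \<open>y\<close> below it in which \<open>F\<close> is
      holomorphic.\<close>
    define F where "F z = ?h (z + \<i> * of_real y) powr of_real p" for z
    define K where "K = ((1 + M) / y + 1) * (\<integral>t. cmod (complex_of_real (g t)) \<partial>lborel)"
    have K0: "K \<ge> 0" using M y by (simp add: K_def)
    have "(\<lambda>z. ?h (z + \<i> * of_real y)) holomorphic_on {z. Im z > - y}"
      by (rule holomorphic_on_compose_gen[OF _ hol, unfolded o_def]) (auto intro!: holomorphic_intros)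
    moreover have "?h (z + \<i> * of_real y) \<notin> \<real>\<^sub>\<le>\<^sub>0" if "Im z > - y" for z
      using Re0[of "z + \<i> * of_real y"] that by (auto simp: complex_nonpos_Reals_iff)
    ultimately have holF: "F holomorphic_on {z. Im z > - y}"
      unfolding F_def by (intro holomorphic_intros) auto
    have normF: "cmod (F z) = cmod (?h (z + \<i> * of_real y)) powr p" for z
      by (simp add: F_def norm_powr_real_powr')
    have bdF: "cmod (F z) \<le> (K * (1 + y)) powr p * (1 + cmod z) powr (- p)" if z: "Im z \<ge> 0" for z
    proof -
      let ?w = "z + \<i> * of_real y"
      have "cmod z \<le> cmod ?w + y"
        using y norm_triangle_ineq4[of ?w "\<i> * of_real y"] by (simp add: norm_mult)
      then have "1 + cmod z \<le> 1 + cmod ?w + y" by simp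
      also have "\<dots> \<le> (1 + y) * (1 + cmod ?w)" using y by (simp add: algebra_simps)
      finally have "cmod (?h ?w) * (1 + cmod z) \<le> cmod (?h ?w) * ((1 + y) * (1 + cmod ?w))"
        by (intro mult_left_mono) auto
      also have "\<dots> = (cmod (?h ?w) * (1 + cmod ?w)) * (1 + y)" by simp
      also have "\<dots> \<le> K * (1 + y)"
        unfolding K_def using cauchy_transform_decay[OF gc _ M y, of ?w] supp y z by (intro mult_right_mono) auto
      finally have "(cmod (?h ?w) * (1 + cmod z)) powr p \<le> (K * (1 + y)) powr p"
        using p by (intro powr_mono2) auto
      then have "cmod (?h ?w) powr p * (1 + cmod z) powr p \<le> (K * (1 + y)) powr p"
        by (simp add: powr_mult)
      moreover have "(1 + cmod z) powr p > 0" by (smt (verit) norm_ge_zero powr_gt_zero)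
      ultimately show ?thesis unfolding normF by (simp add: powr_minus field_simps)
    qed
    note int = half_plane_integral_zero[OF holF y p bdF]
    have eqC: "complex_of_real x + \<i> * of_real y = Complex x y" for x by (simp add: complex_eq_iff)
    let ?H = "\<lambda>x. ?h (Complex x y)"
    have Hp: "integrable lborel (\<lambda>x. cmod (?H x) powr p)"
      using integrable_norm[OF int(1)] unfolding normF eqC by simp
    have ReF: "integrable lborel (\<lambda>x. Re (F (of_real x)))" "(\<integral>x. Re (F (of_real x)) \<partial>lborel) = 0"
      using int by auto
    have contH: "continuous_on UNIV ?H"
      by (rule continuous_on_compose2[OF holomorphic_on_imp_continuous_on[OF hol]])
         (use y in \<open>auto intro!: continuous_intros simp: Complex_eq\<close>)
    then have mH[measurable]: "?H \<in> borel_measurable borel" by (rule borel_measurable_continuous_onI)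
    have RHp: "integrable lborel (\<lambda>x. Re (?H x) powr p)"
    proof (rule Bochner_Integration.integrable_bound[OF Hp])
      have "Re (?H x) powr p \<le> cmod (?H x) powr p" for x
        using p Re0[of "Complex x y"] y complex_Re_le_cmod[of "?H x"] by (intro powr_mono2) auto
      then show "AE x in lborel. norm (Re (?H x) powr p) \<le> norm (cmod (?H x) powr p)" by simp
    qed measurable
    have "(\<integral>x. cmod (?H x) powr p \<partial>lborel) \<le> (\<integral>x. A * Re (?H x) powr p - B * Re (F (of_real x)) \<partial>lborel)"
    proof (rule Bochner_Integration.integral_mono[OF Hp])
      show "integrable lborel (\<lambda>x. A * Re (?H x) powr p - B * Re (F (of_real x)))"
        using RHp ReF by auto
      show "cmod (?H x) powr p \<le> A * Re (?H x) powr p - B * Re (F (of_real x))" for x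
        using AB(3)[OF Re0[of "Complex x y"]] y by (simp add: F_def eqC)
    qed
    also have "\<dots> = A * (\<integral>x. Re (?H x) powr p \<partial>lborel)"
      using RHp ReF by (subst Bochner_Integration.integral_diff) auto
    finally have main: "(\<integral>x. cmod (?H x) powr p \<partial>lborel) \<le> A * (\<integral>x. Re (?H x) powr p \<partial>lborel)" .
    have "pmass p ?H = ennreal (\<integral>x. cmod (?H x) powr p \<partial>lborel)"
      unfolding pmass_def using Hp by (intro nn_integral_eq_integral) auto
    also have "\<dots> \<le> ennreal A * ennreal (\<integral>x. Re (?H x) powr p \<partial>lborel)"
      using main AB by (simp flip: ennreal_mult'')
    also have "ennreal (\<integral>x. Re (?H x) powr p \<partial>lborel) = (\<integral>\<^sup>+x. ennreal (Re (?H x) powr p) \<partial>lborel)"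
      using RHp by (intro nn_integral_eq_integral[symmetric]) auto
    also have "\<dots> \<le> (\<integral>\<^sup>+x. ennreal ((\<integral>t. poisson (Complex x y) t * g t \<partial>lborel) powr p) \<partial>lborel)"
    proof (intro nn_integral_mono ennreal_leI)
      fix x
      have "Re (?H x) > 0" using Re0 y by simp
      then show "Re (?H x) powr p \<le> (\<integral>t. poisson (Complex x y) t * g t \<partial>lborel) powr p"
        using Re_cauchy_transform[OF g(1), of "Complex x y"] y p by (intro powr_mono2) auto
    qed
    also have "\<dots> \<le> (\<integral>\<^sup>+t. ennreal (g t powr p) \<partial>lborel)"
      by (rule poisson_contraction[OF p g gp y])
    also have "\<dots> = pmass p (\<lambda>t. of_real (g t))" unfolding pmass_def using g by simp
    finally show ?thesis by (simp add: mult_left_mono)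
  qed
qed

section \<open>Riesz's theorem for complex functions of bounded support\<close>

text \<open>A dense class inside every \<open>L_p\<close> that is stable under passing to smaller
  measurable functions. One constant bounds both the values and the support.\<close>

definition bounded_support :: "(real \<Rightarrow> complex) \<Rightarrow> bool" where
  "bounded_support g \<longleftrightarrow> g \<in> borel_measurable borel \<and> (\<exists>M\<ge>0. \<forall>t. cmod (g t) \<le> M * indicator {-M..M} t)"

lemma bounded_supportE:
  assumes "bounded_support g"
  obtains M where "M \<ge> 0" "\<And>t. cmod (g t) \<le> M" "\<And>t. \<bar>t\<bar> > M \<Longrightarrow> g t = 0"
proof -
  obtain M where M: "M \<ge> 0" "\<And>t. cmod (g t) \<le> M * indicator {-M..M} t"
    using assms by (auto simp: bounded_support_def)
  have "cmod (g t) \<le> M" for t using M(2)[of t] M(1) by (cases "t \<in> {-M..M}") auto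
  moreover have "g t = 0" if "\<bar>t\<bar> > M" for t using M(2)[of t] that by (cases "t \<in> {-M..M}") auto
  ultimately show ?thesis using that M(1) by blast
qed

lemma bounded_support_le:
  assumes "bounded_support g" "f \<in> borel_measurable borel" "\<And>t. cmod (f t) \<le> cmod (g t)"
  shows "bounded_support f"
  using assms unfolding bounded_support_def by (meson order_trans)

lemma bounded_support_integrable_powr:
  assumes "bounded_support g" "p > 0"
  shows "integrable lborel (\<lambda>t. cmod (g t) powr p)"
proof -
  obtain M where M: "M \<ge> 0" "\<And>t. cmod (g t) \<le> M" "\<And>t. \<bar>t\<bar> > M \<Longrightarrow> g t = 0"
    using bounded_supportE[OF assms(1)] by blast
  have [measurable]: "g \<in> borel_measurable borel" using assms by (simp add: bounded_support_def)
  have "integrable lborel (\<lambda>t. M powr p * indicator {-M..M} t)"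
    using M(1) by (intro integrable_mult_right integrable_real_indicator) auto
  then show ?thesis
  proof (rule Bochner_Integration.integrable_bound)
    have "cmod (g t) powr p \<le> M powr p * indicator {-M..M} t" for t
    proof (cases "\<bar>t\<bar> > M")
      case False
      then show ?thesis using M(2)[of t] assms(2) by (auto simp: indicator_def intro!: powr_mono2)
    qed (use M(3)[of t] in auto)
    then show "AE t in lborel. norm (cmod (g t) powr p) \<le> norm (M powr p * indicator {-M..M} t)"
      by (simp add: abs_mult)
  qed measurable
qed

lemma bounded_support_integrable:
  assumes "bounded_support g"
  shows "integrable lborel g"
proof (rule integrable_norm_cancel)
  show "integrable lborel (\<lambda>t. cmod (g t))"
    using bounded_support_integrable_powr[OF assms, of 1] by simp
  show "g \<in> borel_measurable lborel"
    using assms by (simp add: bounded_support_def)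
qed

lemma cauchy_transform_add:
  assumes "integrable lborel f" "integrable lborel g" "Im z > 0"
  shows "cauchy_transform (\<lambda>t. f t + g t) z = cauchy_transform f z + cauchy_transform g z"
  using assms by (simp add: cauchy_transform_def add_divide_distrib cauchy_integrand_integrable distrib_left)

lemma cauchy_transform_cmult:
  "cauchy_transform (\<lambda>t. c * f t) z = c * cauchy_transform f z"
  by (simp add: cauchy_transform_def flip: times_divide_eq_right)

lemma cauchy_transform_line_measurable:
  assumes "integrable lborel g" "y > 0"
  shows "(\<lambda>x. cauchy_transform g (Complex x y)) \<in> borel_measurable borel"
proof -
  have "continuous_on UNIV (\<lambda>x. cauchy_transform g (Complex x y))"
    by (rule continuous_on_compose2[OF holomorphic_on_imp_continuous_on[OF cauchy_transform_holomorphic[OF assms(1)]]])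
       (use assms in \<open>auto intro!: continuous_intros simp: Complex_eq\<close>)
  then show ?thesis by (rule borel_measurable_continuous_onI)
qed

text \<open>\<open>g\<close> is split into the positive and negative parts of its real and imaginary
  parts, each dominated by \<open>cmod g\<close>. Two levels of \<open>pmass_add_le\<close> assemble
  the four estimates into \<open>K\<close>, which depends neither on \<open>g\<close> nor on the
  height \<open>y\<close>.\<close>

theorem riesz_cauchy_transform:
  assumes p: "1 < p" "p \<le> 2"
  obtains K where "K \<ge> 0"
    "\<And>g y. bounded_support g \<Longrightarrow> y > 0 \<Longrightarrow>
       pmass p (\<lambda>x. cauchy_transform g (Complex x y)) \<le> ennreal K * pmass p g"
proof -
  obtain A B :: real where AB: "A \<ge> 0" "B \<ge> 0"
    "\<And>z. Re z > 0 \<Longrightarrow> cmod z powr p \<le> A * Re z powr p - B * Re (z powr of_real p)"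
    using riesz_angle_inequality[OF p] by blast
  define c where "c = (2::real) powr p"
  have c: "c \<ge> 0" by (simp add: c_def)
  define K where "K = c * (c * (A + A) + c * (A + A))"
  have "pmass p (\<lambda>x. cauchy_transform g (Complex x y)) \<le> ennreal K * pmass p g"
    if g: "bounded_support g" and y: "y > 0" for g y
  proof -
    have mg[measurable]: "g \<in> borel_measurable borel" using g by (simp add: bounded_support_def)
    \<comment> \<open>The unimodular \<open>\<kappa>\<close> absorbs the coefficients
      \<open>1\<close>, \<open>-1\<close>, \<open>\<i>\<close> and \<open>-\<i>\<close> of the four
      parts, which do not change the mass.\<close>
    have part: "integrable lborel (\<lambda>t. complex_of_real (u t)) \<and>
        (\<forall>\<kappa>. cmod \<kappa> = 1 \<longrightarrow> pmass p (\<lambda>x. \<kappa> * cauchy_transform (\<lambda>t. of_real (u t)) (Complex x y)) \<le> ennreal A * pmass p g)"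
      if u: "\<And>t. 0 \<le> u t" "\<And>t. u t \<le> cmod (g t)" and [measurable]: "u \<in> borel_measurable borel" for u
    proof -
      have b: "bounded_support (\<lambda>t. complex_of_real (u t))"
        by (rule bounded_support_le[OF g]) (use u in auto)
      obtain M where M: "M \<ge> 0" "\<And>t. cmod (g t) \<le> M" "\<And>t. \<bar>t\<bar> > M \<Longrightarrow> g t = 0"
        by (rule bounded_supportE[OF g], rule that)
      note ci = bounded_support_integrable[OF b]
      have i: "integrable lborel u" using integrable_Re[OF ci] by simp
      have "integrable lborel (\<lambda>t. cmod (complex_of_real (u t)) powr p)"
        using p by (intro bounded_support_integrable_powr[OF b]) linarith
      then have ip: "integrable lborel (\<lambda>t. u t powr p)"
        by (simp add: u(1))
      have s: "u t = 0" if "\<bar>t\<bar> > M" for t using u(1)[of t] u(2)[of t] M(3)[OF that] by simp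
      have "pmass p (\<lambda>x. cauchy_transform (\<lambda>t. of_real (u t)) (Complex x y)) \<le> ennreal A * pmass p (\<lambda>t. of_real (u t))"
        by (rule riesz_cauchy_transform_nonneg[OF p(1) AB i u(1) ip s M(1) y])
      also have "\<dots> \<le> ennreal A * pmass p g"
        using p u by (intro mult_left_mono pmass_mono) auto
      finally show ?thesis using ci p y by (simp add: pmass_def norm_mult)
    qed
    define u1 where "u1 t = max 0 (Re (g t))" for t
    define u2 where "u2 t = max 0 (- Re (g t))" for t
    define u3 where "u3 t = max 0 (Im (g t))" for t
    define u4 where "u4 t = max 0 (- Im (g t))" for t
    have R: "(\<lambda>t. Re (g t)) \<in> borel_measurable borel" "(\<lambda>t. Im (g t)) \<in> borel_measurable borel"
      by (rule measurable_compose[OF mg borel_measurable_Re], rule measurable_compose[OF mg borel_measurable_Im])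
    have [measurable]: "u1 \<in> borel_measurable borel" "u2 \<in> borel_measurable borel"
      "u3 \<in> borel_measurable borel" "u4 \<in> borel_measurable borel"
      unfolding u1_def[abs_def] u2_def[abs_def] u3_def[abs_def] u4_def[abs_def]
      by (intro borel_measurable_max borel_measurable_const borel_measurable_uminus R)+
    have le: "u1 t \<le> cmod (g t)" "u2 t \<le> cmod (g t)" "u3 t \<le> cmod (g t)" "u4 t \<le> cmod (g t)" for t
      using abs_Re_le_cmod[of "g t"] abs_Im_le_cmod[of "g t"]
      by (auto simp: u1_def u2_def u3_def u4_def)
    have nn: "0 \<le> u1 t" "0 \<le> u2 t" "0 \<le> u3 t" "0 \<le> u4 t" for t
      by (auto simp: u1_def u2_def u3_def u4_def)
    have geq: "g = (\<lambda>t. (1 * of_real (u1 t) + (-1) * of_real (u2 t)) + (\<i> * of_real (u3 t) + (-\<i>) * of_real (u4 t)))"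
      by (auto simp: fun_eq_iff complex_eq_iff u1_def u2_def u3_def u4_def)
    note p1 = part[OF nn(1) le(1)] and p2 = part[OF nn(2) le(2)]
      and p3 = part[OF nn(3) le(3)] and p4 = part[OF nn(4) le(4)]
    let ?T = "\<lambda>u x. cauchy_transform (\<lambda>t. complex_of_real (u t)) (Complex x y)"
    have ct: "cauchy_transform g (Complex x y) = (1 * ?T u1 x + (-1) * ?T u2 x) + (\<i> * ?T u3 x + (-\<i>) * ?T u4 x)" for x
    proof -
      have "cauchy_transform g (Complex x y) =
         cauchy_transform (\<lambda>t. 1 * of_real (u1 t) + (-1) * of_real (u2 t)) (Complex x y) +
         cauchy_transform (\<lambda>t. \<i> * of_real (u3 t) + (-\<i>) * of_real (u4 t)) (Complex x y)"
        by (subst geq, rule cauchy_transform_add) (use p1 p2 p3 p4 y in auto)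
      also have "cauchy_transform (\<lambda>t. 1 * of_real (u1 t) + (-1) * of_real (u2 t)) (Complex x y)
          = 1 * ?T u1 x + (-1) * ?T u2 x"
        unfolding cauchy_transform_cmult[symmetric]
        by (rule cauchy_transform_add) (use p1 p2 y in auto)
      also have "cauchy_transform (\<lambda>t. \<i> * of_real (u3 t) + (-\<i>) * of_real (u4 t)) (Complex x y)
          = \<i> * ?T u3 x + (-\<i>) * ?T u4 x"
        unfolding cauchy_transform_cmult[symmetric]
        by (rule cauchy_transform_add) (use p3 p4 y in auto)
      finally show ?thesis .
    qed
    have [measurable]: "?T u1 \<in> borel_measurable borel" "?T u2 \<in> borel_measurable borel"
       "?T u3 \<in> borel_measurable borel" "?T u4 \<in> borel_measurable borel"
      using p1 p2 p3 p4 y by (auto intro!: cauchy_transform_line_measurable)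
    let ?X = "ennreal A * pmass p g"
    have q: "pmass p (\<lambda>x. 1 * ?T u1 x) \<le> ?X" "pmass p (\<lambda>x. (-1) * ?T u2 x) \<le> ?X"
       "pmass p (\<lambda>x. \<i> * ?T u3 x) \<le> ?X" "pmass p (\<lambda>x. (-\<i>) * ?T u4 x) \<le> ?X"
      using p1[THEN conjunct2, rule_format, of 1] p2[THEN conjunct2, rule_format, of "-1"]
         p3[THEN conjunct2, rule_format, of \<i>] p4[THEN conjunct2, rule_format, of "-\<i>"] by simp_all
    have p0: "p > 0" using p by simp
    have b1: "pmass p (\<lambda>x. 1 * ?T u1 x + (-1) * ?T u2 x) \<le> ennreal c * (?X + ?X)"
      unfolding c_def
      by (rule order_trans[OF pmass_add_le[OF p0] mult_left_mono[OF add_mono[OF q(1,2)]]]) simp_all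
    have b2: "pmass p (\<lambda>x. \<i> * ?T u3 x + (-\<i>) * ?T u4 x) \<le> ennreal c * (?X + ?X)"
      unfolding c_def
      by (rule order_trans[OF pmass_add_le[OF p0] mult_left_mono[OF add_mono[OF q(3,4)]]]) simp_all
    have "pmass p (\<lambda>x. cauchy_transform g (Complex x y)) \<le>
        ennreal c * (ennreal c * (?X + ?X) + ennreal c * (?X + ?X))"
      unfolding ct c_def
      by (rule order_trans[OF pmass_add_le[OF p0] mult_left_mono[OF add_mono[OF b1[unfolded c_def] b2[unfolded c_def]]]]) simp_all
    also have "\<dots> = ennreal K * pmass p g"
      unfolding K_def using c AB(1)
      by (simp only: ennreal_mult ennreal_plus add_nonneg_nonneg mult_nonneg_nonneg distrib_left distrib_right mult.assoc)
    finally show ?thesis .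
  qed
  moreover have "K \<ge> 0" using c AB(1) by (simp add: K_def)
  ultimately show ?thesis using that by blast
qed

section \<open>Blaschke products, the Christoffel-Darboux identity and bounds for the basis
  functions\<close>

lemma cmod_chi [simp]: "cmod (chi w) = 1"
  by (simp add: chi_def norm_divide)

lemma chi_cnj: "chi (cnj w) = cnj (chi w)"
proof -
  have e: "1 + (cnj w)\<^sup>2 = cnj (1 + w\<^sup>2)" by simp
  have "cmod (1 + (cnj w)\<^sup>2) = cmod (1 + w\<^sup>2)" unfolding e by (rule complex_mod_cnj)
  moreover have "1 + (cnj w)\<^sup>2 = 0 \<longleftrightarrow> 1 + w\<^sup>2 = 0" unfolding e by (rule complex_cnj_zero_iff)
  ultimately show ?thesis by (simp add: chi_def)
qed

lemma Bplus_Suc: "Bplus a (Suc n) z = Bplus a n z * (chi (a n) * ((z - a n) / (z - cnj (a n))))"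
  by (simp add: Bplus_def)

text \<open>The sum telescopes: with \<open>w = a n\<close>, each term reduces to the identity
  \<open>(z - cnj w) * (cnj u - w) - (z - w) * (cnj u - cnj w) = - (w - cnj w) * (z - cnj
  u)\<close>, and \<open>w - cnj w\<close> is \<open>2 * \<i> * Im w\<close>. The constants
  \<open>chi\<close> cancel because they have modulus \<open>1\<close>. Keeping the factor
  \<open>z - cnj u\<close> on the left avoids a division.\<close>

theorem christoffel_darboux:
  assumes "\<And>k. Im (a k) > 0" "\<And>k. z \<noteq> cnj (a k)" "\<And>k. u \<noteq> cnj (a k)"
  shows "(\<Sum>k<n. Phiplus a k z * cnj (Phiplus a k u)) * (- 2 * \<i> * (z - cnj u)) =
     1 - Bplus a n z * cnj (Bplus a n u)"
proof (induction n)
  case 0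
  then show ?case by (simp add: Bplus_def)
next
  case (Suc n)
  define B where "B = Bplus a n z * cnj (Bplus a n u)"
  let ?w = "a n"
  have nz: "z - cnj ?w \<noteq> 0" "cnj u - ?w \<noteq> 0"
    using assms(2)[of n] assms(3)[of n] by (auto simp: complex_eq_iff)
  have sq: "complex_of_real (sqrt (Im ?w)) * complex_of_real (sqrt (Im ?w)) = of_real (Im ?w)"
    using assms(1)[of n] by (simp flip: of_real_mult)
  have ch: "chi ?w * cnj (chi ?w) = 1"
    by (metis cmod_chi complex_norm_square of_real_1 power_one)
  have im: "2 * \<i> * of_real (Im ?w) = ?w - cnj ?w" by (simp add: complex_eq_iff)
  have P: "Phiplus a n z * cnj (Phiplus a n u) = of_real (Im ?w) * B / ((z - cnj ?w) * (cnj u - ?w))"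
  proof -
    have "Phiplus a n z * cnj (Phiplus a n u) = (complex_of_real (sqrt (Im ?w)) * complex_of_real (sqrt (Im ?w))) * B / ((z - cnj ?w) * (cnj u - ?w))"
      by (simp add: Phiplus_def B_def)
    then show ?thesis unfolding sq .
  qed
  have Q: "Bplus a (Suc n) z * cnj (Bplus a (Suc n) u) = B * ((z - ?w) * (cnj u - cnj ?w) / ((z - cnj ?w) * (cnj u - ?w)))"
  proof -
    have "Bplus a (Suc n) z * cnj (Bplus a (Suc n) u) = (chi ?w * cnj (chi ?w)) * (B * ((z - ?w) * (cnj u - cnj ?w) / ((z - cnj ?w) * (cnj u - ?w))))"
      by (simp add: Bplus_Suc B_def)
    then show ?thesis unfolding ch by simp
  qed
  have "Phiplus a n z * cnj (Phiplus a n u) * (- 2 * \<i> * (z - cnj u))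
     = - (2 * \<i> * of_real (Im ?w)) * (z - cnj u) * B / ((z - cnj ?w) * (cnj u - ?w))"
    unfolding P by simp
  also have "\<dots> = B - Bplus a (Suc n) z * cnj (Bplus a (Suc n) u)"
  proof -
    define D where "D = (z - cnj ?w) * (cnj u - ?w)"
    define N where "N = (z - ?w) * (cnj u - cnj ?w)"
    have D: "D \<noteq> 0" using nz by (simp add: D_def)
    have "- (?w - cnj ?w) * (z - cnj u) = D - N"
      by (simp add: D_def N_def algebra_simps)
    moreover have "(D - N) * B / D = B - B * (N / D)"
      using D by (simp add: field_simps)
    ultimately show ?thesis unfolding Q im D_def[symmetric] N_def[symmetric] by simp
  qed
  finally have "Phiplus a n z * cnj (Phiplus a n u) * (- 2 * \<i> * (z - cnj u)) = B - Bplus a (Suc n) z * cnj (Bplus a (Suc n) u)" .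
  with Suc show ?case unfolding sum.lessThan_Suc distrib_right B_def by simp
qed

text \<open>A point of the closed upper half plane is no farther from \<open>a k\<close> than from
  its mirror image \<open>cnj (a k)\<close>.\<close>

lemma Bplus_norm_le_1:
  assumes "\<And>k. Im (a k) > 0" "Im z \<ge> 0"
  shows "cmod (Bplus a n z) \<le> 1"
  unfolding Bplus_def prod_norm[symmetric]
proof (rule prod_le_1)
  fix k
  have "(cmod (z - a k))\<^sup>2 \<le> (cmod (z - cnj (a k)))\<^sup>2"
    unfolding cmod_power2 using assms(1)[of k] assms(2) by (simp add: power2_eq_square algebra_simps)
  then have "cmod (z - a k) \<le> cmod (z - cnj (a k))" by simp
  then show "0 \<le> cmod (chi (a k) * ((z - a k) / (z - cnj (a k)))) \<and> cmod (chi (a k) * ((z - a k) / (z - cnj (a k)))) \<le> 1"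
    by (simp add: norm_mult norm_divide divide_le_eq_1)
qed

lemma Phiplus_norm_le:
  assumes a: "\<And>k. Im (a k) > 0" and z: "Im z \<ge> 0"
  shows "cmod (Phiplus a n z) \<le> sqrt (Im (a n)) / cmod (z - cnj (a n))"
    and "cmod (Phiplus a n z) \<le> 1 / sqrt (Im (a n))"
proof -
  have "cmod (Phiplus a n z) = sqrt (Im (a n)) / cmod (z - cnj (a n)) * cmod (Bplus a n z)"
    using a[of n] by (simp add: Phiplus_def norm_mult norm_divide)
  also have "\<dots> \<le> sqrt (Im (a n)) / cmod (z - cnj (a n)) * 1"
    using a[of n] by (intro mult_left_mono Bplus_norm_le_1 a z) auto
  finally show 1: "cmod (Phiplus a n z) \<le> sqrt (Im (a n)) / cmod (z - cnj (a n))" by simp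
  have "Im (a n) \<le> cmod (z - cnj (a n))"
    using abs_Im_le_cmod[of "z - cnj (a n)"] z by simp
  then have "sqrt (Im (a n)) / cmod (z - cnj (a n)) \<le> sqrt (Im (a n)) / Im (a n)"
    using a[of n] by (intro divide_left_mono mult_pos_pos) auto
  also have "\<dots> = 1 / sqrt (Im (a n))"
    using a[of n] by (simp add: field_simps)
  finally show "cmod (Phiplus a n z) \<le> 1 / sqrt (Im (a n))" using 1 by linarith
qed

text \<open>First-order decay on the line places each basis function in every \<open>L_q\<close>
  with \<open>q > 1\<close>; this is what makes the coefficients of an \<open>L_p\<close> function
  well defined.\<close>

lemma Phiplus_real_decay:
  assumes a: "\<And>k. Im (a k) > 0"
  shows "\<exists>C\<ge>0. \<forall>t. cmod (Phiplus a n (of_real t)) \<le> C * (1 + \<bar>t\<bar>) powr - 1"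
proof -
  define L where "L = (1 + cmod (cnj (a n))) / \<bar>Im (cnj (a n))\<bar> + 1"
  have "cmod (Phiplus a n (of_real t)) \<le> (sqrt (Im (a n)) * L) * (1 + \<bar>t\<bar>) powr - 1" for t
  proof -
    have nz: "cmod (cnj (a n) - of_real t) > 0" using a[of n] by (auto simp: complex_eq_iff)
    have "1 + \<bar>t\<bar> \<le> L * cmod (cnj (a n) - of_real t)"
      unfolding L_def using a[of n] by (intro one_plus_abs_le) auto
    then have "1 / cmod (cnj (a n) - of_real t) \<le> L / (1 + \<bar>t\<bar>)"
      using nz by (intro one_div_le) auto
    then have "sqrt (Im (a n)) * (1 / cmod (cnj (a n) - of_real t)) \<le> sqrt (Im (a n)) * (L / (1 + \<bar>t\<bar>))"
      using a[of n] by (intro mult_left_mono) auto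
    with Phiplus_norm_le(1)[of a "of_real t" n, OF a] show ?thesis
      by (simp add: norm_minus_commute powr_minus divide_inverse)
  qed
  moreover have "sqrt (Im (a n)) * L \<ge> 0" using a[of n] by (simp add: L_def)
  ultimately show ?thesis by blast
qed

lemma Bplus_holomorphic:
  assumes "\<And>k z. k < n \<Longrightarrow> z \<in> S \<Longrightarrow> z \<noteq> cnj (a k)"
  shows "Bplus a n holomorphic_on S"
  unfolding Bplus_def[abs_def] using assms by (intro holomorphic_intros) auto

lemma Phiplus_holomorphic:
  assumes "\<And>k z. k \<le> n \<Longrightarrow> z \<in> S \<Longrightarrow> z \<noteq> cnj (a k)"
  shows "Phiplus a n holomorphic_on S"
  unfolding Phiplus_def[abs_def] using assms by (intro holomorphic_intros Bplus_holomorphic) auto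

text \<open>The only poles are the points \<open>cnj (a k)\<close> with \<open>k \<le> n\<close>, so
  the least of the numbers \<open>Im (a k)\<close> serves as \<open>d\<close>. It may shrink with
  \<open>n\<close>, which does no harm: it is used for one \<open>n\<close> at a time.\<close>

lemma Phiplus_holomorphic_half_plane:
  assumes a: "\<And>k. Im (a k) > 0"
  shows "\<exists>d>0. Phiplus a n holomorphic_on {z. Im z > - d}"
proof -
  define d where "d = Min ((\<lambda>k. Im (a k)) ` {..n})"
  have "d > 0" unfolding d_def using a by (subst Min_gr_iff) auto
  moreover have "d \<le> Im (a k)" if "k \<le> n" for k unfolding d_def using that by (intro Min_le) auto
  then have "Phiplus a n holomorphic_on {z. Im z > - d}"
    by (intro Phiplus_holomorphic) (force simp: complex_eq_iff)
  ultimately show ?thesis by blast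
qed

lemma Phiplus_continuous_upper:
  assumes a: "\<And>k. Im (a k) > 0"
  shows "continuous_on {z. Im z \<ge> 0} (Phiplus a n)"
proof -
  obtain d where d: "d > 0" "Phiplus a n holomorphic_on {z. Im z > - d}"
    using Phiplus_holomorphic_half_plane[of a n] a by auto
  show ?thesis
    by (rule continuous_on_subset[OF holomorphic_on_imp_continuous_on[OF d(2)]]) (use d(1) in auto)
qed

lemma Bplus_continuous_upper:
  assumes a: "\<And>k. Im (a k) > 0"
  shows "continuous_on {z. Im z \<ge> 0} (Bplus a n)"
proof -
  have "z \<noteq> cnj (a k)" if "Im z \<ge> 0" for z k using a[of k] that by (auto simp: complex_eq_iff)
  then show ?thesis by (intro holomorphic_on_imp_continuous_on Bplus_holomorphic) auto
qed

subsection \<open>Uniform boundedness of the partial sums\<close>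

lemma borel_measurable_cnj [measurable]: "cnj \<in> borel_measurable borel"
  by (intro borel_measurable_continuous_onI continuous_intros)

lemma Bplus_real_measurable [measurable]: "(\<lambda>t. Bplus a n (complex_of_real t)) \<in> borel_measurable borel"
  unfolding Bplus_def by measurable

lemma Phiplus_real_measurable [measurable]: "(\<lambda>t. Phiplus a n (complex_of_real t)) \<in> borel_measurable borel"
  unfolding Phiplus_def by measurable

lemma Phi_of_nat [simp]: "Phi a (int k) z = Phiplus a k z"
  by (simp add: Phi_def)

text \<open>The half of the partial sum with indices \<open>0 \<le> k < n\<close>. Its argument is
  complex so that it can be compared with Cauchy transforms above the axis.\<close>

definition Ppart :: "(nat \<Rightarrow> complex) \<Rightarrow> (real \<Rightarrow> complex) \<Rightarrow> nat \<Rightarrow> complex \<Rightarrow> complex" where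
  "Ppart a f n z = (\<Sum>k<n. coef a f (int k) * Phiplus a k z)"

lemma Ppart_real_measurable [measurable]: "(\<lambda>t. Ppart a f n (complex_of_real t)) \<in> borel_measurable borel"
  unfolding Ppart_def by measurable

lemma pmass_Fatou:
  assumes p: "p > 0" and F[measurable]: "\<And>m. F m \<in> borel_measurable borel"
    and lim: "\<And>x. (\<lambda>m. F m x) \<longlonglongrightarrow> f x" and le: "\<And>m. pmass p (F m) \<le> C"
  shows "pmass p f \<le> C"
proof -
  have L: "(\<lambda>m. ennreal (cmod (F m x) powr p)) \<longlonglongrightarrow> ennreal (cmod (f x) powr p)" for x
    using p by (intro tendsto_ennrealI tendsto_powr' tendsto_norm lim tendsto_const) auto
  have "pmass p f = (\<integral>\<^sup>+x. liminf (\<lambda>m. ennreal (cmod (F m x) powr p)) \<partial>lborel)"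
    unfolding pmass_def using L by (intro nn_integral_cong lim_imp_Liminf[symmetric]) auto
  also have "\<dots> \<le> liminf (\<lambda>m. pmass p (F m))"
    unfolding pmass_def by (rule nn_integral_liminf) measurable
  also have "\<dots> \<le> C"
    using le by (intro Liminf_le) auto
  finally show ?thesis .
qed

lemma Phiplus_bounded_integrable:
  assumes a: "\<And>k. Im (a k) > 0" and f: "integrable lborel f"
  shows "integrable lborel (\<lambda>t. f t * cnj (Phiplus a n (of_real t)))"
proof (rule Bochner_Integration.integrable_bound)
  show "integrable lborel (\<lambda>t. f t * of_real (1 / sqrt (Im (a n))))"
    using f by (rule integrable_mult_left)
  have "cmod (f t * cnj (Phiplus a n (of_real t))) \<le> cmod (f t * of_real (1 / sqrt (Im (a n))))" for t
  proof -
    have "cmod (Phiplus a n (of_real t)) \<le> cmod (complex_of_real (1 / sqrt (Im (a n))))"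
      using Phiplus_norm_le(2)[of a "of_real t" n] a less_imp_le[OF a[of n]]
      unfolding norm_of_real by simp
    then show ?thesis
      unfolding norm_mult complex_mod_cnj by (intro mult_left_mono) auto
  qed
  then show "AE t in lborel. norm (f t * cnj (Phiplus a n (of_real t))) \<le> norm (f t * of_real (1 / sqrt (Im (a n))))"
    by simp
qed (use f in measurable)

text \<open>The coefficient integrals are merged into one, and Christoffel-Darboux is applied with
  \<open>u = t\<close> real, so that \<open>cnj u = t\<close>. Since
  \<open>1 / (- 2 * \<i>) = \<i> / 2\<close>, the factor \<open>1 / pi\<close> of the coefficients
  becomes the constant \<open>\<i> / (2 * pi)\<close> of the Cauchy transform.\<close>

lemma Ppart_eq_cauchy_transform:
  assumes a: "\<And>k. Im (a k) > 0" and f: "integrable lborel f" and z: "Im z > 0"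
  shows "Ppart a f n z = cauchy_transform f z
     - Bplus a n z * cauchy_transform (\<lambda>t. f t * cnj (Bplus a n (of_real t))) z"
proof -
  have fB: "integrable lborel (\<lambda>t. f t * cnj (Bplus a n (of_real t)))"
  proof (rule Bochner_Integration.integrable_bound[OF f])
    show "AE t in lborel. norm (f t * cnj (Bplus a n (of_real t))) \<le> norm (f t)"
      using Bplus_norm_le_1[OF a] by (simp add: norm_mult mult_left_le)
  qed (use f in measurable)
  have "Ppart a f n z = (\<Sum>k<n. (\<integral>t. (1 / of_real pi) * (f t * cnj (Phiplus a k (of_real t))) * Phiplus a k z \<partial>lborel))"
    by (simp add: Ppart_def coef_def)
  also have "\<dots> = (\<integral>t. (\<Sum>k<n. (1 / of_real pi) * (f t * cnj (Phiplus a k (of_real t))) * Phiplus a k z) \<partial>lborel)"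
    using Phiplus_bounded_integrable[OF a f]
    by (intro Bochner_Integration.integral_sum[symmetric] integrable_mult_left integrable_mult_right)
  also have "\<dots> = (\<integral>t. (\<i> / of_real (2 * pi)) * (f t / (z - of_real t)) -
       (\<i> / of_real (2 * pi)) * Bplus a n z * (f t * cnj (Bplus a n (of_real t)) / (z - of_real t)) \<partial>lborel)"
  proof (intro Bochner_Integration.integral_cong refl)
    fix t
    have nz: "z - of_real t \<noteq> 0" using z by (auto simp: complex_eq_iff)
    have ne: "z \<noteq> cnj (a k)" "complex_of_real t \<noteq> cnj (a k)" for k
      using z a[of k] by (auto simp: complex_eq_iff)
    define S where "S = (\<Sum>k<n. Phiplus a k z * cnj (Phiplus a k (of_real t)))"
    have S: "S * (- 2 * \<i> * (z - of_real t)) = 1 - Bplus a n z * cnj (Bplus a n (of_real t))"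
      unfolding S_def using christoffel_darboux[of a z "of_real t" n, OF a ne] by simp
    have "S = (\<i> / 2) * (S * (- 2 * \<i> * (z - of_real t))) / (z - of_real t)"
      using nz by (simp add: field_simps)
    then have S': "S = (\<i> / 2) * (1 - Bplus a n z * cnj (Bplus a n (of_real t))) / (z - of_real t)"
      unfolding S .
    have "(\<Sum>k<n. (1 / of_real pi) * (f t * cnj (Phiplus a k (of_real t))) * Phiplus a k z) = f t / of_real pi * S"
      unfolding S_def sum_distrib_left by (intro sum.cong) auto
    also have "\<dots> = (\<i> / of_real (2 * pi)) * (f t / (z - of_real t)) -
       (\<i> / of_real (2 * pi)) * Bplus a n z * (f t * cnj (Bplus a n (of_real t)) / (z - of_real t))"
    proof -
      have c: "\<i> / complex_of_real (2 * pi) = inverse (of_real pi) * (\<i> / 2)"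
        by (simp add: field_simps)
      have alg: "u * q * (b * (1 - B * C) * d) = q * b * (u * d) - q * b * B * (u * C * d)"
        for u q b B C d :: complex by (simp add: algebra_simps)
      show ?thesis unfolding S' c by (simp only: divide_inverse alg)
    qed
    finally show "(\<Sum>k<n. (1 / of_real pi) * (f t * cnj (Phiplus a k (of_real t))) * Phiplus a k z) =
      (\<i> / of_real (2 * pi)) * (f t / (z - of_real t)) -
       (\<i> / of_real (2 * pi)) * Bplus a n z * (f t * cnj (Bplus a n (of_real t)) / (z - of_real t))" .
  qed
  also have "\<dots> = (\<i> / of_real (2 * pi)) * (\<integral>t. f t / (z - of_real t) \<partial>lborel) -
      (\<i> / of_real (2 * pi)) * Bplus a n z * (\<integral>t. f t * cnj (Bplus a n (of_real t)) / (z - of_real t) \<partial>lborel)"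
    unfolding Bochner_Integration.integral_diff[OF integrable_mult_right[OF cauchy_integrand_integrable[OF f z]]
       integrable_mult_right[OF cauchy_integrand_integrable[OF fB z]]]
    by (intro arg_cong2[where f="(-)"] integral_mult_right_zero)
  finally show ?thesis unfolding cauchy_transform_def by (simp only: mult_ac)
qed

text \<open>On the line of height \<open>y\<close> both terms of the representation are controlled
  by Cauchy transforms of functions no larger than \<open>f\<close>, with a bound free of
  \<open>y\<close>; Fatou's lemma along \<open>y = 1 / (m + 1)\<close> reaches the axis.
  \<open>K\<close> is fixed before \<open>a\<close>, \<open>f\<close> and \<open>n\<close>: this
  order of quantifiers is the uniformity needed later.\<close>

lemma Ppart_bounded_support:
  assumes p: "1 < p" "p \<le> 2"
  shows "\<exists>K\<ge>0. \<forall>a f n. (\<forall>k. Im (a k) > 0) \<longrightarrow> bounded_support f \<longrightarrow>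
       pmass p (\<lambda>x. Ppart a f n (of_real x)) \<le> ennreal K * pmass p f"
proof -
  obtain K where K: "K \<ge> 0"
    "\<And>g y. bounded_support g \<Longrightarrow> y > 0 \<Longrightarrow>
       pmass p (\<lambda>x. cauchy_transform g (Complex x y)) \<le> ennreal K * pmass p g"
    using riesz_cauchy_transform[OF p] by blast
  have p0: "p > 0" using p by simp
  define c where "c = (2::real) powr p"
  have c: "c \<ge> 0" by (simp add: c_def)
  have "pmass p (\<lambda>x. Ppart a f n (of_real x)) \<le> ennreal (c * (K + K)) * pmass p f"
    if a: "\<And>k. Im (a k) > 0" and f: "bounded_support f" for a f n
  proof -
    have mf[measurable]: "f \<in> borel_measurable borel" using f by (simp add: bounded_support_def)
    let ?fB = "\<lambda>t. f t * cnj (Bplus a n (of_real t))"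
    have le: "cmod (?fB t) \<le> cmod (f t)" for t
      using Bplus_norm_le_1[of a "of_real t" n, OF a] by (simp add: norm_mult mult_left_le)
    have fB: "bounded_support ?fB"
      by (rule bounded_support_le[OF f _ le]) measurable
    note fi = bounded_support_integrable[OF f] and fBi = bounded_support_integrable[OF fB]
    have line: "pmass p (\<lambda>x. Ppart a f n (Complex x y)) \<le> ennreal (c * (K + K)) * pmass p f \<and>
        (\<lambda>x. Ppart a f n (Complex x y)) \<in> borel_measurable borel" if y: "y > 0" for y
    proof -
      let ?u = "\<lambda>x. cauchy_transform f (Complex x y)"
      let ?v = "\<lambda>x. - Bplus a n (Complex x y) * cauchy_transform ?fB (Complex x y)"
      have eq: "(\<lambda>x. Ppart a f n (Complex x y)) = (\<lambda>x. ?u x + ?v x)"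
      proof
        fix x
        show "Ppart a f n (Complex x y) = ?u x + ?v x"
          using Ppart_eq_cauchy_transform[of a f "Complex x y" n, OF a fi] y by simp
      qed
      have contB: "continuous_on UNIV (\<lambda>x. Bplus a n (Complex x y))"
        by (rule continuous_on_compose2[OF Bplus_continuous_upper[OF a]])
           (use y in \<open>auto intro!: continuous_intros simp: Complex_eq\<close>)
      have mu: "?u \<in> borel_measurable borel"
        by (rule cauchy_transform_line_measurable[OF fi y])
      have mv: "?v \<in> borel_measurable borel"
        by (intro borel_measurable_times borel_measurable_uminus borel_measurable_continuous_onI[OF contB]
              cauchy_transform_line_measurable[OF fBi y])
      have "pmass p ?v \<le> pmass p (\<lambda>x. cauchy_transform ?fB (Complex x y))"
      proof (rule pmass_mono[OF p0])
        fix x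
        have "cmod (Bplus a n (Complex x y)) \<le> 1" using y by (intro Bplus_norm_le_1 a) auto
        then show "cmod (?v x) \<le> cmod (cauchy_transform ?fB (Complex x y))"
          by (simp add: norm_mult mult_left_le_one_le)
      qed
      also have "\<dots> \<le> ennreal K * pmass p ?fB" by (rule K(2)[OF fB y])
      also have "\<dots> \<le> ennreal K * pmass p f" by (intro mult_left_mono pmass_mono p0 le) auto
      finally have v: "pmass p ?v \<le> ennreal K * pmass p f" .
      have u: "pmass p ?u \<le> ennreal K * pmass p f" by (rule K(2)[OF f y])
      have "pmass p (\<lambda>x. ?u x + ?v x) \<le> ennreal c * (ennreal K * pmass p f + ennreal K * pmass p f)"
        unfolding c_def
        by (rule order_trans[OF pmass_add_le[OF p0 mu mv] mult_left_mono[OF add_mono[OF u v]]]) simp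
      also have "\<dots> = ennreal (c * (K + K)) * pmass p f"
        using c K(1) by (simp only: ennreal_mult ennreal_plus add_nonneg_nonneg mult_nonneg_nonneg distrib_left distrib_right mult.assoc)
      finally show ?thesis unfolding eq using mu mv by (auto intro!: borel_measurable_add)
    qed
    show ?thesis
    proof (rule pmass_Fatou[OF p0])
      let ?y = "\<lambda>m. inverse (real (Suc m))"
      show "(\<lambda>x. Ppart a f n (Complex x (?y m))) \<in> borel_measurable borel" for m
        using line[of "?y m"] by simp
      show "pmass p (\<lambda>x. Ppart a f n (Complex x (?y m))) \<le> ennreal (c * (K + K)) * pmass p f" for m
        using line[of "?y m"] by simp
      fix x
      have "(\<lambda>m. Complex x (?y m)) \<longlonglongrightarrow> Complex x 0"
        by (intro tendsto_intros LIMSEQ_inverse_real_of_nat)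
      then have "(\<lambda>m. Phiplus a k (Complex x (?y m))) \<longlonglongrightarrow> Phiplus a k (Complex x 0)" for k
        by (intro continuous_on_tendsto_compose[OF Phiplus_continuous_upper[OF a]]) auto
      then show "(\<lambda>m. Ppart a f n (Complex x (?y m))) \<longlonglongrightarrow> Ppart a f n (of_real x)"
        unfolding Ppart_def complex_of_real_def by (intro tendsto_intros) auto
    qed
  qed
  moreover have "c * (K + K) \<ge> 0" using c K(1) by simp
  ultimately show ?thesis by blast
qed

section \<open>From bounded support to all of \<open>L_p\<close>, and the dual range of
  exponents\<close>

lemma pmass_eq_integral:
  assumes "integrable lborel (\<lambda>x. cmod (f x) powr p)"
  shows "pmass p f = ennreal (\<integral>x. cmod (f x) powr p \<partial>lborel)"
  unfolding pmass_def using assms by (intro nn_integral_eq_integral) auto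

lemma pmass_finite_iff:
  assumes [measurable]: "f \<in> borel_measurable borel"
  shows "pmass p f < \<infinity> \<longleftrightarrow> integrable lborel (\<lambda>x. cmod (f x) powr p)"
  unfolding pmass_def by (simp add: integrable_iff_bounded)

lemma integrable_decay_powr:
  assumes [measurable]: "g \<in> borel_measurable borel" and q: "1 < q"
    and C: "C \<ge> 0" "\<And>t. cmod (g t) \<le> C * (1 + \<bar>t\<bar>) powr - 1"
  shows "integrable lborel (\<lambda>t. cmod (g t) powr q)"
proof (rule Bochner_Integration.integrable_bound)
  show "integrable lborel (\<lambda>t::real. C powr q * (1 + \<bar>t\<bar>) powr (- q))"
    using integrable_one_plus_abs_powr[OF q] by (rule integrable_mult_right)
  have "cmod (g t) powr q \<le> C powr q * (1 + \<bar>t\<bar>) powr (- q)" for t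
  proof -
    have "cmod (g t) powr q \<le> (C * (1 + \<bar>t\<bar>) powr - 1) powr q"
      using C(2)[of t] q by (intro powr_mono2) auto
    also have "\<dots> = C powr q * (1 + \<bar>t\<bar>) powr (- q)"
    proof -
      have "((1 + \<bar>t\<bar>) powr - 1) powr q = (1 + \<bar>t\<bar>) powr (- q)" by (simp only: powr_powr) simp
      then show ?thesis by (simp only: powr_mult)
    qed
    finally show ?thesis .
  qed
  then show "AE t in lborel. norm (cmod (g t) powr q) \<le> norm (C powr q * (1 + \<bar>t\<bar>) powr (- q))"
    by (simp add: abs_mult)
qed measurable

lemma integrable_mult_conjugate_exponents:
  fixes f g :: "real \<Rightarrow> complex"
  assumes pq: "1 < p" "1 < q" "1 / p + 1 / q = 1"
    and [measurable]: "f \<in> borel_measurable borel" "g \<in> borel_measurable borel"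
    and f: "integrable lborel (\<lambda>x. cmod (f x) powr p)" and g: "integrable lborel (\<lambda>x. cmod (g x) powr q)"
  shows "integrable lborel (\<lambda>x. f x * g x)"
proof (rule Bochner_Integration.integrable_bound)
  show "integrable lborel (\<lambda>x. cmod (f x) powr p / p + cmod (g x) powr q / q)"
    by (intro Bochner_Integration.integrable_add integrable_divide_zero f g)
  have "cmod (f x * g x) \<le> cmod (f x) powr p / p + cmod (g x) powr q / q" for x
    unfolding norm_mult using pq by (intro Youngs_inequality) auto
  then show "AE x in lborel. norm (f x * g x) \<le> norm (cmod (f x) powr p / p + cmod (g x) powr q / q)"
    by (intro AE_I2) (auto intro: order_trans[OF _ abs_ge_self])
qed measurable

lemma conjugate_exponent:
  fixes p :: real
  assumes "1 < p"
  shows "1 < p / (p - 1)" "1 / p + 1 / (p / (p - 1)) = 1" "(p - 1) * (p / (p - 1)) = p"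
  using assms by (auto simp: field_simps)

lemma Phiplus_integrable_powr:
  assumes a: "\<And>k. Im (a k) > 0" and q: "1 < q"
  shows "integrable lborel (\<lambda>t. cmod (Phiplus a n (of_real t)) powr q)"
proof -
  obtain C where "C \<ge> 0" "\<And>t. cmod (Phiplus a n (of_real t)) \<le> C * (1 + \<bar>t\<bar>) powr - 1"
    using Phiplus_real_decay[of a n] a by auto
  then show ?thesis by (intro integrable_decay_powr[OF _ q]) auto
qed

lemma Lp_mult_Phiplus_integrable:
  assumes a: "\<And>k. Im (a k) > 0" and p: "1 < p"
    and [measurable]: "f \<in> borel_measurable borel" and f: "integrable lborel (\<lambda>x. cmod (f x) powr p)"
  shows "integrable lborel (\<lambda>t. f t * cnj (Phiplus a n (of_real t)))"
proof -
  have "integrable lborel (\<lambda>t. cmod (cnj (Phiplus a n (of_real t))) powr (p / (p - 1)))"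
    unfolding complex_mod_cnj by (rule Phiplus_integrable_powr[OF a conjugate_exponent(1)[OF p]])
  then show ?thesis
    by (rule integrable_mult_conjugate_exponents[OF p conjugate_exponent(1,2)[OF p] _ _ f, rotated 2]) measurable
qed

lemma Ppart_real_decay:
  assumes a: "\<And>k. Im (a k) > 0"
  shows "\<exists>C\<ge>0. \<forall>t. cmod (Ppart a f n (of_real t)) \<le> C * (1 + \<bar>t\<bar>) powr - 1"
proof -
  have "\<forall>k. \<exists>C\<ge>0. \<forall>t. cmod (Phiplus a k (of_real t)) \<le> C * (1 + \<bar>t\<bar>) powr - 1"
    using Phiplus_real_decay[of a] a by blast
  then obtain C where C: "\<And>k. C k \<ge> 0" "\<And>k t. cmod (Phiplus a k (of_real t)) \<le> C k * (1 + \<bar>t\<bar>) powr - 1"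
    by metis
  let ?D = "\<Sum>k<n. cmod (coef a f (int k)) * C k"
  have "cmod (Ppart a f n (of_real t)) \<le> ?D * (1 + \<bar>t\<bar>) powr - 1" for t
  proof -
    have "cmod (Ppart a f n (of_real t)) \<le> (\<Sum>k<n. cmod (coef a f (int k)) * cmod (Phiplus a k (of_real t)))"
      unfolding Ppart_def by (rule order_trans[OF norm_sum]) (simp add: norm_mult)
    also have "\<dots> \<le> (\<Sum>k<n. cmod (coef a f (int k)) * (C k * (1 + \<bar>t\<bar>) powr - 1))"
      by (intro sum_mono mult_left_mono C) auto
    also have "\<dots> = ?D * (1 + \<bar>t\<bar>) powr - 1" unfolding sum_distrib_right by (simp add: mult.assoc)
    finally show ?thesis .
  qed
  moreover have "?D \<ge> 0" using C(1) by (intro sum_nonneg) auto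
  ultimately show ?thesis by blast
qed

text \<open>A qualitative statement with no uniformity in \<open>n\<close>. It makes the left-hand
  side of the duality estimate finite, so that half of it can be absorbed.\<close>

lemma Ppart_integrable_powr:
  assumes a: "\<And>k. Im (a k) > 0" and q: "1 < q"
  shows "integrable lborel (\<lambda>t. cmod (Ppart a f n (of_real t)) powr q)"
proof -
  obtain C where "C \<ge> 0" "\<And>t. cmod (Ppart a f n (of_real t)) \<le> C * (1 + \<bar>t\<bar>) powr - 1"
    using Ppart_real_decay[of a f n] a by auto
  then show ?thesis by (intro integrable_decay_powr[OF _ q]) auto
qed

definition trunc :: "(real \<Rightarrow> complex) \<Rightarrow> nat \<Rightarrow> real \<Rightarrow> complex" where
  "trunc f m x = (if \<bar>x\<bar> \<le> real m \<and> cmod (f x) \<le> real m then f x else 0)"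

lemma trunc_measurable [measurable]:
  assumes [measurable]: "f \<in> borel_measurable borel"
  shows "trunc f m \<in> borel_measurable borel"
  unfolding trunc_def[abs_def] by measurable

lemma trunc_le: "cmod (trunc f m x) \<le> cmod (f x)"
  by (simp add: trunc_def)

lemma trunc_bounded_support:
  assumes [measurable]: "f \<in> borel_measurable borel"
  shows "bounded_support (trunc f m)"
  unfolding bounded_support_def
proof (intro conjI exI allI)
  show "cmod (trunc f m t) \<le> real m * indicator {-real m..real m} t" for t
    by (auto simp: trunc_def indicator_def)
qed auto

lemma trunc_tendsto: "(\<lambda>m. trunc f m x) \<longlonglongrightarrow> f x"
proof (rule tendsto_eventually)
  show "\<forall>\<^sub>F m in sequentially. trunc f m x = f x"
    using eventually_ge_at_top[of "nat \<lceil>max \<bar>x\<bar> (cmod (f x))\<rceil>"]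
  proof eventually_elim
    case (elim m)
    then have "max \<bar>x\<bar> (cmod (f x)) \<le> real m" by linarith
    then show ?case by (simp add: trunc_def)
  qed
qed

text \<open>For fixed \<open>n\<close> only finitely many coefficients occur, and each converges by
  dominated convergence. Pointwise convergence is enough, because the bound is transferred by
  Fatou's lemma.\<close>

lemma Ppart_trunc_tendsto:
  assumes a: "\<And>k. Im (a k) > 0" and p: "1 < p"
    and [measurable]: "f \<in> borel_measurable borel" and f: "integrable lborel (\<lambda>x. cmod (f x) powr p)"
  shows "(\<lambda>m. Ppart a (trunc f m) n z) \<longlonglongrightarrow> Ppart a f n z"
proof -
  have "(\<lambda>m. coef a (trunc f m) (int k)) \<longlonglongrightarrow> coef a f (int k)" for k
    unfolding coef_def Phi_of_nat
  proof (intro tendsto_mult_left integral_dominated_convergence)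
    show "integrable lborel (\<lambda>t. cmod (f t * cnj (Phiplus a k (of_real t))))"
      by (intro integrable_norm Lp_mult_Phiplus_integrable[OF a p _ f]) measurable
    show "AE t in lborel. (\<lambda>m. trunc f m t * cnj (Phiplus a k (of_real t))) \<longlonglongrightarrow> f t * cnj (Phiplus a k (of_real t))"
      by (intro AE_I2 tendsto_mult_right trunc_tendsto)
    show "AE t in lborel. norm (trunc f m t * cnj (Phiplus a k (of_real t))) \<le> cmod (f t * cnj (Phiplus a k (of_real t)))" for m
      unfolding norm_mult by (intro AE_I2 mult_right_mono trunc_le) auto
  qed measurable
  then show ?thesis unfolding Ppart_def by (intro tendsto_intros)
qed

lemma Ppart_bounded_le_2:
  assumes p: "1 < p" "p \<le> 2"
  shows "\<exists>K\<ge>0. \<forall>a f n. (\<forall>k. Im (a k) > 0) \<longrightarrow> f \<in> borel_measurable borel \<longrightarrow>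
       integrable lborel (\<lambda>x. cmod (f x) powr p) \<longrightarrow>
       pmass p (\<lambda>x. Ppart a f n (of_real x)) \<le> ennreal K * pmass p f"
proof -
  obtain K where K: "K \<ge> 0"
    "\<forall>a f n. (\<forall>k. Im (a k) > 0) \<longrightarrow> bounded_support f \<longrightarrow>
       pmass p (\<lambda>x. Ppart a f n (of_real x)) \<le> ennreal K * pmass p f"
    using Ppart_bounded_support[OF p] by auto
  have p0: "p > 0" using p by simp
  have "pmass p (\<lambda>x. Ppart a f n (of_real x)) \<le> ennreal K * pmass p f"
    if a: "\<And>k. Im (a k) > 0" and mf[measurable]: "f \<in> borel_measurable borel"
      and f: "integrable lborel (\<lambda>x. cmod (f x) powr p)" for a f n
  proof (rule pmass_Fatou[OF p0])
    show "(\<lambda>m. Ppart a (trunc f m) n (of_real x)) \<longlonglongrightarrow> Ppart a f n (of_real x)" for x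
      by (rule Ppart_trunc_tendsto[OF a p(1) mf f])
    show "pmass p (\<lambda>x. Ppart a (trunc f m) n (of_real x)) \<le> ennreal K * pmass p f" for m
    proof -
      have "pmass p (\<lambda>x. Ppart a (trunc f m) n (of_real x)) \<le> ennreal K * pmass p (trunc f m)"
        using K(2) a trunc_bounded_support[OF mf] by blast
      also have "\<dots> \<le> ennreal K * pmass p f"
        by (intro mult_left_mono pmass_mono p0 trunc_le) auto
      finally show ?thesis .
    qed
  qed measurable
  then show ?thesis using K(1) by blast
qed

text \<open>The kernel of \<open>Ppart\<close> is hermitian: both sides equal \<open>pi\<close>
  times the sum over \<open>k < n\<close> of
  \<open>coef a f (int k) * cnj (coef a g (int k))\<close>.\<close>

lemma Ppart_adjoint:
  assumes a: "\<And>k. Im (a k) > 0" and pq: "1 < p" "1 < q"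
    and [measurable]: "f \<in> borel_measurable borel" "g \<in> borel_measurable borel"
    and f: "integrable lborel (\<lambda>x. cmod (f x) powr p)" and g: "integrable lborel (\<lambda>x. cmod (g x) powr q)"
  shows "(\<integral>x. Ppart a f n (of_real x) * cnj (g x) \<partial>lborel) = (\<integral>x. f x * cnj (Ppart a g n (of_real x)) \<partial>lborel)"
proof -
  have fi: "integrable lborel (\<lambda>t. f t * cnj (Phiplus a k (of_real t)))" for k
    by (rule Lp_mult_Phiplus_integrable[OF a pq(1) _ f]) measurable
  have gi: "integrable lborel (\<lambda>t. g t * cnj (Phiplus a k (of_real t)))" for k
    by (rule Lp_mult_Phiplus_integrable[OF a pq(2) _ g]) measurable
  have gi': "integrable lborel (\<lambda>t. cnj (g t * cnj (Phiplus a k (of_real t))))" for k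
    using gi[of k] by (rule integrable_cnj)
  have gc: "(\<integral>t. cnj (g t * cnj (Phiplus a k (of_real t))) \<partial>lborel) = of_real pi * cnj (coef a g (int k))" for k
  proof -
    have "(\<integral>t. g t * cnj (Phiplus a k (of_real t)) \<partial>lborel) = of_real pi * coef a g (int k)"
      unfolding coef_def Phi_of_nat by simp
    from arg_cong[OF this, of cnj] show ?thesis
      unfolding Bochner_Integration.integral_cnj by (simp only: Bochner_Integration.integral_cnj complex_cnj_mult complex_cnj_complex_of_real)
  qed
  have fc: "(\<integral>t. f t * cnj (Phiplus a k (of_real t)) \<partial>lborel) = of_real pi * coef a f (int k)" for k
    unfolding coef_def Phi_of_nat by simp
  have "(\<integral>x. Ppart a f n (of_real x) * cnj (g x) \<partial>lborel)
     = (\<integral>x. (\<Sum>k<n. coef a f (int k) * cnj (g x * cnj (Phiplus a k (of_real x)))) \<partial>lborel)"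
    unfolding Ppart_def sum_distrib_right by (simp add: mult_ac)
  also have "\<dots> = (\<Sum>k<n. (\<integral>x. coef a f (int k) * cnj (g x * cnj (Phiplus a k (of_real x))) \<partial>lborel))"
    by (intro Bochner_Integration.integral_sum integrable_mult_right gi')
  also have "\<dots> = (\<Sum>k<n. coef a f (int k) * (of_real pi * cnj (coef a g (int k))))"
    unfolding integral_mult_right_zero gc ..
  also have "\<dots> = (\<Sum>k<n. cnj (coef a g (int k)) * (of_real pi * coef a f (int k)))"
    by (simp add: mult_ac)
  also have "\<dots> = (\<Sum>k<n. (\<integral>x. cnj (coef a g (int k)) * (f x * cnj (Phiplus a k (of_real x))) \<partial>lborel))"
    unfolding integral_mult_right_zero fc ..
  also have "\<dots> = (\<integral>x. (\<Sum>k<n. cnj (coef a g (int k)) * (f x * cnj (Phiplus a k (of_real x)))) \<partial>lborel)"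
    by (intro Bochner_Integration.integral_sum[symmetric] integrable_mult_right fi)
  also have "\<dots> = (\<integral>x. f x * cnj (Ppart a g n (of_real x)) \<partial>lborel)"
    unfolding Ppart_def cnj_sum sum_distrib_left by (simp add: mult_ac)
  finally show ?thesis .
qed

text \<open>
  Duality: \<open>g = H \<bar>H\<bar>\<^sup>p\<^sup>-\<^sup>2\<close> has \<open>\<integral> H cnj g = \<integral> \<bar>H\<bar>\<^sup>p = \<integral> \<bar>g\<bar>\<^sup>q\<close>, and \<open>l\<close> weights Young's inequality so that the
  term with \<open>P\<^sub>n g\<close> is absorbed into half of the left-hand side.
\<close>

lemma Ppart_bounded_ge_2:
  assumes p: "2 \<le> p"
  shows "\<exists>K\<ge>0. \<forall>a f n. (\<forall>k. Im (a k) > 0) \<longrightarrow> f \<in> borel_measurable borel \<longrightarrow>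
       integrable lborel (\<lambda>x. cmod (f x) powr p) \<longrightarrow>
       pmass p (\<lambda>x. Ppart a f n (of_real x)) \<le> ennreal K * pmass p f"
proof -
  have p1: "1 < p" using p by simp
  define q where "q = p / (p - 1)"
  have q: "1 < q" "q \<le> 2" "1 / p + 1 / q = 1" "(p - 1) * q = p"
    using conjugate_exponent[OF p1] p by (auto simp: q_def field_simps)
  have q0: "q > 0" using q by simp
  obtain K where K: "K \<ge> 0"
    "\<forall>a g n. (\<forall>k. Im (a k) > 0) \<longrightarrow> g \<in> borel_measurable borel \<longrightarrow>
       integrable lborel (\<lambda>x. cmod (g x) powr q) \<longrightarrow>
       pmass q (\<lambda>x. Ppart a g n (of_real x)) \<le> ennreal K * pmass q g"
    using Ppart_bounded_le_2[OF q(1,2)] by blast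
  \<comment> \<open>Chosen so that \<open>l powr q = 2 * (K + 1)\<close>, hence
    \<open>K / l powr q \<le> 1 / 2\<close>. The summand \<open>1\<close> keeps \<open>l\<close>
    positive when \<open>K = 0\<close>.\<close>
  define l where "l = (2 * (K + 1)) powr (1 / q)"
  have l0: "l > 0" using K by (simp add: l_def)
  have lq: "l powr q = 2 * (K + 1)" using K q0 by (simp add: l_def powr_powr)
  have "pmass p (\<lambda>x. Ppart a f n (of_real x)) \<le> ennreal (2 * l powr p) * pmass p f"
    if a: "\<And>k. Im (a k) > 0" and mf[measurable]: "f \<in> borel_measurable borel"
      and f: "integrable lborel (\<lambda>x. cmod (f x) powr p)" for a f n
  proof -
    define H where "H x = Ppart a f n (complex_of_real x)" for x
    \<comment> \<open>At zeros of \<open>H\<close> the convention \<open>0 powr (p - 2) = 0\<close>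
      is harmless, because the factor \<open>H x\<close> vanishes there as well.\<close>
    define g where "g x = H x * of_real (cmod (H x) powr (p - 2))" for x
    define G where "G x = Ppart a g n (complex_of_real x)" for x
    have mH[measurable]: "H \<in> borel_measurable borel" unfolding H_def[abs_def] by measurable
    have mg[measurable]: "g \<in> borel_measurable borel" unfolding g_def[abs_def] by measurable
    have mG[measurable]: "G \<in> borel_measurable borel" unfolding G_def[abs_def] by measurable
    have iH: "integrable lborel (\<lambda>x. cmod (H x) powr p)"
      unfolding H_def by (rule Ppart_integrable_powr[OF a p1])
    have iG: "integrable lborel (\<lambda>x. cmod (G x) powr q)"
      unfolding G_def by (rule Ppart_integrable_powr[OF a q(1)])
    have ng: "cmod (g x) powr q = cmod (H x) powr p" for x
    proof -
      have "cmod (g x) = cmod (H x) powr 1 * cmod (H x) powr (p - 2)"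
        by (simp add: g_def norm_mult)
      also have "\<dots> = cmod (H x) powr (p - 1)" by (simp only: powr_add[symmetric]) simp
      finally show ?thesis by (simp add: powr_powr q(4))
    qed
    have ig: "integrable lborel (\<lambda>x. cmod (g x) powr q)" unfolding ng by (rule iH)
    have Hg: "H x * cnj (g x) = of_real (cmod (H x) powr p)" for x
    proof -
      have "H x * cnj (g x) = (H x * cnj (H x)) * of_real (cmod (H x) powr (p - 2))"
        by (simp add: g_def)
      also have "\<dots> = of_real ((cmod (H x))\<^sup>2 * cmod (H x) powr (p - 2))"
        by (simp add: complex_norm_square[symmetric])
      also have "(cmod (H x))\<^sup>2 * cmod (H x) powr (p - 2) = cmod (H x) powr p"
      proof (cases "H x = 0")
        case False
        then have "(cmod (H x))\<^sup>2 * cmod (H x) powr (p - 2) = cmod (H x) powr 2 * cmod (H x) powr (p - 2)"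
          by simp
        also have "\<dots> = cmod (H x) powr p" by (simp only: powr_add[symmetric]) simp
        finally show ?thesis .
      qed simp
      finally show ?thesis .
    qed
    define IH where "IH = (\<integral>x. cmod (H x) powr p \<partial>lborel)"
    define If where "If = (\<integral>x. cmod (f x) powr p \<partial>lborel)"
    define IG where "IG = (\<integral>x. cmod (G x) powr q \<partial>lborel)"
    have nn: "IH \<ge> 0" "If \<ge> 0" "IG \<ge> 0" by (simp_all add: IH_def If_def IG_def)
    have "pmass q G \<le> ennreal K * pmass q g"
      using K(2) a mg ig unfolding G_def[abs_def] by blast
    then have "ennreal IG \<le> ennreal K * ennreal IH"
      unfolding pmass_eq_integral[OF iG] pmass_eq_integral[OF ig] ng by (simp add: IG_def IH_def)
    then have KG: "IG \<le> K * IH"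
      using K(1) nn by (simp flip: ennreal_mult)
    have "of_real IH = (\<integral>x. H x * cnj (g x) \<partial>lborel)"
      unfolding Hg IH_def by (rule integral_complex_of_real[symmetric])
    also have "\<dots> = (\<integral>x. f x * cnj (G x) \<partial>lborel)"
      unfolding H_def G_def by (rule Ppart_adjoint[OF a p1 q(1) mf mg f ig])
    finally have adj: "complex_of_real IH = (\<integral>x. f x * cnj (G x) \<partial>lborel)" .
    have "IH = cmod (complex_of_real IH)" using nn by simp
    also have "\<dots> \<le> (\<integral>x. cmod (f x * cnj (G x)) \<partial>lborel)"
      unfolding adj by (rule integral_norm_bound)
    also have "\<dots> \<le> (\<integral>x. l powr p * cmod (f x) powr p + inverse (l powr q) * cmod (G x) powr q \<partial>lborel)"
    proof (rule Bochner_Integration.integral_mono)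
      show "integrable lborel (\<lambda>x. cmod (f x * cnj (G x)))"
      proof (rule integrable_norm, rule integrable_mult_conjugate_exponents[OF p1 q(1,3) mf _ f])
        show "(\<lambda>x. cnj (G x)) \<in> borel_measurable borel" by measurable
        show "integrable lborel (\<lambda>x. cmod (cnj (G x)) powr q)" unfolding complex_mod_cnj by (rule iG)
      qed
      show "integrable lborel (\<lambda>x. l powr p * cmod (f x) powr p + inverse (l powr q) * cmod (G x) powr q)"
        by (intro Bochner_Integration.integrable_add integrable_mult_right f iG)
      fix x
      have "cmod (f x * cnj (G x)) = (l * cmod (f x)) * (inverse l * cmod (G x))"
        using l0 by (simp add: norm_mult)
      also have "\<dots> \<le> (l * cmod (f x)) powr p / p + (inverse l * cmod (G x)) powr q / q"
        using l0 by (intro Youngs_inequality p1 q) auto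
      also have "\<dots> \<le> (l * cmod (f x)) powr p + (inverse l * cmod (G x)) powr q"
        using p1 q(1) by (intro add_mono) (auto simp: divide_le_eq mult_left_le_one_le intro!: mult_le_cancel_left1[THEN iffD2])
      also have "(l * cmod (f x)) powr p = l powr p * cmod (f x) powr p"
        by (rule powr_mult)
      also have "(inverse l * cmod (G x)) powr q = inverse (l powr q) * cmod (G x) powr q"
        unfolding powr_mult using l0 by (simp add: powr_def ln_inverse exp_minus)
      finally show "cmod (f x * cnj (G x)) \<le> l powr p * cmod (f x) powr p + inverse (l powr q) * cmod (G x) powr q" .
    qed
    also have "\<dots> = l powr p * If + inverse (l powr q) * IG"
      unfolding If_def IG_def
      by (subst Bochner_Integration.integral_add) (simp_all add: f iG)
    also have "\<dots> \<le> l powr p * If + inverse (l powr q) * (K * IH)"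
      using KG by (intro add_left_mono mult_left_mono) auto
    also have "inverse (l powr q) * (K * IH) \<le> IH / 2"
    proof -
      have "K * IH \<le> (K + 1) * IH" using nn by (simp add: distrib_right)
      then show ?thesis unfolding lq using K(1) by (simp add: field_simps)
    qed
    finally have "IH \<le> 2 * l powr p * If" by simp
    then have "ennreal IH \<le> ennreal (2 * l powr p) * ennreal If"
      using nn by (simp flip: ennreal_mult)
    moreover have "pmass p (\<lambda>x. Ppart a f n (of_real x)) = ennreal IH"
      using pmass_eq_integral[OF iH] by (simp add: H_def IH_def)
    moreover have "pmass p f = ennreal If"
      using pmass_eq_integral[OF f] by (simp add: If_def)
    ultimately show ?thesis by simp
  qed
  then show ?thesis by (intro exI[of _ "2 * l powr p"]) auto
qed

section \<open>Negative indices and the full partial sums\<close>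

text \<open>The index \<open>- 1 - k\<close> selects \<open>Phiminus\<close> at
  \<open>k + 1\<close>, whose pole parameter is \<open>bseq a (k + 1) = cnj (a k)\<close>; its
  product over \<open>1, ..., k\<close> runs over \<open>a 0, ..., a (k - 1)\<close> after the
  shift. For real \<open>x\<close>, exchanging each \<open>a j\<close> with its conjugate is the
  same as conjugating the value.\<close>

lemma Phi_neg:
  "Phi a (- 1 - int k) (complex_of_real x) = cnj (Phiplus a k (complex_of_real x))"
proof -
  have e: "nat (- (- 1 - int k)) = Suc k" by simp
  have "Bminus a (Suc k) (of_real x) = (\<Prod>j<k. chi (cnj (a j)) * ((of_real x - cnj (a j)) / (of_real x - a j)))"
    unfolding Bminus_def One_nat_def prod.atLeast_Suc_lessThan_Suc_shift
    by (simp add: bseq_def o_def atLeast0LessThan)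
  also have "\<dots> = cnj (Bplus a k (of_real x))"
    by (simp add: Bplus_def chi_cnj)
  finally have B: "Bminus a (Suc k) (of_real x) = cnj (Bplus a k (of_real x))" .
  show ?thesis
    unfolding Phi_def e using B by (simp add: Phiminus_def Phiplus_def bseq_def)
qed

lemma coef_neg: "coef a f (- 1 - int k) = cnj (coef a (\<lambda>t. cnj (f t)) (int k))"
proof -
  have "(\<integral>t. cnj (cnj (f t) * cnj (Phiplus a k (of_real t))) \<partial>lborel) =
      cnj (\<integral>t. cnj (f t) * cnj (Phiplus a k (of_real t)) \<partial>lborel)"
    by (rule Bochner_Integration.integral_cnj)
  then show ?thesis
    unfolding coef_def Phi_of_nat Phi_neg by simp
qed

lemma Spart_eq_Ppart:
  "Spart f a n x = Ppart a f n (of_real x) + cnj (Ppart a (\<lambda>t. cnj (f t)) n (of_real x))"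
proof -
  let ?t = "\<lambda>k. coef a f k * Phi a k (complex_of_real x)"
  have "{- int n..<int n} = (int ` {..<n}) \<union> ((\<lambda>k. - 1 - int k) ` {..<n})"
  proof (intro set_eqI iffI)
    fix j assume j: "j \<in> {- int n..<int n}"
    show "j \<in> (int ` {..<n}) \<union> ((\<lambda>k. - 1 - int k) ` {..<n})"
    proof (cases "j \<ge> 0")
      case True
      then have "j = int (nat j)" "nat j < n" using j by auto
      then show ?thesis by blast
    next
      case False
      then have "j = - 1 - int (nat (- 1 - j))" "nat (- 1 - j) < n" using j by auto
      then show ?thesis by blast
    qed
  qed auto
  then have "Spart f a n x = sum ?t (int ` {..<n}) + sum ?t ((\<lambda>k. - 1 - int k) ` {..<n})"
    unfolding Spart_def by (simp only:) (intro sum.union_disjoint, auto)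
  also have "sum ?t (int ` {..<n}) = Ppart a f n (of_real x)"
    by (subst sum.reindex) (auto simp: Ppart_def)
  also have "sum ?t ((\<lambda>k. - 1 - int k) ` {..<n}) = cnj (Ppart a (\<lambda>t. cnj (f t)) n (of_real x))"
    by (subst sum.reindex) (auto simp: Ppart_def inj_on_def Phi_neg coef_neg)
  finally show ?thesis .
qed

theorem Spart_bounded:
  assumes p: "1 < p"
  shows "\<exists>K\<ge>0. \<forall>a f n. (\<forall>k. Im (a k) > 0) \<longrightarrow> f \<in> borel_measurable borel \<longrightarrow>
       integrable lborel (\<lambda>x. cmod (f x) powr p) \<longrightarrow>
       pmass p (Spart f a n) \<le> ennreal K * pmass p f"
proof -
  have p0: "p > 0" using p by simp
  obtain K where K: "K \<ge> 0"
    "\<forall>a f n. (\<forall>k. Im (a k) > 0) \<longrightarrow> f \<in> borel_measurable borel \<longrightarrow>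
       integrable lborel (\<lambda>x. cmod (f x) powr p) \<longrightarrow>
       pmass p (\<lambda>x. Ppart a f n (of_real x)) \<le> ennreal K * pmass p f"
    using Ppart_bounded_le_2[OF p] Ppart_bounded_ge_2[of p] by (cases "p \<le> 2") auto
  define c where "c = (2::real) powr p"
  have c: "c \<ge> 0" by (simp add: c_def)
  have "pmass p (Spart f a n) \<le> ennreal (c * (K + K)) * pmass p f"
    if a: "\<forall>k. Im (a k) > 0" and mf[measurable]: "f \<in> borel_measurable borel"
      and f: "integrable lborel (\<lambda>x. cmod (f x) powr p)" for a f n
  proof -
    let ?g = "\<lambda>t. cnj (f t)"
    have 1: "pmass p (\<lambda>x. Ppart a f n (of_real x)) \<le> ennreal K * pmass p f"
      using K(2) a mf f by blast
    have "pmass p (\<lambda>x. Ppart a ?g n (of_real x)) \<le> ennreal K * pmass p ?g"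
    proof -
      have "?g \<in> borel_measurable borel" by measurable
      moreover have "integrable lborel (\<lambda>x. cmod (?g x) powr p)" unfolding complex_mod_cnj by (rule f)
      ultimately show ?thesis using K(2) a by blast
    qed
    then have 2: "pmass p (\<lambda>x. cnj (Ppart a ?g n (of_real x))) \<le> ennreal K * pmass p f"
      unfolding pmass_def complex_mod_cnj .
    have "pmass p (Spart f a n) \<le> ennreal c * (ennreal K * pmass p f + ennreal K * pmass p f)"
      unfolding c_def Spart_eq_Ppart[abs_def]
      by (rule order_trans[OF pmass_add_le[OF p0 _ _] mult_left_mono[OF add_mono[OF 1 2]]]) simp_all
    also have "\<dots> = ennreal (c * (K + K)) * pmass p f"
      using c K(1) by (simp only: ennreal_mult ennreal_plus add_nonneg_nonneg mult_nonneg_nonneg distrib_left distrib_right mult.assoc)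
    finally show ?thesis .
  qed
  moreover have "c * (K + K) \<ge> 0" using c K(1) by simp
  ultimately show ?thesis by blast
qed

subsection \<open>The functions approximated by their partial sums\<close>

definition in_Lp :: "real \<Rightarrow> (real \<Rightarrow> complex) \<Rightarrow> bool" where
  "in_Lp p f \<longleftrightarrow> f \<in> borel_measurable borel \<and> integrable lborel (\<lambda>x. cmod (f x) powr p)"

lemma in_Lp_pmass: "in_Lp p f \<longleftrightarrow> f \<in> borel_measurable borel \<and> pmass p f < \<infinity>"
  unfolding in_Lp_def using pmass_finite_iff by blast

lemma in_Lp_add:
  assumes "0 < p" "in_Lp p f" "in_Lp p g"
  shows "in_Lp p (\<lambda>x. f x + g x)"
proof -
  have [measurable]: "f \<in> borel_measurable borel" "g \<in> borel_measurable borel"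
    using assms by (auto simp: in_Lp_def)
  have "pmass p (\<lambda>x. f x + g x) \<le> ennreal (2 powr p) * (pmass p f + pmass p g)"
    by (rule pmass_add_le[OF assms(1)]) measurable
  also have "\<dots> < \<infinity>"
    using assms by (auto simp: in_Lp_pmass ennreal_mult_less_top)
  finally show ?thesis unfolding in_Lp_pmass by simp
qed

lemma in_Lp_cmult:
  assumes "0 < p" "in_Lp p f"
  shows "in_Lp p (\<lambda>x. c * f x)"
proof -
  have [measurable]: "f \<in> borel_measurable borel"
    using assms by (auto simp: in_Lp_def)
  show ?thesis
    using assms unfolding in_Lp_pmass by (auto simp: pmass_cmult ennreal_mult_less_top)
qed

lemma in_Lp_diff:
  assumes "0 < p" "in_Lp p f" "in_Lp p g"
  shows "in_Lp p (\<lambda>x. f x - g x)"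
  using in_Lp_add[OF assms(1,2) in_Lp_cmult[OF assms(1,3), of "-1"]] by simp

lemma Ppart_add:
  assumes a: "\<And>k. Im (a k) > 0" and p: "1 < p" and f: "in_Lp p f" and g: "in_Lp p g"
  shows "Ppart a (\<lambda>x. f x + g x) n z = Ppart a f n z + Ppart a g n z"
proof -
  have "coef a (\<lambda>x. f x + g x) (int k) = coef a f (int k) + coef a g (int k)" for k
  proof -
    have "(\<integral>t. (f t + g t) * cnj (Phiplus a k (of_real t)) \<partial>lborel) =
      (\<integral>t. f t * cnj (Phiplus a k (of_real t)) \<partial>lborel) + (\<integral>t. g t * cnj (Phiplus a k (of_real t)) \<partial>lborel)"
      unfolding distrib_right using f g
      by (intro Bochner_Integration.integral_add Lp_mult_Phiplus_integrable[OF a p]) (auto simp: in_Lp_def)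
    then show ?thesis unfolding coef_def Phi_of_nat by (simp add: distrib_left)
  qed
  then show ?thesis unfolding Ppart_def by (simp add: distrib_right sum.distrib)
qed

lemma Ppart_cmult: "Ppart a (\<lambda>x. c * f x) n z = c * Ppart a f n z"
proof -
  have "coef a (\<lambda>x. c * f x) k = c * coef a f k" for k
    unfolding coef_def mult.assoc integral_mult_right_zero by simp
  then show ?thesis unfolding Ppart_def by (simp add: sum_distrib_left mult.assoc)
qed

lemma in_Lp_cnj: "in_Lp p f \<Longrightarrow> in_Lp p (\<lambda>x. cnj (f x))"
  unfolding in_Lp_def by (auto intro: measurable_compose[OF _ borel_measurable_cnj])

lemma Spart_add:
  assumes a: "\<And>k. Im (a k) > 0" and p: "1 < p" and f: "in_Lp p f" and g: "in_Lp p g"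
  shows "Spart (\<lambda>x. f x + g x) a n x = Spart f a n x + Spart g a n x"
  unfolding Spart_eq_Ppart complex_cnj_add Ppart_add[OF a p f g] Ppart_add[OF a p in_Lp_cnj[OF f] in_Lp_cnj[OF g]]
  by simp

lemma Spart_cmult: "Spart (\<lambda>x. c * f x) a n x = c * Spart f a n x"
  unfolding Spart_eq_Ppart complex_cnj_mult Ppart_cmult by (simp add: distrib_left)

lemma Spart_measurable [measurable]: "Spart f a n \<in> borel_measurable borel"
  unfolding Spart_eq_Ppart[abs_def] by measurable

text \<open>The class of functions for which the convergence holds. It is shown to be a linear space
  closed under \<open>L_p\<close> limits, and then to exhaust \<open>L_p\<close>.\<close>

definition approximable :: "(nat \<Rightarrow> complex) \<Rightarrow> real \<Rightarrow> (real \<Rightarrow> complex) \<Rightarrow> bool" where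
  "approximable a p f \<longleftrightarrow> in_Lp p f \<and> (\<lambda>n. pmass p (\<lambda>x. f x - Spart f a n x)) \<longlonglongrightarrow> 0"

lemma ennreal_tendsto_0I:
  fixes X :: "nat \<Rightarrow> ennreal"
  assumes "\<And>e::real. e > 0 \<Longrightarrow> \<forall>\<^sub>F n in sequentially. X n \<le> ennreal e"
  shows "X \<longlonglongrightarrow> 0"
proof (rule order_tendstoI)
  fix y :: ennreal assume "0 < y"
  then obtain e where e: "e > 0" "ennreal e < y"
    by (metis dense ennreal_cases ennreal_0 ennreal_less_top less_top ennreal_less_zero_iff order_less_trans top.not_eq_extremum)
  from assms[OF e(1)] show "\<forall>\<^sub>F n in sequentially. X n < y"
    by eventually_elim (use e in auto)
qed auto

lemma approximable_add:
  assumes a: "\<And>k. Im (a k) > 0" and p: "1 < p" and f: "approximable a p f" and g: "approximable a p g"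
  shows "approximable a p (\<lambda>x. f x + g x)"
proof -
  have L: "in_Lp p f" "in_Lp p g" using f g by (auto simp: approximable_def)
  have p0: "0 < p" using p by simp
  have [measurable]: "f \<in> borel_measurable borel" "g \<in> borel_measurable borel"
    using L by (auto simp: in_Lp_def)
  let ?u = "\<lambda>n. pmass p (\<lambda>x. f x - Spart f a n x)" and ?v = "\<lambda>n. pmass p (\<lambda>x. g x - Spart g a n x)"
  have "(\<lambda>n. ?u n + ?v n) \<longlonglongrightarrow> 0 + 0"
    using f g by (intro tendsto_add) (auto simp: approximable_def)
  then have lim: "(\<lambda>n. ennreal (2 powr p) * (?u n + ?v n)) \<longlonglongrightarrow> ennreal (2 powr p) * (0 + 0)"
    by (intro ennreal_tendsto_cmult) auto
  have le: "pmass p (\<lambda>x. (f x + g x) - Spart (\<lambda>x. f x + g x) a n x) \<le> ennreal (2 powr p) * (?u n + ?v n)" for n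
  proof -
    have e: "(f x + g x) - Spart (\<lambda>x. f x + g x) a n x = (f x - Spart f a n x) + (g x - Spart g a n x)" for x
      unfolding Spart_add[OF a p L] by simp
    show ?thesis unfolding e by (rule pmass_add_le[OF p0]) measurable
  qed
  have "(\<lambda>n. pmass p (\<lambda>x. (f x + g x) - Spart (\<lambda>x. f x + g x) a n x)) \<longlonglongrightarrow> 0"
    by (rule tendsto_sandwich[OF _ _ tendsto_const lim[simplified]]) (use le in auto)
  then show ?thesis using in_Lp_add[OF p0 L] by (simp add: approximable_def)
qed

lemma approximable_cmult:
  assumes p: "0 < p" and f: "approximable a p f"
  shows "approximable a p (\<lambda>x. c * f x)"
proof -
  have L: "in_Lp p f" using f by (auto simp: approximable_def)
  have mf[measurable]: "f \<in> borel_measurable borel" using L by (auto simp: in_Lp_def)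
  have "(\<lambda>n. ennreal (cmod c powr p) * pmass p (\<lambda>x. f x - Spart f a n x)) \<longlonglongrightarrow> ennreal (cmod c powr p) * 0"
    using f by (intro ennreal_tendsto_cmult) (auto simp: approximable_def)
  moreover have "ennreal (cmod c powr p) * pmass p (\<lambda>x. f x - Spart f a n x) = pmass p (\<lambda>x. c * f x - Spart (\<lambda>x. c * f x) a n x)" for n
  proof -
    have "ennreal (cmod c powr p) * pmass p (\<lambda>x. f x - Spart f a n x) = pmass p (\<lambda>x. c * (f x - Spart f a n x))"
      by (rule pmass_cmult[OF p, symmetric]) measurable
    then show ?thesis unfolding Spart_cmult by (simp add: right_diff_distrib)
  qed
  ultimately show ?thesis using in_Lp_cmult[OF p L] by (simp add: approximable_def)
qed

lemma approximable_0:
  assumes "0 < p"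
  shows "approximable a p (\<lambda>x. 0)"
proof -
  have "Spart (\<lambda>x. 0) a n x = 0" for n x using Spart_cmult[of 0 "\<lambda>x. 0" a n x] by simp
  then show ?thesis by (simp add: approximable_def in_Lp_def pmass_def)
qed

lemma approximable_sum:
  assumes a: "\<And>k. Im (a k) > 0" and p: "1 < p" and "finite I" "\<And>i. i \<in> I \<Longrightarrow> approximable a p (f i)"
  shows "approximable a p (\<lambda>x. \<Sum>i\<in>I. f i x)"
  using assms(3,4)
proof (induction I rule: finite_induct)
  case empty
  then show ?case using approximable_0[of p a] p by simp
next
  case (insert i I)
  then have "approximable a p (\<lambda>x. f i x + (\<Sum>i\<in>I. f i x))"
    by (intro approximable_add[OF a p]) auto
  then show ?case using insert by simp
qed

text \<open>With \<open>r = f - F m\<close>, the error for \<open>f\<close> is the error for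
  \<open>F m\<close> plus \<open>r\<close> minus its partial sum. The uniform bound makes the terms
  with \<open>r\<close> small for all \<open>n\<close> at once, so \<open>m\<close> can be fixed
  before \<open>n\<close> grows.\<close>

lemma approximable_limit:
  assumes a: "\<And>k. Im (a k) > 0" and p: "1 < p" and f: "in_Lp p f"
    and F: "\<And>m::nat. approximable a p (F m)"
    and lim: "(\<lambda>m. pmass p (\<lambda>x. f x - F m x)) \<longlonglongrightarrow> 0"
  shows "approximable a p f"
proof -
  have p0: "0 < p" using p by simp
  define c where "c = (2::real) powr p"
  have c: "c > 0" by (simp add: c_def)
  obtain K where K: "K \<ge> 0"
    "\<forall>a f n. (\<forall>k. Im (a k) > 0) \<longrightarrow> f \<in> borel_measurable borel \<longrightarrow>
       integrable lborel (\<lambda>x. cmod (f x) powr p) \<longrightarrow>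
       pmass p (Spart f a n) \<le> ennreal K * pmass p f"
    using Spart_bounded[OF p] by blast
  have LF: "in_Lp p (F m)" for m using F by (simp add: approximable_def)
  have [measurable]: "f \<in> borel_measurable borel" "F m \<in> borel_measurable borel" for m
    using f LF by (auto simp: in_Lp_def)
  have "(\<lambda>n. pmass p (\<lambda>x. f x - Spart f a n x)) \<longlonglongrightarrow> 0"
  proof (rule ennreal_tendsto_0I)
    fix e :: real assume e: "e > 0"
    \<comment> \<open>Two nested uses of \<open>pmass_add_le\<close> lead to the total
      \<open>c * (c * (1 + K) + 1) * d\<close>, which this choice makes equal to
      \<open>e / 2\<close>.\<close>
    define d where "d = e / (2 * c * (c * (1 + K) + 1))"
    have pos: "2 * c * (c * (1 + K) + 1) > 0" using c K by (simp add: add_pos_pos)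
    have d: "d > 0" using e pos by (simp add: d_def)
    have "\<forall>\<^sub>F m in sequentially. pmass p (\<lambda>x. f x - F m x) < ennreal d"
      using lim d by (intro order_tendstoD(2)) auto
    then obtain m where m: "pmass p (\<lambda>x. f x - F m x) \<le> ennreal d"
      by (auto simp: eventually_sequentially intro: less_imp_le)
    let ?r = "\<lambda>x. f x - F m x"
    have Lr: "in_Lp p ?r" using f LF p0 by (intro in_Lp_diff)
    have Sr: "pmass p (Spart ?r a n) \<le> ennreal (K * d)" for n
    proof -
      have "pmass p (Spart ?r a n) \<le> ennreal K * pmass p ?r"
        using K(2) a Lr unfolding in_Lp_def by blast
      also have "\<dots> \<le> ennreal K * ennreal d" by (intro mult_left_mono m) auto
      finally show ?thesis using K(1) d by (simp add: ennreal_mult)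
    qed
    have Sd: "pmass p (\<lambda>x. - Spart ?r a n x) \<le> ennreal (K * d)" for n
      using Sr[of n] by (simp add: pmass_def)
    have "\<forall>\<^sub>F n in sequentially. pmass p (\<lambda>x. F m x - Spart (F m) a n x) < ennreal d"
      using F[of m] d by (intro order_tendstoD(2)[of _ 0]) (auto simp: approximable_def)
    then show "\<forall>\<^sub>F n in sequentially. pmass p (\<lambda>x. f x - Spart f a n x) \<le> ennreal e"
    proof eventually_elim
      case (elim n)
      have eqf: "f = (\<lambda>x. ?r x + F m x)" by simp
      have S: "Spart f a n x = Spart ?r a n x + Spart (F m) a n x" for x
        by (subst eqf, rule Spart_add[OF a p Lr LF])
      have e1: "f x - Spart f a n x = (?r x + - Spart ?r a n x) + (F m x - Spart (F m) a n x)" for x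
        unfolding S by simp
      have i1: "pmass p (\<lambda>x. ?r x + - Spart ?r a n x) \<le> ennreal (c * (d + K * d))"
      proof -
        have "pmass p (\<lambda>x. ?r x + - Spart ?r a n x) \<le> ennreal c * (ennreal d + ennreal (K * d))"
          unfolding c_def
          by (rule order_trans[OF pmass_add_le[OF p0] mult_left_mono[OF add_mono[OF m Sd[of n]]]]) simp_all
        then show ?thesis using c d K(1) by (simp add: ennreal_mult)
      qed
      have "pmass p (\<lambda>x. f x - Spart f a n x) \<le> ennreal c * (ennreal (c * (d + K * d)) + ennreal d)"
        unfolding e1 c_def
        by (rule order_trans[OF pmass_add_le[OF p0] mult_left_mono[OF add_mono[OF i1[unfolded c_def] less_imp_le[OF elim]]]]) simp_all
      also have "\<dots> = ennreal (c * (c * (d + K * d) + d))"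
        using c d K(1) by (simp add: ennreal_mult)
      also have "c * (c * (d + K * d) + d) = (c * (c * (1 + K) + 1)) * d"
        by (simp add: algebra_simps)
      also have "\<dots> = e / 2" using pos unfolding d_def by (simp add: field_simps)
      also have "ennreal (e / 2) \<le> ennreal e" using e by (intro ennreal_leI) auto
      finally show ?case .
    qed
  qed
  then show ?thesis using f by (simp add: approximable_def)
qed

lemma pmass_dominated:
  assumes p: "0 < p" and F[measurable]: "\<And>m. F m \<in> borel_measurable borel" and f[measurable]: "f \<in> borel_measurable borel"
    and w: "integrable lborel (\<lambda>x. w x powr p)" 
    and lim: "AE x in lborel. (\<lambda>m. F m x) \<longlonglongrightarrow> f x" and le: "\<And>m x. cmod (f x - F m x) \<le> w x"
  shows "(\<lambda>m. pmass p (\<lambda>x. f x - F m x)) \<longlonglongrightarrow> 0"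
proof -
  have w0: "w x \<ge> 0" for x using le norm_ge_zero order_trans by blast
  have "(\<lambda>m. \<integral>\<^sup>+x. ennreal (cmod (f x - F m x) powr p) \<partial>lborel) \<longlonglongrightarrow> (\<integral>\<^sup>+(x::real). 0 \<partial>lborel)"
  proof (rule nn_integral_dominated_convergence)
    show "(\<lambda>x. ennreal (w x powr p)) \<in> borel_measurable lborel" using w by measurable
    show "(\<integral>\<^sup>+x. ennreal (w x powr p) \<partial>lborel) < \<infinity>"
      using w by (simp add: integrable_iff_bounded)
    show "AE x in lborel. ennreal (cmod (f x - F m x) powr p) \<le> ennreal (w x powr p)" for m
      using p le by (intro AE_I2 ennreal_leI powr_mono2) auto
    show "AE x in lborel. (\<lambda>m. ennreal (cmod (f x - F m x) powr p)) \<longlonglongrightarrow> 0"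
      using lim
    proof eventually_elim
      case (elim x)
      then have "(\<lambda>m. cmod (f x - F m x)) \<longlonglongrightarrow> cmod (f x - f x)"
        by (intro tendsto_intros)
      then have "(\<lambda>m. cmod (f x - F m x) powr p) \<longlonglongrightarrow> cmod (f x - f x) powr p"
        using p by (intro tendsto_powr' tendsto_const) auto
      then have "(\<lambda>m. ennreal (cmod (f x - F m x) powr p)) \<longlonglongrightarrow> ennreal (cmod (f x - f x) powr p)"
        by (rule tendsto_ennrealI)
      then show ?case by simp
    qed
  qed measurable
  then show ?thesis by (simp add: pmass_def)
qed

section \<open>Decay of Blaschke products and expansion of Poisson averages\<close>

text \<open>A squared factor with zero \<open>w\<close> equals
  \<open>1 - 4 * Im z * Im w / (cmod (z - cnj w))\<^sup>2\<close>, and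
  \<open>1 - t \<le> exp (- t)\<close>. The denominator is at most
  \<open>2 * (1 + (cmod z)\<^sup>2) * (1 + (cmod w)\<^sup>2)\<close>, which isolates the term of the
  divergent series. The rate is explicit in \<open>z\<close>, as is needed for uniformity over a
  segment.\<close>

lemma Bplus_norm_le_exp:
  assumes a: "\<And>k. Im (a k) > 0" and z: "Im z > 0"
  shows "(cmod (Bplus a n z))\<^sup>2 \<le> exp (- (2 * Im z / (1 + (cmod z)\<^sup>2)) * (\<Sum>k<n. \<bar>Im (a k)\<bar> / (1 + (cmod (a k))\<^sup>2)))"
proof -
  define c where "c = 2 * Im z / (1 + (cmod z)\<^sup>2)"
  have factor: "(cmod (chi w * ((z - w) / (z - cnj w))))\<^sup>2 \<le> exp (- c * (\<bar>Im w\<bar> / (1 + (cmod w)\<^sup>2)))"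
    if w: "Im w > 0" for w
  proof -
    have nz: "z - cnj w \<noteq> 0" using z w by (auto simp: complex_eq_iff)
    then have pos: "(cmod (z - cnj w))\<^sup>2 > 0" by simp
    have "(cmod (z - w))\<^sup>2 = (cmod (z - cnj w))\<^sup>2 - 4 * Im z * Im w"
      unfolding cmod_power2 by (simp add: power2_eq_square algebra_simps)
    then have "(cmod (chi w * ((z - w) / (z - cnj w))))\<^sup>2 = 1 - 4 * Im z * Im w / (cmod (z - cnj w))\<^sup>2"
      unfolding norm_mult norm_divide cmod_chi mult_1_left power_divide
      using pos by (simp add: diff_divide_distrib)
    also have "\<dots> \<le> exp (- (4 * Im z * Im w / (cmod (z - cnj w))\<^sup>2))"
      using exp_ge_add_one_self[of "- (4 * Im z * Im w / (cmod (z - cnj w))\<^sup>2)"] by simp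
    also have "\<dots> \<le> exp (- c * (\<bar>Im w\<bar> / (1 + (cmod w)\<^sup>2)))"
    proof -
      have "cmod (z - cnj w) \<le> cmod z + cmod w" using norm_triangle_ineq4[of z "cnj w"] by simp
      then have "(cmod (z - cnj w))\<^sup>2 \<le> (cmod z + cmod w)\<^sup>2" by (intro power_mono) auto
      also have "\<dots> \<le> 2 * ((cmod z)\<^sup>2 + (cmod w)\<^sup>2)"
        using sum_squares_ge_zero[of "cmod z - cmod w" 0] by (simp add: power2_eq_square algebra_simps)
      also have "\<dots> \<le> 2 * ((1 + (cmod z)\<^sup>2) * (1 + (cmod w)\<^sup>2))"
        by (simp add: algebra_simps)
      finally have le: "(cmod (z - cnj w))\<^sup>2 \<le> 2 * ((1 + (cmod z)\<^sup>2) * (1 + (cmod w)\<^sup>2))" .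
      have "c * (\<bar>Im w\<bar> / (1 + (cmod w)\<^sup>2)) = 4 * Im z * Im w / (2 * ((1 + (cmod z)\<^sup>2) * (1 + (cmod w)\<^sup>2)))"
        using w by (simp add: c_def mult_ac)
      also have "\<dots> \<le> 4 * Im z * Im w / (cmod (z - cnj w))\<^sup>2"
        using z w le pos by (intro divide_left_mono mult_pos_pos) (auto intro!: add_pos_nonneg)
      finally show ?thesis by simp
    qed
    finally show ?thesis .
  qed
  have "(cmod (Bplus a n z))\<^sup>2 = (\<Prod>k<n. (cmod (chi (a k) * ((z - a k) / (z - cnj (a k)))))\<^sup>2)"
    unfolding Bplus_def prod_norm[symmetric] prod_power_distrib ..
  also have "\<dots> \<le> (\<Prod>k<n. exp (- c * (\<bar>Im (a k)\<bar> / (1 + (cmod (a k))\<^sup>2))))"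
    by (intro prod_mono conjI factor a zero_le_power2)
  also have "\<dots> = exp (- c * (\<Sum>k<n. \<bar>Im (a k)\<bar> / (1 + (cmod (a k))\<^sup>2)))"
    by (simp add: exp_sum sum_distrib_left)
  finally show ?thesis by (simp add: c_def)
qed

lemma integrable_indicator_Icc [simp]: "integrable lborel (indicator {\<alpha>..\<beta>::real} :: real \<Rightarrow> real)"
  by (rule integrable_real_indicator) (auto simp: emeasure_lborel_Icc_eq)

text \<open>Written as the Poisson integral of an indicator, with base point
  \<open>x + \<i> y\<close>. By \<open>poisson_swap\<close> it is also, as a function of
  \<open>x\<close>, the superposition of the Poisson kernels with poles \<open>s + \<i> y\<close>,
  \<open>s\<close> ranging over the interval; the expansion uses this second view.\<close>

definition poisson_average :: "real \<Rightarrow> real \<Rightarrow> real \<Rightarrow> real \<Rightarrow> real" where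
  "poisson_average \<alpha> \<beta> y x = (\<integral>s. poisson (Complex x y) s * indicator {\<alpha>..\<beta>} s \<partial>lborel)"

text \<open>The angle under which the interval is seen from \<open>x + \<i> y\<close>, divided by
  \<open>pi\<close>. The closed form gives the bounds by \<open>0\<close> and \<open>1\<close> and
  the limit as \<open>y\<close> tends to \<open>0\<close>.\<close>

lemma poisson_average_arctan:
  assumes "\<alpha> \<le> \<beta>" "y > 0"
  shows "poisson_average \<alpha> \<beta> y x = (arctan ((\<beta> - x) / y) - arctan ((\<alpha> - x) / y)) / pi"
proof -
  have "((\<lambda>s. arctan ((s - x) / y) / pi) has_real_derivative poisson (Complex x y) s) (at s)" for s
  proof -
    have "((\<lambda>s. arctan ((s - x) / y) / pi) has_real_derivative (inverse (1 + ((s - x) / y)\<^sup>2) * (1 / y)) / pi) (at s)"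
      using assms by (auto intro!: derivative_eq_intros)
    also have "(inverse (1 + ((s - x) / y)\<^sup>2) * (1 / y)) / pi = poisson (Complex x y) s"
    proof -
      have "1 + ((s - x) / y)\<^sup>2 = ((x - s)\<^sup>2 + y\<^sup>2) / y\<^sup>2"
        using assms by (simp add: power_divide field_simps power2_commute)
      then show ?thesis unfolding poisson_def cmod_power2
        using assms by (simp add: power2_eq_square)
    qed
    finally show ?thesis .
  qed
  moreover have "isCont (poisson (Complex x y)) s" for s
    unfolding poisson_def using assms by (intro continuous_intros) (auto simp: complex_eq_iff)
  ultimately show ?thesis
    unfolding poisson_average_def using integral_FTC_Icc_real[OF assms(1), of "\<lambda>s. arctan ((s - x) / y) / pi" "poisson (Complex x y)"]
    by (simp add: diff_divide_distrib)
qed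

lemma poisson_average_measurable [measurable]: "poisson_average \<alpha> \<beta> y \<in> borel_measurable borel"
proof -
  have [measurable]: "(\<lambda>(x, s). poisson (Complex x y) s) \<in> borel_measurable (borel \<Otimes>\<^sub>M borel)"
    unfolding poisson_def cmod_power2 by simp
  show ?thesis unfolding poisson_average_def[abs_def] by measurable
qed

lemma poisson_average_bounds:
  assumes "\<alpha> \<le> \<beta>" "y > 0"
  shows "0 \<le> poisson_average \<alpha> \<beta> y x" "poisson_average \<alpha> \<beta> y x \<le> 1"
proof -
  have "arctan ((\<alpha> - x) / y) \<le> arctan ((\<beta> - x) / y)"
    using assms by (simp add: arctan_le_iff divide_right_mono)
  then show "0 \<le> poisson_average \<alpha> \<beta> y x"
    unfolding poisson_average_arctan[OF assms] by simp
  have "arctan ((\<beta> - x) / y) - arctan ((\<alpha> - x) / y) \<le> pi"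
    using arctan_bounded[of "(\<beta> - x) / y"] arctan_bounded[of "(\<alpha> - x) / y"] by linarith
  then show "poisson_average \<alpha> \<beta> y x \<le> 1"
    unfolding poisson_average_arctan[OF assms] by simp
qed

text \<open>The bound does not involve \<open>y\<close>, so it is a common majorant as
  \<open>y\<close> tends to \<open>0\<close>. For \<open>\<bar>x\<bar> < 2 * M + 1\<close> the
  trivial bound \<open>1\<close> suffices; otherwise
  \<open>\<bar>x - s\<bar> \<ge> (1 + \<bar>x\<bar>) / 2\<close> on the interval. First-order decay
  is enough since it is raised to a power \<open>p > 1\<close>.\<close>

lemma poisson_average_decay:
  assumes ab: "\<alpha> \<le> \<beta>" and M: "\<bar>\<alpha>\<bar> \<le> M" "\<bar>\<beta>\<bar> \<le> M" and y: "0 < y" "y \<le> 1"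
  shows "poisson_average \<alpha> \<beta> y x \<le> (2 * M + 2 + 4 * (\<beta> - \<alpha>)) * (1 + \<bar>x\<bar>) powr - 1"
proof (cases "\<bar>x\<bar> < 2 * M + 1")
  case True
  have "poisson_average \<alpha> \<beta> y x \<le> 1" by (rule poisson_average_bounds(2)[OF ab y(1)])
  also have "\<dots> \<le> (2 * M + 2 + 4 * (\<beta> - \<alpha>)) / (1 + \<bar>x\<bar>)"
  proof -
    have "0 < 1 + \<bar>x\<bar>" by linarith
    then show ?thesis using True ab by (simp add: pos_le_divide_eq)
  qed
  finally show ?thesis by (simp add: powr_minus divide_inverse)
next
  case False
  have le: "poisson (Complex x y) s \<le> 4 / (1 + \<bar>x\<bar>)" if "s \<in> {\<alpha>..\<beta>}" for s
  proof -
    have "\<bar>s\<bar> \<le> M" using that M by auto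
    moreover have "(1 + u) / 2 \<le> w" if "v \<le> M" "\<not> u < 2 * M + 1" "u - v \<le> w" for u v w :: real
      using that by (simp add: field_simps)
    ultimately have "(1 + \<bar>x\<bar>) / 2 \<le> \<bar>x - s\<bar>"
      using False abs_triangle_ineq2[of x s] by blast
    also have "\<dots> \<le> cmod (Complex x y - of_real s)"
      using abs_Re_le_cmod[of "Complex x y - of_real s"] by simp
    finally have "((1 + \<bar>x\<bar>) / 2)\<^sup>2 \<le> (cmod (Complex x y - of_real s))\<^sup>2"
      by (intro power_mono) auto
    moreover have "1 * (1 + \<bar>x\<bar>) \<le> (1 + \<bar>x\<bar>)\<^sup>2" unfolding power2_eq_square by (intro mult_right_mono) auto
    ultimately have "(1 + \<bar>x\<bar>) / 4 \<le> (cmod (Complex x y - of_real s))\<^sup>2" by (simp add: power_divide)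
    also have "\<dots> \<le> pi * (cmod (Complex x y - of_real s))\<^sup>2"
      using pi_gt3 by (simp add: mult_le_cancel_right1)
    finally have D: "(1 + \<bar>x\<bar>) / 4 \<le> pi * (cmod (Complex x y - of_real s))\<^sup>2" .
    have "poisson (Complex x y) s \<le> 1 / (pi * (cmod (Complex x y - of_real s))\<^sup>2)"
      unfolding poisson_def using y by (intro divide_right_mono) auto
    also have "\<dots> \<le> 1 / ((1 + \<bar>x\<bar>) / 4)"
      using D by (intro divide_left_mono mult_pos_pos) (auto intro: less_le_trans[OF _ D])
    finally show ?thesis by simp
  qed
  have "poisson_average \<alpha> \<beta> y x \<le> (\<integral>s. 4 / (1 + \<bar>x\<bar>) * indicator {\<alpha>..\<beta>} s \<partial>lborel)"
    unfolding poisson_average_def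
  proof (rule Bochner_Integration.integral_mono)
    show "integrable lborel (\<lambda>s. poisson (Complex x y) s * indicator {\<alpha>..\<beta>} s)"
      using y by (intro poisson_integrable) auto
    show "integrable lborel (\<lambda>s::real. 4 / (1 + \<bar>x\<bar>) * indicator {\<alpha>..\<beta>} s)"
      by (intro integrable_mult_right) auto
    show "poisson (Complex x y) s * indicator {\<alpha>..\<beta>} s \<le> 4 / (1 + \<bar>x\<bar>) * indicator {\<alpha>..\<beta>} s" for s
      using le[of s] by (cases "s \<in> {\<alpha>..\<beta>}") auto
  qed
  also have "\<dots> = 4 * (\<beta> - \<alpha>) / (1 + \<bar>x\<bar>)" using ab by simp
  also have "\<dots> \<le> (2 * M + 2 + 4 * (\<beta> - \<alpha>)) / (1 + \<bar>x\<bar>)"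
    using M by (intro divide_right_mono) auto
  finally show ?thesis by (simp add: powr_minus divide_inverse)
qed

lemma poisson_average_in_Lp:
  assumes p: "1 < p" and ab: "\<alpha> \<le> \<beta>" and y: "0 < y" "y \<le> 1"
  shows "in_Lp p (\<lambda>x. of_real (poisson_average \<alpha> \<beta> y x))"
proof -
  define M where "M = max \<bar>\<alpha>\<bar> \<bar>\<beta>\<bar>"
  have "integrable lborel (\<lambda>x. cmod (complex_of_real (poisson_average \<alpha> \<beta> y x)) powr p)"
  proof (rule integrable_decay_powr[OF _ p])
    show "2 * M + 2 + 4 * (\<beta> - \<alpha>) \<ge> 0" using ab by (auto simp: M_def)
    show "cmod (complex_of_real (poisson_average \<alpha> \<beta> y x)) \<le> (2 * M + 2 + 4 * (\<beta> - \<alpha>)) * (1 + \<bar>x\<bar>) powr - 1" for x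
      using poisson_average_decay[OF ab _ _ y, of M x] poisson_average_bounds(1)[OF ab y(1), of x]
      by (simp add: M_def)
  qed measurable
  then show ?thesis by (simp add: in_Lp_def)
qed

lemma Phiplus_line_continuous:
  assumes a: "\<And>k. Im (a k) > 0" and y: "y > 0"
  shows "continuous_on UNIV (\<lambda>s. Phiplus a k (Complex s y))"
  by (rule continuous_on_compose2[OF Phiplus_continuous_upper[of a]])
     (use a y in \<open>auto intro!: continuous_intros simp: Complex_eq\<close>)

lemma Phiplus_line_integrable:
  assumes a: "\<And>k. Im (a k) > 0" and y: "y > 0"
  shows "integrable lborel (\<lambda>s. indicator {\<alpha>..\<beta>} s *\<^sub>R cnj (Phiplus a k (Complex s y)))"
  by (intro borel_integrable_compact continuous_on_cnj continuous_on_subset[OF Phiplus_line_continuous[of a, OF a y]]) auto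

text \<open>By \<open>poisson_reproduces\<close> the coefficient of a single kernel with pole
  \<open>w\<close> is \<open>cnj (Phiplus a k w) / pi\<close>, and Fubini's theorem averages this
  over the poles. Absolute integrability holds because \<open>Phiplus a k\<close> is bounded by
  \<open>B\<close> on the closed upper half plane and each kernel has mass \<open>1\<close>.\<close>

lemma coef_poisson_average:
  assumes a: "\<And>k. Im (a k) > 0" and y: "y > 0"
  shows "coef a (\<lambda>x. of_real (poisson_average \<alpha> \<beta> y x)) (int k) =
     (1 / of_real pi) * (\<integral>s. indicator {\<alpha>..\<beta>} s *\<^sub>R cnj (Phiplus a k (Complex s y)) \<partial>lborel)"
proof -
  let ?\<Phi> = "\<lambda>x. cnj (Phiplus a k (complex_of_real x))"
  define B where "B = 1 / sqrt (Im (a k))"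
  have B: "cmod (Phiplus a k z) \<le> B" if "Im z \<ge> 0" for z
    unfolding B_def by (rule Phiplus_norm_le(2)[of a, OF a that])
  have B0: "B \<ge> 0" using order_trans[OF norm_ge_zero B[of 0]] by simp
  have [measurable]: "(\<lambda>(s, x). poisson (Complex s y) x) \<in> borel_measurable (borel \<Otimes>\<^sub>M borel)"
    unfolding poisson_def cmod_power2 by simp
  let ?G = "\<lambda>s x. indicator {\<alpha>..\<beta>} s *\<^sub>R (of_real (poisson (Complex s y) x) * ?\<Phi> x)"
  obtain d where d: "d > 0" "Phiplus a k holomorphic_on {z. Im z > - d}"
    using Phiplus_holomorphic_half_plane[of a k] a by auto
  have rep: "integrable lborel (\<lambda>x. of_real (poisson (Complex s y) x) * ?\<Phi> x)"
    "(\<integral>x. of_real (poisson (Complex s y) x) * ?\<Phi> x \<partial>lborel) = cnj (Phiplus a k (Complex s y))" for s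
  proof -
    have P: "integrable lborel (\<lambda>x. of_real (poisson (Complex s y) x) * Phiplus a k (of_real x))"
      "(\<integral>x. of_real (poisson (Complex s y) x) * Phiplus a k (of_real x) \<partial>lborel) = Phiplus a k (Complex s y)"
      using poisson_reproduces[OF d(2,1) B, of "Complex s y"] y by auto
    have e: "of_real (poisson (Complex s y) x) * ?\<Phi> x = cnj (of_real (poisson (Complex s y) x) * Phiplus a k (of_real x))" for x
      by simp
    show "integrable lborel (\<lambda>x. of_real (poisson (Complex s y) x) * ?\<Phi> x)"
      unfolding e by (rule integrable_cnj[OF P(1)])
    show "(\<integral>x. of_real (poisson (Complex s y) x) * ?\<Phi> x \<partial>lborel) = cnj (Phiplus a k (Complex s y))"
      unfolding e Bochner_Integration.integral_cnj P(2) ..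
  qed
  have int: "integrable (lborel \<Otimes>\<^sub>M lborel) (\<lambda>(s, x). ?G s x)"
  proof (rule lborel_pair.Fubini_integrable)
    show m: "(\<lambda>(s, x). ?G s x) \<in> borel_measurable (lborel \<Otimes>\<^sub>M lborel)" by measurable
    show "AE s in lborel. integrable lborel (\<lambda>x. case (s, x) of (s, x) \<Rightarrow> ?G s x)"
      using rep(1) by (auto intro!: integrable_scaleR_right)
    show "integrable lborel (\<lambda>s. \<integral>x. norm (case (s, x) of (s, x) \<Rightarrow> ?G s x) \<partial>lborel)"
    proof (rule Bochner_Integration.integrable_bound)
      show "integrable lborel (\<lambda>s::real. B * indicator {\<alpha>..\<beta>} s)" by (intro integrable_mult_right) auto
      show "(\<lambda>s. \<integral>x. norm (case (s, x) of (s, x) \<Rightarrow> ?G s x) \<partial>lborel) \<in> borel_measurable lborel"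
        by measurable
      have "(\<integral>x. norm (?G s x) \<partial>lborel) \<le> B * indicator {\<alpha>..\<beta>} s" for s
      proof -
        have P: "integrable lborel (poisson (Complex s y))" "(\<integral>x. poisson (Complex s y) x \<partial>lborel) = 1"
          using poisson_has_integral[of "Complex s y"] y by (auto simp: has_bochner_integral_iff)
        have "(\<integral>x. norm (?G s x) \<partial>lborel) \<le> (\<integral>x. (B * indicator {\<alpha>..\<beta>} s) * poisson (Complex s y) x \<partial>lborel)"
        proof (rule Bochner_Integration.integral_mono)
          show "integrable lborel (\<lambda>x. norm (?G s x))"
            by (intro integrable_norm integrable_scaleR_right rep(1))
          show "integrable lborel (\<lambda>x. (B * indicator {\<alpha>..\<beta>} s) * poisson (Complex s y) x)"
            by (intro integrable_mult_right P)
          fix x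
          have "norm (?G s x) = indicator {\<alpha>..\<beta>} s * (poisson (Complex s y) x * cmod (Phiplus a k (of_real x)))"
            using y poisson_nonneg[of "Complex s y" x] by (simp add: norm_mult)
          also have "\<dots> \<le> indicator {\<alpha>..\<beta>} s * (poisson (Complex s y) x * B)"
            using y poisson_nonneg[of "Complex s y" x] B[of "of_real x"] by (intro mult_left_mono) auto
          finally show "norm (?G s x) \<le> (B * indicator {\<alpha>..\<beta>} s) * poisson (Complex s y) x"
            by (simp add: mult_ac)
        qed
        also have "\<dots> = B * indicator {\<alpha>..\<beta>} s" using P by simp
        finally show ?thesis .
      qed
      then show "AE s in lborel. norm (\<integral>x. norm (case (s, x) of (s, x) \<Rightarrow> ?G s x) \<partial>lborel) \<le> norm (B * indicator {\<alpha>..\<beta>} s)"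
        using B0 by simp
    qed
  qed
  have "(\<integral>x. of_real (poisson_average \<alpha> \<beta> y x) * ?\<Phi> x \<partial>lborel) = (\<integral>x. (\<integral>s. ?G s x \<partial>lborel) \<partial>lborel)"
  proof (rule Bochner_Integration.integral_cong[OF refl])
    fix x
    have "(\<integral>s. ?G s x \<partial>lborel) = (\<integral>s. complex_of_real (poisson (Complex x y) s * indicator {\<alpha>..\<beta>} s) * ?\<Phi> x \<partial>lborel)"
      by (intro Bochner_Integration.integral_cong refl) (simp add: poisson_swap[of _ y x] scaleR_conv_of_real mult_ac)
    also have "\<dots> = (\<integral>s. complex_of_real (poisson (Complex x y) s * indicator {\<alpha>..\<beta>} s) \<partial>lborel) * ?\<Phi> x"
      by (rule integral_mult_left_zero)
    also have "(\<integral>s. complex_of_real (poisson (Complex x y) s * indicator {\<alpha>..\<beta>} s) \<partial>lborel) = of_real (poisson_average \<alpha> \<beta> y x)"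
      unfolding poisson_average_def by (rule integral_complex_of_real)
    finally show "of_real (poisson_average \<alpha> \<beta> y x) * ?\<Phi> x = (\<integral>s. ?G s x \<partial>lborel)" by simp
  qed
  also have "\<dots> = (\<integral>s. (\<integral>x. ?G s x \<partial>lborel) \<partial>lborel)"
    by (rule lborel_pair.Fubini_integral[OF int])
  also have "\<dots> = (\<integral>s. indicator {\<alpha>..\<beta>} s *\<^sub>R cnj (Phiplus a k (Complex s y)) \<partial>lborel)"
    unfolding integral_scaleR_right rep(2) ..
  finally show ?thesis unfolding coef_def Phi_of_nat by simp
qed

text \<open>The averaged function is real, so its partial sum is twice the real part of
  \<open>Ppart\<close>. For one pole \<open>w\<close>, Christoffel-Darboux makes
  \<open>Ppart\<close> at \<open>x\<close> equal to
  \<open>(\<i> / 2) * (1 - R) / (pi * (x - cnj w))\<close> with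
  \<open>R = Bplus a n x * cnj (Bplus a n w)\<close>. Twice the real part of the term without
  \<open>R\<close> is exactly the Poisson kernel, so the whole error comes from \<open>R\<close>,
  and \<open>cmod R \<le> b\<close>.\<close>

lemma Spart_poisson_average:
  assumes a: "\<And>k. Im (a k) > 0" and y: "y > 0" and ab: "\<alpha> \<le> \<beta>" and M: "\<bar>\<alpha>\<bar> \<le> M" "\<bar>\<beta>\<bar> \<le> M"
    and b: "\<And>s. s \<in> {\<alpha>..\<beta>} \<Longrightarrow> cmod (Bplus a n (Complex s y)) \<le> b"
  shows "cmod (of_real (poisson_average \<alpha> \<beta> y x) - Spart (\<lambda>x. of_real (poisson_average \<alpha> \<beta> y x)) a n x)
     \<le> ((1 + M) / y + 1) * (\<beta> - \<alpha>) * b * (1 + \<bar>x\<bar>) powr - 1"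
proof -
  let ?h = "poisson_average \<alpha> \<beta> y" and ?i = "\<lambda>s. indicator {\<alpha>..\<beta>} s :: real"
  let ?P = "Ppart a (\<lambda>x. of_real (?h x)) n (of_real x)"
  let ?L = "(1 + M) / y + 1"
  define T where "T s = (\<Sum>k<n. Phiplus a k (of_real x) * cnj (Phiplus a k (Complex s y)))" for s
  have "?P = (\<Sum>k<n. (\<integral>s. ((1 / of_real pi) * Phiplus a k (of_real x)) * (?i s *\<^sub>R cnj (Phiplus a k (Complex s y))) \<partial>lborel))"
    unfolding Ppart_def coef_poisson_average[of a, OF a y] integral_mult_right_zero by (simp add: mult_ac)
  also have "\<dots> = (\<integral>s. (\<Sum>k<n. ((1 / of_real pi) * Phiplus a k (of_real x)) * (?i s *\<^sub>R cnj (Phiplus a k (Complex s y)))) \<partial>lborel)"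
    by (intro Bochner_Integration.integral_sum[symmetric] integrable_mult_right Phiplus_line_integrable[of a, OF a y])
  also have "\<dots> = (\<integral>s. ?i s *\<^sub>R (T s / of_real pi) \<partial>lborel)"
    unfolding T_def sum_divide_distrib scaleR_sum_right by (intro Bochner_Integration.integral_cong refl sum.cong) auto
  finally have P: "?P = (\<integral>s. ?i s *\<^sub>R (T s / of_real pi) \<partial>lborel)" .
  have intT: "integrable lborel (\<lambda>s. ?i s *\<^sub>R (T s / of_real pi))"
    unfolding T_def
    by (intro borel_integrable_compact continuous_intros continuous_on_subset[OF Phiplus_line_continuous[of a, OF a y]]) auto
  have ReP: "Re ?P = (\<integral>s. Re (?i s *\<^sub>R (T s / of_real pi)) \<partial>lborel)"
    unfolding P by (rule integral_Re[OF intT, symmetric])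
  have S: "Spart (\<lambda>x. of_real (?h x)) a n x = of_real (2 * Re ?P)"
    unfolding Spart_eq_Ppart by (simp add: complex_eq_iff)
  have ip: "integrable lborel (\<lambda>s. poisson (Complex x y) s * ?i s)"
    using y by (intro poisson_integrable) auto
  have iR: "integrable lborel (\<lambda>s. 2 * Re (?i s *\<^sub>R (T s / of_real pi)))"
    by (intro integrable_mult_right integrable_Re intT)
  have "?h x - 2 * Re ?P = (\<integral>s. poisson (Complex x y) s * ?i s - 2 * Re (?i s *\<^sub>R (T s / of_real pi)) \<partial>lborel)"
    unfolding ReP unfolding poisson_average_def integral_mult_right_zero[symmetric]
    by (rule Bochner_Integration.integral_diff[OF ip iR, symmetric])
  then have "\<bar>?h x - 2 * Re ?P\<bar> \<le> (\<integral>s. norm (poisson (Complex x y) s * ?i s - 2 * Re (?i s *\<^sub>R (T s / of_real pi))) \<partial>lborel)"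
    using integral_norm_bound[of lborel "\<lambda>s. poisson (Complex x y) s * ?i s - 2 * Re (?i s *\<^sub>R (T s / of_real pi))"] by simp
  also have "\<dots> \<le> (\<integral>s. b * (?L / (1 + \<bar>x\<bar>)) * ?i s \<partial>lborel)"
  proof (rule Bochner_Integration.integral_mono)
    show "integrable lborel (\<lambda>s. norm (poisson (Complex x y) s * ?i s - 2 * Re (?i s *\<^sub>R (T s / of_real pi))))"
      by (intro integrable_norm Bochner_Integration.integrable_diff ip iR)
    show "integrable lborel (\<lambda>s. b * (?L / (1 + \<bar>x\<bar>)) * ?i s)" by (intro integrable_mult_right) auto
    fix s
    show "norm (poisson (Complex x y) s * ?i s - 2 * Re (?i s *\<^sub>R (T s / of_real pi))) \<le> b * (?L / (1 + \<bar>x\<bar>)) * ?i s"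
    proof (cases "s \<in> {\<alpha>..\<beta>}")
      case True
      define w where "w = Complex s y"
      define D where "D = complex_of_real x - cnj w"
      have D0: "D \<noteq> 0" using y by (simp add: D_def w_def complex_eq_iff)
      have nD: "cmod D = cmod (w - of_real x)"
        unfolding D_def by (metis complex_cnj_cnj complex_cnj_complex_of_real complex_cnj_diff complex_mod_cnj norm_minus_commute)
      have ne: "complex_of_real x \<noteq> cnj (a k)" "w \<noteq> cnj (a k)" for k
        using y a[of k] by (auto simp: complex_eq_iff w_def)
      define R where "R = Bplus a n (of_real x) * cnj (Bplus a n w)"
      have "T s * (- 2 * \<i> * D) = 1 - R"
        unfolding T_def D_def R_def w_def[symmetric] by (rule christoffel_darboux[of a, OF a ne])
      then have Ts: "T s = (\<i> / 2) / D - (\<i> / 2) * R / D"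
      proof -
        have "T s = (\<i> / 2) * (T s * (- 2 * \<i> * D)) / D" using D0 by (simp add: field_simps)
        then show ?thesis unfolding \<open>T s * (- 2 * \<i> * D) = 1 - R\<close>
          by (simp add: right_diff_distrib diff_divide_distrib)
      qed
      have main: "2 * Re ((\<i> / 2) / D / of_real pi) = poisson (Complex x y) s"
      proof -
        have "2 * Re ((\<i> / 2) / D / of_real pi) = Re (\<i> / D) / pi"
        proof -
          have "(\<i> / 2) / D / of_real pi = of_real (1 / (2 * pi)) * (\<i> / D)" by simp
          then show ?thesis by (simp only: Re_complex_of_real times_complex.sel Im_complex_of_real) simp
        qed
        also have "Re (\<i> / D) = y / ((x - s)\<^sup>2 + y\<^sup>2)"
          by (simp add: Re_divide D_def w_def)
        finally show ?thesis unfolding poisson_def cmod_power2 by simp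
      qed
      have "poisson (Complex x y) s - 2 * Re (T s / of_real pi) = 2 * Re ((\<i> / 2) * R / D / of_real pi)"
        unfolding Ts diff_divide_distrib minus_complex.sel main[symmetric] by simp
      also have "\<bar>\<dots>\<bar> \<le> 2 * cmod ((\<i> / 2) * R / D / of_real pi)"
        using abs_Re_le_cmod[of "(\<i> / 2) * R / D / of_real pi"] by (simp add: abs_mult)
      also have "\<dots> = cmod R / cmod D / pi" by (simp add: norm_mult norm_divide)
      also have "\<dots> \<le> cmod R / cmod D"
        using divide_left_mono[of 1 pi "cmod R / cmod D"] pi_gt3 by simp
      also have "\<dots> \<le> b * (?L / (1 + \<bar>x\<bar>))"
      proof -
        have "cmod R \<le> 1 * b"
          unfolding R_def norm_mult complex_mod_cnj w_def
          using b[OF True] Bplus_norm_le_1[of a "of_real x" n, OF a] by (intro mult_mono) auto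
        then have Rb: "cmod R \<le> b" by simp
        then have b0: "b \<ge> 0" using norm_ge_zero order_trans by blast
        have d: "cmod (w - of_real x) \<ge> y" using Im_le_cmod_diff[of w x] by (simp add: w_def)
        have "\<bar>x\<bar> \<le> \<bar>s\<bar> + \<bar>s - x\<bar>" by linarith
        also have "\<bar>s - x\<bar> \<le> cmod (w - of_real x)"
          using abs_Re_le_cmod[of "w - of_real x"] by (simp add: w_def)
        finally have "\<bar>x\<bar> \<le> M + cmod (w - of_real x)" using True M by auto
        moreover have "1 + M \<le> (1 + M) / y * cmod (w - of_real x)"
          using d y M by (intro le_divide_mult) auto
        ultimately have "1 + \<bar>x\<bar> \<le> ?L * cmod (w - of_real x)" by (simp add: distrib_right)
        then have "1 / cmod D \<le> ?L / (1 + \<bar>x\<bar>)"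
          unfolding nD using d y by (intro one_div_le) auto
        then have "cmod R * (1 / cmod D) \<le> b * (?L / (1 + \<bar>x\<bar>))"
          using Rb b0 by (intro mult_mono) auto
        then show ?thesis by simp
      qed
      finally show ?thesis using True by simp
    qed simp
  qed
  also have "\<dots> = b * (?L / (1 + \<bar>x\<bar>)) * (\<beta> - \<alpha>)" using ab by simp
  finally have "\<bar>?h x - 2 * Re ?P\<bar> \<le> b * (?L / (1 + \<bar>x\<bar>)) * (\<beta> - \<alpha>)" .
  then show ?thesis unfolding S of_real_diff[symmetric] norm_of_real
    by (simp add: powr_minus divide_inverse mult_ac)
qed

lemma approximable_poisson_average:
  assumes a: "\<And>k. Im (a k) > 0"
    and div: "filterlim (\<lambda>n. \<Sum>k<n. \<bar>Im (a k)\<bar> / (1 + (cmod (a k))^2)) at_top sequentially"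
    and p: "1 < p" and ab: "\<alpha> \<le> \<beta>" and y: "0 < y" "y \<le> 1"
  shows "approximable a p (\<lambda>x. of_real (poisson_average \<alpha> \<beta> y x))"
proof -
  let ?h = "\<lambda>x. complex_of_real (poisson_average \<alpha> \<beta> y x)"
  define \<sigma> where "\<sigma> n = (\<Sum>k<n. \<bar>Im (a k)\<bar> / (1 + (cmod (a k))\<^sup>2))" for n
  define M where "M = max \<bar>\<alpha>\<bar> \<bar>\<beta>\<bar>"
  \<comment> \<open>On the segment \<open>cmod (s + \<i> y)\<close> squared is at most
    \<open>M\<^sup>2 + y\<^sup>2\<close>, so \<open>c\<close> is a decay rate valid for all its
    points.\<close>
  define c where "c = 2 * y / (1 + (M\<^sup>2 + y\<^sup>2))"
  \<comment> \<open>The rate is halved because \<open>Bplus_norm_le_exp\<close> bounds the square of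
    the modulus.\<close>
  define b where "b n = exp (- (c / 2) * \<sigma> n)" for n
  have M: "\<bar>\<alpha>\<bar> \<le> M" "\<bar>\<beta>\<bar> \<le> M" by (auto simp: M_def)
  have M0: "M \<ge> 0" using M by linarith
  have den: "1 + (M\<^sup>2 + y\<^sup>2) > 0" by (simp add: add_pos_nonneg)
  have c: "c > 0" using y den by (simp add: c_def)
  have \<sigma>0: "\<sigma> n \<ge> 0" for n unfolding \<sigma>_def by (intro sum_nonneg) simp
  have Bb: "cmod (Bplus a n (Complex s y)) \<le> b n" if s: "s \<in> {\<alpha>..\<beta>}" for n s
  proof (rule power2_le_imp_le)
    have "\<bar>s\<bar> \<le> M" using s by (auto simp: M_def)
    then have "s\<^sup>2 \<le> M\<^sup>2" using M0 by (metis abs_le_square_iff abs_of_nonneg)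
    then have "c \<le> 2 * y / (1 + (cmod (Complex s y))\<^sup>2)"
      unfolding c_def cmod_power2 using y den
      by (intro divide_left_mono mult_pos_pos) (auto intro: add_pos_nonneg)
    then have "c * \<sigma> n \<le> 2 * y / (1 + (cmod (Complex s y))\<^sup>2) * \<sigma> n"
      using \<sigma>0 by (intro mult_right_mono)
    then have "exp (- (2 * y / (1 + (cmod (Complex s y))\<^sup>2)) * \<sigma> n) \<le> exp (- c * \<sigma> n)" by simp
    moreover have "(cmod (Bplus a n (Complex s y)))\<^sup>2 \<le> exp (- (2 * y / (1 + (cmod (Complex s y))\<^sup>2)) * \<sigma> n)"
      using Bplus_norm_le_exp[of a "Complex s y" n, OF a] y by (simp add: \<sigma>_def)
    moreover have "(b n)\<^sup>2 = exp (- c * \<sigma> n)"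
      unfolding b_def power2_eq_square exp_add[symmetric] by simp
    ultimately show "(cmod (Bplus a n (Complex s y)))\<^sup>2 \<le> (b n)\<^sup>2" by linarith
    show "0 \<le> b n" by (simp add: b_def)
  qed
  define D where "D = ((1 + M) / y + 1) * (\<beta> - \<alpha>)"
  have D0: "D \<ge> 0" using y M0 ab by (simp add: D_def)
  define I where "I = (\<integral>(x::real). (1 + \<bar>x\<bar>) powr (- p) \<partial>lborel)"
  have iI: "integrable lborel (\<lambda>x::real. (1 + \<bar>x\<bar>) powr (- p))" by (rule integrable_one_plus_abs_powr[OF p])
  have le: "pmass p (\<lambda>x. ?h x - Spart ?h a n x) \<le> ennreal ((D * b n) powr p * I)" for n
  proof -
    have "pmass p (\<lambda>x. ?h x - Spart ?h a n x) \<le> (\<integral>\<^sup>+(x::real). ennreal ((D * b n) powr p * (1 + \<bar>x\<bar>) powr (- p)) \<partial>lborel)"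
      unfolding pmass_def
    proof (intro nn_integral_mono ennreal_leI)
      fix x :: real
      have "cmod (?h x - Spart ?h a n x) \<le> (D * b n) * (1 + \<bar>x\<bar>) powr - 1"
        unfolding D_def by (rule Spart_poisson_average[of a, OF a y(1) ab M Bb])
      then have "cmod (?h x - Spart ?h a n x) powr p \<le> ((D * b n) * (1 + \<bar>x\<bar>) powr - 1) powr p"
        using p by (intro powr_mono2) auto
      also have "\<dots> = (D * b n) powr p * ((1 + \<bar>x\<bar>) powr - 1) powr p" by (rule powr_mult)
      also have "((1 + \<bar>x\<bar>) powr - 1) powr p = (1 + \<bar>x\<bar>) powr (- p)" by (simp only: powr_powr) simp
      finally show "cmod (?h x - Spart ?h a n x) powr p \<le> (D * b n) powr p * (1 + \<bar>x\<bar>) powr (- p)" .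
    qed
    also have "\<dots> = ennreal (\<integral>(x::real). (D * b n) powr p * (1 + \<bar>x\<bar>) powr (- p) \<partial>lborel)"
      by (intro nn_integral_eq_integral integrable_mult_right iI) simp
    also have "(\<integral>(x::real). (D * b n) powr p * (1 + \<bar>x\<bar>) powr (- p) \<partial>lborel) = (D * b n) powr p * I"
      unfolding I_def by (rule integral_mult_right_zero)
    finally show ?thesis .
  qed
  have "filterlim (\<lambda>n. (c / 2) * \<sigma> n) at_top sequentially"
    using c div unfolding \<sigma>_def by (intro filterlim_tendsto_pos_mult_at_top[OF tendsto_const]) auto
  then have "filterlim (\<lambda>n. - (c / 2) * \<sigma> n) at_bot sequentially"
    by (simp add: filterlim_uminus_at_top)
  then have "b \<longlonglongrightarrow> 0" unfolding b_def by (rule filterlim_compose[OF exp_at_bot])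
  then have "(\<lambda>n. D * b n) \<longlonglongrightarrow> D * 0" by (rule tendsto_mult_left)
  then have "(\<lambda>n. (D * b n) powr p) \<longlonglongrightarrow> (D * 0) powr p"
    using p D0 by (intro tendsto_powr' tendsto_const) (auto simp: b_def)
  then have "(\<lambda>n. (D * b n) powr p * I) \<longlonglongrightarrow> (D * 0) powr p * I" by (rule tendsto_mult_right)
  then have "(\<lambda>n. ennreal ((D * b n) powr p * I)) \<longlonglongrightarrow> ennreal ((D * 0) powr p * I)" by (rule tendsto_ennrealI)
  then have lim: "(\<lambda>n. ennreal ((D * b n) powr p * I)) \<longlonglongrightarrow> 0" by simp
  have "(\<lambda>n. pmass p (\<lambda>x. ?h x - Spart ?h a n x)) \<longlonglongrightarrow> 0"
    by (rule tendsto_sandwich[OF _ _ tendsto_const lim]) (use le in auto)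
  then show ?thesis using poisson_average_in_Lp[OF p ab y] by (simp add: approximable_def)
qed

text \<open>The endpoints of a nondegenerate interval are genuine exceptions: the limit there is
  \<open>1 / 2\<close>. They form a null set.\<close>

lemma poisson_average_tendsto:
  assumes ab: "\<alpha> \<le> \<beta>" and x: "x \<noteq> \<alpha>" "x \<noteq> \<beta>"
  shows "(\<lambda>m. poisson_average \<alpha> \<beta> (inverse (real (Suc m))) x) \<longlonglongrightarrow> indicator {\<alpha>..\<beta>} x"
proof -
  have lim: "(\<lambda>m. arctan (u / inverse (real (Suc m)))) \<longlonglongrightarrow> (if u > 0 then pi / 2 else - (pi / 2))" if u: "u \<noteq> 0" for u
  proof -
    have top: "filterlim (\<lambda>m. real (Suc m)) at_top sequentially"
      by (rule filterlim_compose[OF filterlim_real_sequentially filterlim_Suc])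
    have e: "u / inverse (real (Suc m)) = u * real (Suc m)" for m
      by (simp only: divide_inverse inverse_inverse_eq)
    show ?thesis unfolding e
    proof (cases "u > 0")
      case True
      have "filterlim (\<lambda>m. u * real (Suc m)) at_top sequentially"
        by (rule filterlim_tendsto_pos_mult_at_top[OF tendsto_const True top])
      then have "(\<lambda>m. arctan (u * real (Suc m))) \<longlonglongrightarrow> pi / 2"
        by (rule filterlim_compose[OF tendsto_arctan_at_top])
      then show "(\<lambda>m. arctan (u * real (Suc m))) \<longlonglongrightarrow> (if u > 0 then pi / 2 else - (pi / 2))"
        using True by (simp only: if_True)
    next
      case False
      then have "u < 0" using u by linarith
      then have "filterlim (\<lambda>m. u * real (Suc m)) at_bot sequentially"
        by (rule filterlim_tendsto_neg_mult_at_bot[OF tendsto_const _ top])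
      then have "(\<lambda>m. arctan (u * real (Suc m))) \<longlonglongrightarrow> - (pi / 2)"
        by (rule filterlim_compose[OF tendsto_arctan_at_bot])
      then show "(\<lambda>m. arctan (u * real (Suc m))) \<longlonglongrightarrow> (if u > 0 then pi / 2 else - (pi / 2))"
        using False by (simp only: if_False)
    qed
  qed
  have "(\<lambda>m. (arctan ((\<beta> - x) / inverse (real (Suc m))) - arctan ((\<alpha> - x) / inverse (real (Suc m)))) / pi)
     \<longlonglongrightarrow> ((if \<beta> - x > 0 then pi / 2 else - (pi / 2)) - (if \<alpha> - x > 0 then pi / 2 else - (pi / 2))) / pi"
    by (rule tendsto_divide[OF tendsto_diff[OF lim lim] tendsto_const]) (use x in auto)
  moreover have "((if \<beta> - x > 0 then pi / 2 else - (pi / 2)) - (if \<alpha> - x > 0 then pi / 2 else - (pi / 2))) / pi = indicator {\<alpha>..\<beta>} x"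
    using x ab by (auto simp: indicator_def)
  moreover have "poisson_average \<alpha> \<beta> (inverse (real (Suc m))) x =
      (arctan ((\<beta> - x) / inverse (real (Suc m))) - arctan ((\<alpha> - x) / inverse (real (Suc m)))) / pi" for m
    by (rule poisson_average_arctan[OF ab]) simp
  ultimately show ?thesis by simp
qed

section \<open>From indicators of intervals to all of \<open>L_p\<close>\<close>

lemma indicator_in_Lp:
  assumes "A \<in> sets borel" "A \<subseteq> {-M..M}" "0 < p"
  shows "in_Lp p (indicator A)"
proof -
  have "bounded_support (indicator A)"
    unfolding bounded_support_def
  proof (intro conjI exI allI)
    show "indicator A \<in> borel_measurable borel" using assms(1) by (rule borel_measurable_indicator)
    \<comment> \<open>The single constant of \<open>bounded_support\<close> has to bound the value
      \<open>1\<close> as well as the support, and it must be nonnegative even if \<open>M\<close>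
      is not.\<close>
    show "0 \<le> max 1 M" by simp
    show "cmod (indicator A t) \<le> max 1 M * indicator {- max 1 M..max 1 M} t" for t
    proof (cases "t \<in> A")
      case True
      then have "t \<in> {-M..M}" using assms(2) by blast
      then have "t \<in> {- max 1 M..max 1 M}" by auto
      then show ?thesis using True by simp
    qed simp
  qed
  then show ?thesis
    unfolding in_Lp_def using bounded_support_integrable_powr[OF _ assms(3)] by (auto simp: bounded_support_def)
qed

lemma approximable_Icc:
  assumes a: "\<And>k. Im (a k) > 0"
    and div: "filterlim (\<lambda>n. \<Sum>k<n. \<bar>Im (a k)\<bar> / (1 + (cmod (a k))^2)) at_top sequentially"
    and p: "1 < p"
  shows "approximable a p (indicator {\<alpha>..\<beta>})"
proof (cases "\<alpha> \<le> \<beta>")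
  case False
  then have "indicator {\<alpha>..\<beta>} = (\<lambda>x::real. 0::complex)" by auto
  then show ?thesis using approximable_0[of p a] p by simp
next
  case ab: True
  define M where "M = max \<bar>\<alpha>\<bar> \<bar>\<beta>\<bar>"
  have M: "\<bar>\<alpha>\<bar> \<le> M" "\<bar>\<beta>\<bar> \<le> M" by (auto simp: M_def)
  define C where "C = 2 * M + 2 + 4 * (\<beta> - \<alpha>)"
  have C0: "C \<ge> 0" using M ab by (simp add: C_def)
  let ?y = "\<lambda>m::nat. inverse (real (Suc m))"
  let ?F = "\<lambda>m x. complex_of_real (poisson_average \<alpha> \<beta> (?y m) x)"
  \<comment> \<open>A majorant of the difference between the indicator and its averages, uniform in
    \<open>m\<close> because \<open>poisson_average_decay\<close> is uniform in
    \<open>y \<le> 1\<close>.\<close>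
  let ?w = "\<lambda>x. indicator {\<alpha>..\<beta>} x + C * (1 + \<bar>x\<bar>) powr - 1 :: real"
  have y: "0 < ?y m" "?y m \<le> 1" for m by (auto simp: inverse_le_1_iff)
  have p0: "0 < p" using p by simp
  have Lp: "in_Lp p (indicator {\<alpha>..\<beta>})"
    by (rule indicator_in_Lp[of _ M]) (use M p0 in auto)
  have wLp: "in_Lp p (\<lambda>x. indicator {\<alpha>..\<beta>} x + complex_of_real (C * (1 + \<bar>x\<bar>) powr - 1))"
  proof (rule in_Lp_add[OF p0 Lp])
    have "integrable lborel (\<lambda>x. cmod (complex_of_real (C * (1 + \<bar>x\<bar>) powr - 1)) powr p)"
    proof (rule integrable_decay_powr[OF _ p C0])
      show "cmod (complex_of_real (C * (1 + \<bar>x\<bar>) powr - 1)) \<le> C * (1 + \<bar>x\<bar>) powr - 1" for x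
        unfolding norm_of_real using C0 by simp
    qed measurable
    then show "in_Lp p (\<lambda>x. complex_of_real (C * (1 + \<bar>x\<bar>) powr - 1))" by (simp add: in_Lp_def)
  qed
  have w0: "?w x \<ge> 0" for x using C0 by simp
  have ind: "(indicator {\<alpha>..\<beta>} x :: complex) = of_real (indicator {\<alpha>..\<beta>} x)" for x
    by (simp add: indicator_def)
  have "(\<lambda>m. pmass p (\<lambda>x. indicator {\<alpha>..\<beta>} x - ?F m x)) \<longlonglongrightarrow> 0"
  proof (rule pmass_dominated[OF p0, where w = ?w])
    have "cmod (indicator {\<alpha>..\<beta>} x + complex_of_real (C * (1 + \<bar>x\<bar>) powr - 1)) = ?w x" for x
      unfolding ind of_real_add[symmetric] norm_of_real using w0[of x] by (rule abs_of_nonneg)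
    then show "integrable lborel (\<lambda>x. ?w x powr p)"
      using wLp unfolding in_Lp_def by (simp only:)
    have "AE x in lborel. x \<noteq> \<alpha>" "AE x in lborel. x \<noteq> \<beta>"
      by (rule AE_lborel_singleton)+
    then show "AE x in lborel. (\<lambda>m. ?F m x) \<longlonglongrightarrow> indicator {\<alpha>..\<beta>} x"
    proof eventually_elim
      case (elim x)
      show ?case unfolding ind by (intro tendsto_of_real poisson_average_tendsto ab elim)
    qed
    show "cmod (indicator {\<alpha>..\<beta>} x - ?F m x) \<le> ?w x" for m x
    proof -
      have "cmod (indicator {\<alpha>..\<beta>} x - ?F m x) \<le> cmod (indicator {\<alpha>..\<beta>} x) + cmod (?F m x)"
        by (rule norm_triangle_ineq4)
      also have "cmod (?F m x) \<le> C * (1 + \<bar>x\<bar>) powr - 1"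
        unfolding norm_of_real C_def
        using poisson_average_decay[OF ab M y, of m x] poisson_average_bounds(1)[OF ab y(1), of m x] by simp
      also have "cmod (indicator {\<alpha>..\<beta>} x) = indicator {\<alpha>..\<beta>} x" unfolding ind by simp
      finally show ?thesis by simp
    qed
  qed (use Lp in \<open>auto simp: in_Lp_def\<close>)
  then show ?thesis
    by (rule approximable_limit[where a=a and F="?F", OF a p Lp approximable_poisson_average[of a, OF a div p ab y]])
qed

text \<open>Dynkin's argument: closed intervals are stable under intersection and generate the Borel
  sets. Cutting with \<open>[-M, M]\<close> keeps every indicator in \<open>L_p\<close>, so
  complements become differences, and disjoint unions become limits dominated by the indicator of
  \<open>[-M, M]\<close>.\<close>

lemma approximable_borel:
  assumes a: "\<And>k. Im (a k) > 0"
    and div: "filterlim (\<lambda>n. \<Sum>k<n. \<bar>Im (a k)\<bar> / (1 + (cmod (a k))^2)) at_top sequentially"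
    and p: "1 < p" and A: "A \<in> sets borel"
  shows "approximable a p (indicator (A \<inter> {-M..M}))"
proof -
  have p0: "0 < p" using p by simp
  let ?G = "range (\<lambda>(u, v). {u..v}) :: real set set"
  have "borel = sigma UNIV ?G" by (rule borel_eq_atLeastAtMost)
  then have AG: "A \<in> sigma_sets UNIV ?G" using A by (metis sets_measure_of top_greatest subset_Pow_Union Pow_UNIV)
  have sb: "B \<in> sets borel" if "B \<in> sigma_sets UNIV ?G" for B
    using that by (simp add: borel_eq_atLeastAtMost)
  have "Int_stable ?G"
    by (auto simp: Int_stable_def)
  moreover have "?G \<subseteq> Pow UNIV" by simp
  ultimately show ?thesis using AG
  proof (induction rule: sigma_sets_induct_disjoint)
    case (basic A)
    then obtain u v where "A = {u..v}" by auto
    then show ?case using approximable_Icc[of a, OF a div p] by simp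
  next
    case empty
    then show ?case using approximable_0[OF p0] by simp
  next
    case (compl A)
    have "approximable a p (\<lambda>x. indicator {-M..M} x + (-1) * indicator (A \<inter> {-M..M}) x)"
      by (intro approximable_add[of a, OF a p] approximable_Icc[of a, OF a div p] approximable_cmult[OF p0] compl)
    moreover have "(\<lambda>x. indicator {-M..M} x + (-1) * indicator (A \<inter> {-M..M}) x) = (indicator ((UNIV - A) \<inter> {-M..M}) :: real \<Rightarrow> complex)"
      by (auto simp: indicator_def fun_eq_iff)
    ultimately show ?case by simp
  next
    case (union A)
    have mA: "A i \<in> sets borel" for i using union(2) sb by blast
    let ?f = "indicator ((\<Union>i. A i) \<inter> {-M..M}) :: real \<Rightarrow> complex"
    let ?F = "\<lambda>m x. \<Sum>i<m. (indicator (A i \<inter> {-M..M}) x :: complex)"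
    have Lp: "in_Lp p ?f" by (rule indicator_in_Lp[of _ M]) (use mA p0 in auto)
    have F: "?F m x = indicator ((\<Union>i<m. A i) \<inter> {-M..M}) x" for m x
    proof -
      have d: "disjoint_family_on (\<lambda>i. A i \<inter> {-M..M}) {..<m}"
        using union(1) by (auto simp: disjoint_family_on_def)
      have "(\<Union>i<m. A i) \<inter> {-M..M} = (\<Union>i<m. A i \<inter> {-M..M})" by blast
      then show ?thesis
        by (simp only: indicator_UN_disjoint[OF finite_lessThan d])
    qed
    show ?case
    proof (rule approximable_limit[of a, OF a p Lp])
      show "approximable a p (?F m)" for m
        by (rule approximable_sum[of a, OF a p]) (use union in auto)
      show "(\<lambda>m. pmass p (\<lambda>x. ?f x - ?F m x)) \<longlonglongrightarrow> 0"
      proof (rule pmass_dominated[OF p0, where w = "indicator {-M..M}"])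
        show "?F m \<in> borel_measurable borel" for m using mA by measurable
        show "?f \<in> borel_measurable borel" using Lp by (simp add: in_Lp_def)
        have "in_Lp p (indicator {-M..M})" by (rule indicator_in_Lp[of _ M]) (use p0 in auto)
        moreover have "cmod (indicator {-M..M} x) = indicator {-M..M} x" for x by (simp add: indicator_def)
        ultimately show "integrable lborel (\<lambda>x. indicat_real {-M..M} x powr p)" by (simp add: in_Lp_def)
        show "AE x in lborel. (\<lambda>m. ?F m x) \<longlonglongrightarrow> ?f x"
        proof (rule AE_I2, rule tendsto_eventually)
          fix x :: real
          show "\<forall>\<^sub>F m in sequentially. ?F m x = ?f x"
          proof (cases "\<exists>i. x \<in> A i")
            case True
            then obtain i where i: "x \<in> A i" by blast
            show ?thesis unfolding F using eventually_gt_at_top[of i]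
              by eventually_elim (use i in \<open>auto simp: indicator_def\<close>)
          next
            case False
            then show ?thesis unfolding F by (auto simp: indicator_def)
          qed
        qed
        show "cmod (?f x - ?F m x) \<le> indicator {-M..M} x" for m x
          unfolding F by (auto simp: indicator_def)
      qed
    qed
  qed
qed

text \<open>Simple functions \<open>F i\<close> with
  \<open>cmod (F i x) \<le> 2 * cmod (f x)\<close> converge pointwise to \<open>f\<close>, and the
  differences are dominated by \<open>3 * cmod (f x)\<close>, so the convergence also holds in
  \<open>L_p\<close>.\<close>

lemma approximable_bounded_support:
  assumes a: "\<And>k. Im (a k) > 0"
    and div: "filterlim (\<lambda>n. \<Sum>k<n. \<bar>Im (a k)\<bar> / (1 + (cmod (a k))^2)) at_top sequentially"
    and p: "1 < p" and f: "bounded_support f"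
  shows "approximable a p f"
proof -
  have p0: "0 < p" using p by simp
  have mf: "f \<in> borel_measurable borel" using f by (simp add: bounded_support_def)
  obtain M where M: "M \<ge> 0" "\<And>t. cmod (f t) \<le> M" "\<And>t. \<bar>t\<bar> > M \<Longrightarrow> f t = 0"
    by (rule bounded_supportE[OF f], rule that)
  obtain F where F: "\<And>i. simple_function borel (F i)" "\<And>x. (\<lambda>i. F i x) \<longlonglongrightarrow> f x"
    "\<And>i x. dist (F i x) 0 \<le> 2 * dist (f x) 0"
    using borel_measurable_implies_sequence_metric[OF mf, of 0] by auto
  have F2: "cmod (F i x) \<le> 2 * cmod (f x)" for i x using F(3)[of i x] by simp
  have fp: "integrable lborel (\<lambda>x. cmod (f x) powr p)" by (rule bounded_support_integrable_powr[OF f p0])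
  have Lp: "in_Lp p f" using mf fp by (simp add: in_Lp_def)
  show ?thesis
  proof (rule approximable_limit[of a, OF a p Lp])
    show "approximable a p (F i)" for i
    proof -
      have fin: "finite (range (F i))" using F(1)[of i] by (simp add: simple_function_def)
      have ms: "F i -` {v} \<in> sets borel" for v
        using simple_functionD(2)[OF F(1)[of i], of "{v}"] by simp
      \<comment> \<open>A level set, notably that of \<open>0\<close>, may be unbounded. Cutting it
        with \<open>[-M, M]\<close> changes nothing in the sum, because \<open>F i\<close> vanishes
        wherever \<open>f\<close> does, and it brings the indicators within reach of
        \<open>approximable_borel\<close>.\<close>
      have "approximable a p (\<lambda>x. \<Sum>v\<in>range (F i). v * indicator (F i -` {v} \<inter> {-M..M}) x)"
        by (intro approximable_sum[of a, OF a p fin] approximable_cmult[OF p0] approximable_borel[of a, OF a div p ms])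
      moreover have "(\<Sum>v\<in>range (F i). v * indicator (F i -` {v} \<inter> {-M..M}) x) = F i x" for x
      proof -
        have "(\<Sum>v\<in>range (F i). v * indicator (F i -` {v} \<inter> {-M..M}) x)
            = (\<Sum>v\<in>range (F i). if v = F i x then v * indicator {-M..M} x else 0)"
          by (intro sum.cong refl) (auto simp: indicator_def)
        also have "\<dots> = F i x * indicator {-M..M} x" using fin by (simp add: sum.delta)
        also have "\<dots> = F i x"
        proof (cases "\<bar>x\<bar> > M")
          case True
          then have "F i x = 0" using M(3)[of x] F2[of i x] by simp
          then show ?thesis by simp
        next
          case False
          then have "x \<in> {-M..M}" by auto
          then show ?thesis by simp
        qed
        finally show ?thesis .
      qed
      ultimately show ?thesis by simp
    qed
    show "(\<lambda>m. pmass p (\<lambda>x. f x - F m x)) \<longlonglongrightarrow> 0"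
    proof (rule pmass_dominated[OF p0, where w = "\<lambda>x. 3 * cmod (f x)"])
      show "F m \<in> borel_measurable borel" for m by (rule borel_measurable_simple_function[OF F(1)])
      show "integrable lborel (\<lambda>x. (3 * cmod (f x)) powr p)"
        unfolding powr_mult by (rule integrable_mult_right[OF fp])
      show "cmod (f x - F m x) \<le> 3 * cmod (f x)" for m x
        using norm_triangle_ineq4[of "f x" "F m x"] F2[of m x] by simp
    qed (use F mf in auto)
  qed
qed

lemma approximable_in_Lp:
  assumes a: "\<And>k. Im (a k) > 0"
    and div: "filterlim (\<lambda>n. \<Sum>k<n. \<bar>Im (a k)\<bar> / (1 + (cmod (a k))^2)) at_top sequentially"
    and p: "1 < p" and f: "in_Lp p f"
  shows "approximable a p f"
proof (rule approximable_limit[of a, OF a p f])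
  have p0: "0 < p" using p by simp
  have mf[measurable]: "f \<in> borel_measurable borel" using f by (simp add: in_Lp_def)
  show "approximable a p (trunc f m)" for m
    by (rule approximable_bounded_support[of a, OF a div p trunc_bounded_support[OF mf]])
  show "(\<lambda>m. pmass p (\<lambda>x. f x - trunc f m x)) \<longlonglongrightarrow> 0"
  proof (rule pmass_dominated[OF p0, where w = "\<lambda>x. cmod (f x)"])
    show "integrable lborel (\<lambda>x. cmod (f x) powr p)" using f by (simp add: in_Lp_def)
    show "cmod (f x - trunc f m x) \<le> cmod (f x)" for m x by (simp add: trunc_def)
    show "AE x in lborel. (\<lambda>m. trunc f m x) \<longlonglongrightarrow> f x" by (intro AE_I2 trunc_tendsto)
  qed measurable
qed

theorem theorem1:
  fixes a :: "nat \<Rightarrow> complex" and p :: real and f :: "real \<Rightarrow> complex"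
  assumes "\<And>k. Im (a k) > 0"
    and "filterlim (\<lambda>n. \<Sum>k<n. \<bar>Im (a k)\<bar> / (1 + (cmod (a k))^2)) at_top sequentially"
    and "1 < p"
    and "f \<in> borel_measurable lborel"
    and "integrable lborel (\<lambda>x. cmod (f x) powr p)"
  shows "(\<lambda>n. \<integral>\<^sup>+ x. ennreal (cmod (f x - Spart f a n x) powr p) \<partial>lborel) \<longlonglongrightarrow> 0"
proof -
  have "in_Lp p f" using assms(4,5) by (simp add: in_Lp_def)
  then have "approximable a p f" by (rule approximable_in_Lp[of a, OF assms(1,2,3)])
  then show ?thesis by (simp add: approximable_def pmass_def)
qed

end
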